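(* Let $M$ be a timelike rotational surface (double rotational surface) in $\mathbb{E}^4_1$ parametrized by $r(s,t)=(x(s)\cos at,\ x(s)\sin at,\ w(s)\sinh bt,\ w(s)\cosh bt)$. Then $M$ has pointwise 1-type Gauss map of the first kind if and only if $M$ is an open part of a timelike plane or an open part of a surface $$F(s,t)=\left(r_0\cosh\left(\tfrac{s}{r_0}\right)\cos at,\ r_0\cosh\left(\tfrac{s}{r_0}\right)\sin at,\ r_0\sinh\left(\tfrac{s}{r_0}\right)\sinh bt,\ r_0\sinh\left(\tfrac{s}{r_0}\right)\cosh bt\right)$$ for some constant $r_0\neq 0$. Moreover, the Gauss map $\nu$ of the surface $F$ satisfies $\Delta\nu=f(\nu+C)$ with $C=0$ and $$f=\|h\|^2=\frac{2}{r_0^2}\left(1-\frac{a^2b^2}{\left(a^2\cosh^2\left(\frac{s}{r_0}\right)+b^2\sinh^2\left(\frac{s}{r_0}\right)\right)^2}\right).$$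
   Context: $\mathbb{E}^4_1$ is $\mathbb{R}^4$ with the metric $g=dx_1^2+dx_2^2+dx_3^2-dx_4^2$, and $\langle\cdot,\cdot\rangle$ is the associated indefinite inner product. Double rotational surface: $a,b$ are nonzero real constants; $\gamma(s)=(x(s),0,0,w(s))$ is a smooth timelike curve on an open interval, parametrized by arc length, i.e. $x'(s)^2-w'(s)^2=-1$; the surface is $r(s,t)=(x(s)\cos at,x(s)\sin at,w(s)\sinh bt,w(s)\cosh bt)$, $t\in(0,2\pi)$, with $a^2x^2+b^2w^2>0$ (so the induced metric is Lorentzian, i.e. the surface is timelike). A timelike plane is an affine 2-plane with Lorentzian induced metric. Let $\{e_1,e_2,e_3,e_4\}$ be an oriented local orthonormal frame with $e_1,e_2$ tangent and $e_3,e_4$ normal to $M$, $\varepsilon_A=\langle e_A,e_A\rangle=\pm1$. The Gauss map is $\nu=e_3\wedge e_4$, viewed as a map $M\to\Lambda^2\mathbb{E}^4_1\cong\mathbb{E}^6_s$ (pseudo-Euclidean space for the inner product induced on $\Lambda^2$ by determinants). The Laplacian on $M$ is $\Delta=\sum_{i=1}^2\varepsilon_i(\nabla_{e_i}e_i-e_ie_i)$, where $\nabla$ is the Levi-Civita connection of $M$, applied componentwise to vector-valued maps. $M$ has pointwise 1-type Gauss map if $\Delta\nu=f(\nu+C)$ for some smooth function $f$ on $M$ and some constant vector $C\in\Lambda^2\mathbb{E}^4_1$; it is of the first kind if $C=0$, and of the second kind otherwise. Convention: planes (for which $\nu$ is constant) are regarded as having pointwise 1-type Gauss map both of the first kind (with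 $f=0$) and of the second kind (with $C=-\nu$ and $f$ any nonzero function). $h$ is the second fundamental form, $h^r_{ij}=\langle h(e_i,e_j),e_r\rangle$, and $\|h\|^2=\sum_{i,j,r}\varepsilon_i\varepsilon_j\varepsilon_r h^r_{ij}h^r_{ji}$ with $i,j\in\{1,2\}$, $r\in\{3,4\}$. *)

theory Defs
  imports "HOL-Analysis.Analysis"
begin

text \<open>\<open>C\<^sup>n\<close> on an open set: in finite dimension \<open>f\<close> is \<open>C\<^sup>n\<^sup>+\<^sup>1\<close> iff it is differentiable and all its
  directional derivatives are \<open>C\<^sup>n\<close>. Only used for open \<open>U\<close> and finite-dimensional domains.\<close>

primrec Cn_on :: "nat \<Rightarrow> 'a::real_normed_vector set \<Rightarrow> ('a \<Rightarrow> 'b::real_normed_vector) \<Rightarrow> bool" where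
  "Cn_on 0 U f = continuous_on U f"
| "Cn_on (Suc n) U f =
     ((\<forall>p\<in>U. f differentiable (at p)) \<and>
      (\<forall>v. Cn_on n U (\<lambda>p. frechet_derivative f (at p) v)))"

definition smooth_on :: "'a::real_normed_vector set \<Rightarrow> ('a \<Rightarrow> 'b::real_normed_vector) \<Rightarrow> bool" where
  "smooth_on U f \<longleftrightarrow> (\<forall>n. Cn_on n U f)"

subsection \<open>The space $E^4_1$ and its second exterior power\<close>

definition mink :: "real^4 \<Rightarrow> real^4 \<Rightarrow> real" where
  "mink u v = u$1 * v$1 + u$2 * v$2 + u$3 * v$3 - u$4 * v$4"

text \<open>The second exterior power is modelled by the (six-dimensional) space of skew-symmetric
  matrices, \<open>u \<and> v\<close> being the matrix of Pluecker coordinates \<open>u\<^sub>i v\<^sub>j - u\<^sub>j v\<^sub>i\<close>.\<close>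

definition wedge :: "real^4 \<Rightarrow> real^4 \<Rightarrow> real^4^4" where
  "wedge u v = (\<chi> i j. u$i * v$j - u$j * v$i)"

definition Lambda2 :: "(real^4^4) set" where
  "Lambda2 = span {wedge u v |u v. True}"

text \<open>An affine plane whose direction has an orthonormal basis of signature \<open>(+,-)\<close>; such a pair
  \<open>u, v\<close> is automatically linearly independent.\<close>

definition timelike_plane :: "(real^4) set \<Rightarrow> bool" where
  "timelike_plane P \<longleftrightarrow>
     (\<exists>c u v. mink u u = 1 \<and> mink v v = -1 \<and> mink u v = 0 \<and>
        P = {c + \<alpha> *\<^sub>R u + \<beta> *\<^sub>R v |\<alpha> \<beta>. True})"

definition open_part :: "(real^4) set \<Rightarrow> (real^4) set \<Rightarrow> bool" where
  "open_part M S \<longleftrightarrow> openin (top_of_set S) M"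

subsection \<open>Geometry of a parametrized surface\<close>

text \<open>A surface is given by a parametrization \<open>r\<close> on an open subset of \<open>\<real>\<^sup>2\<close>. Functions on the
  surface are functions of the parameters, and a tangent vector field is given by its components
  \<open>X\<close> in the coordinate basis; the corresponding vector in \<open>\<real>\<^sup>4\<close> is \<open>D X r\<close>.\<close>

definition D :: "(real^2 \<Rightarrow> real^2) \<Rightarrow> (real^2 \<Rightarrow> 'b::real_normed_vector) \<Rightarrow> real^2 \<Rightarrow> 'b" where
  "D X \<phi> p = frechet_derivative \<phi> (at p) (X p)"

definition partial :: "2 \<Rightarrow> (real^2 \<Rightarrow> 'b::real_normed_vector) \<Rightarrow> real^2 \<Rightarrow> 'b" where
  "partial i = D (\<lambda>p. axis i 1)"

definition first_ff :: "(real^2 \<Rightarrow> real^4) \<Rightarrow> real^2 \<Rightarrow> real^2^2" where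
  "first_ff r p = (\<chi> i j. mink (partial i r p) (partial j r p))"

definition christoffel :: "(real^2 \<Rightarrow> real^4) \<Rightarrow> real^2 \<Rightarrow> 2 \<Rightarrow> 2 \<Rightarrow> 2 \<Rightarrow> real" where
  "christoffel r p k i j =
     (\<Sum>l\<in>UNIV. matrix_inv (first_ff r p) $ k $ l *
        (partial i (\<lambda>q. first_ff r q $ j $ l) p +
         partial j (\<lambda>q. first_ff r q $ i $ l) p -
         partial l (\<lambda>q. first_ff r q $ i $ j) p)) / 2"

text \<open>The Levi-Civita connection of the induced metric.\<close>

definition nabla :: "(real^2 \<Rightarrow> real^4) \<Rightarrow> (real^2 \<Rightarrow> real^2) \<Rightarrow> (real^2 \<Rightarrow> real^2) \<Rightarrow> real^2 \<Rightarrow> real^2" where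
  "nabla r X Y p =
     (\<chi> k. D X Y p $ k + (\<Sum>i\<in>UNIV. \<Sum>j\<in>UNIV. christoffel r p k i j * X p $ i * Y p $ j))"

text \<open>The second fundamental form by the Gauss formula: the derivative of \<open>Y\<close> along \<open>X\<close> in the
  ambient flat space is \<open>\<nabla>\<^sub>X Y + h(X,Y)\<close>.\<close>

definition second_ff :: "(real^2 \<Rightarrow> real^4) \<Rightarrow> (real^2 \<Rightarrow> real^2) \<Rightarrow> (real^2 \<Rightarrow> real^2) \<Rightarrow> real^2 \<Rightarrow> real^4" where
  "second_ff r X Y p = D X (D Y r) p - D (nabla r X Y) r p"

text \<open>Oriented local orthonormal frames on the open set \<open>V\<close> of parameters: \<open>e 1, e 2\<close> are tangent
  with coordinate components \<open>E 1, E 2\<close>, and \<open>e 3, e 4\<close> are normal. The surface is oriented by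
  its parametrization, so that \<open>e 3 \<and> e 4\<close> does not depend on the choice of the frame.\<close>

definition oriented_frame ::
  "(real^2 \<Rightarrow> real^4) \<Rightarrow> (real^2) set \<Rightarrow> (nat \<Rightarrow> real^2 \<Rightarrow> real^2) \<Rightarrow> (nat \<Rightarrow> real^2 \<Rightarrow> real^4) \<Rightarrow> bool" where
  "oriented_frame r V E e \<longleftrightarrow>
     open V \<and>
     (\<forall>i\<in>{1,2}. smooth_on V (E i)) \<and> (\<forall>A\<in>{1..4}. smooth_on V (e A)) \<and>
     (\<forall>p\<in>V.
        (\<forall>i\<in>{1,2}. e i p = D (E i) r p) \<and>
        (\<forall>k\<in>{3,4}. \<forall>j. mink (e k p) (partial j r p) = 0) \<and>
        (\<forall>A\<in>{1..4}. \<forall>B\<in>{1..4}. A \<noteq> B \<longrightarrow> mink (e A p) (e B p) = 0) \<and>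
        (\<forall>A\<in>{1..4}. mink (e A p) (e A p) \<in> {1, -1}) \<and>
        det (vector [E 1 p, E 2 p] :: real^2^2) > 0 \<and>
        det (vector [e 1 p, e 2 p, e 3 p, e 4 p] :: real^4^4) > 0)"

text \<open>The following three notions are independent of the frame.\<close>

definition gauss_map :: "(real^2 \<Rightarrow> real^4) \<Rightarrow> real^2 \<Rightarrow> real^4^4" where
  "gauss_map r p =
     (THE n. \<exists>V E e. oriented_frame r V E e \<and> p \<in> V \<and> n = wedge (e 3 p) (e 4 p))"

definition laplacian :: "(real^2 \<Rightarrow> real^4) \<Rightarrow> (real^2 \<Rightarrow> 'b::real_normed_vector) \<Rightarrow> real^2 \<Rightarrow> 'b" where
  "laplacian r \<phi> p =
     (THE y. \<exists>V E e. oriented_frame r V E e \<and> p \<in> V \<and>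
        y = (\<Sum>i\<in>{1,2}. mink (e i p) (e i p) *\<^sub>R
               (D (nabla r (E i) (E i)) \<phi> p - D (E i) (D (E i) \<phi>) p)))"

definition second_ff_norm_sq :: "(real^2 \<Rightarrow> real^4) \<Rightarrow> real^2 \<Rightarrow> real" where
  "second_ff_norm_sq r p =
     (THE y. \<exists>V E e. oriented_frame r V E e \<and> p \<in> V \<and>
        y = (\<Sum>i\<in>{1,2}. \<Sum>j\<in>{1,2}. \<Sum>k\<in>{3,4}.
               mink (e i p) (e i p) * mink (e j p) (e j p) * mink (e k p) (e k p) *
               mink (second_ff r (E i) (E j) p) (e k p) *
               mink (second_ff r (E j) (E i) p) (e k p)))"

definition pointwise_1_type ::
  "(real^2) set \<Rightarrow> (real^2 \<Rightarrow> real^4) \<Rightarrow> (real^2 \<Rightarrow> real) \<Rightarrow> real^4^4 \<Rightarrow> bool" where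
  "pointwise_1_type U r f C \<longleftrightarrow>
     smooth_on U f \<and> C \<in> Lambda2 \<and>
     (\<forall>p\<in>U. laplacian r (gauss_map r) p = f p *\<^sub>R (gauss_map r p + C))"

text \<open>Planes are included: there \<open>f = 0\<close>.\<close>

definition pointwise_1_type_first_kind :: "(real^2) set \<Rightarrow> (real^2 \<Rightarrow> real^4) \<Rightarrow> bool" where
  "pointwise_1_type_first_kind U r \<longleftrightarrow> (\<exists>f. pointwise_1_type U r f 0)"

subsection \<open>Double rotational surfaces\<close>

definition double_rot ::
  "real \<Rightarrow> real \<Rightarrow> (real \<Rightarrow> real) \<Rightarrow> (real \<Rightarrow> real) \<Rightarrow> real^2 \<Rightarrow> real^4" where
  "double_rot a b x w p = (let s = p$1; t = p$2 in
     vector [x s * cos (a*t), x s * sin (a*t), w s * sinh (b*t), w s * cosh (b*t)])"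

definition rot_domain :: "real set \<Rightarrow> (real^2) set" where
  "rot_domain I = {p. p$1 \<in> I \<and> p$2 \<in> {0<..<2*pi}}"

definition F_surface :: "real \<Rightarrow> real \<Rightarrow> real \<Rightarrow> real^2 \<Rightarrow> real^4" where
  "F_surface a b r0 = double_rot a b (\<lambda>s. r0 * cosh (s/r0)) (\<lambda>s. r0 * sinh (s/r0))"

end

theory Submission
  imports Defs
begin

text \<open>Write \<open>r = x c\<^sub>1 + w c\<^sub>4\<close> in the rotating basis \<open>c\<^sub>1 = (cos at, sin at, 0, 0)\<close>,
  \<open>c\<^sub>2 = (-sin at, cos at, 0, 0)\<close>, \<open>c\<^sub>3 = (0, 0, cosh bt, sinh bt)\<close>, \<open>c\<^sub>4 = (0, 0, sinh bt, cosh bt)\<close>.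
  In the frame \<open>e\<^sub>1 = r\<^sub>s\<close>, \<open>e\<^sub>2 = r\<^sub>t/q\<close>, \<open>e\<^sub>3 = w' c\<^sub>1 + x' c\<^sub>4\<close>, \<open>e\<^sub>4 = (-bw c\<^sub>2 + ax c\<^sub>3)/q\<close> with
  \<open>q\<^sup>2 = a\<^sup>2x\<^sup>2 + b\<^sup>2w\<^sup>2\<close>, all structure functions depend on \<open>s\<close> only, and the Codazzi equations reduce
  \<open>\<Delta>\<nu>\<close> to \<open>\<parallel>h\<parallel>\<^sup>2 \<nu> + 2\<tau>(\<mu> - \<kappa>) e\<^sub>1 \<and> e\<^sub>2 + (\<kappa> + \<mu>)' e\<^sub>1 \<and> e\<^sub>4 + (\<kappa> + \<mu>)\<sigma> e\<^sub>2 \<and> e\<^sub>3\<close>. So the first kind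
  means: the normal bundle is flat and the mean curvature vector is parallel. If \<open>\<kappa> + \<mu>\<close> is a nonzero
  constant, then \<open>\<sigma> = 0\<close>, i.e. \<open>xx' = ww'\<close>, and the profile curve lies on a hyperbola
  \<open>x\<^sup>2 - w\<^sup>2 = r\<^sub>0\<^sup>2\<close>. If \<open>\<kappa> + \<mu> = 0\<close>, then \<open>\<tau>\<close> and \<open>\<kappa>\<close> vanish, which forces \<open>x = 0\<close>: a plane.
  Conversely, a plane containing the surface has a nonzero linear functional constant on it, which
  contradicts the linear independence of \<open>1, cos at, sin at, sinh bt, cosh bt\<close> unless \<open>x = 0\<close>.\<close>

subsection \<open>Smooth functions\<close>

text \<open>The Gauss map, the Laplacian and the squared norm of \<open>h\<close> are definite
  descriptions over arbitrary oriented frames, so one good frame does not evaluate them: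
  independence of the frame has to be proved. For the last two it is a contraction with the inverse
  metric, which equals the sum of \<epsilon> e \<otimes> e over a tangent orthonormal frame. For the
  Gauss map it holds because the normal planes are positive definite: equally oriented normal frames
  differ by a rotation.

  The extra coefficients in \<Delta>\<nu> have a meaning. The trace of \<open>h\<close> is
  -(\<kappa> + \<mu>) \<open>e\<^sub>3\<close>, so the last two are, up to constants, the normal
  derivatives of the mean curvature vector. The shape operators of \<open>e\<^sub>3\<close> and
  \<open>e\<^sub>4\<close> are diagonal and off-diagonal; \<tau>(\<mu> - \<kappa>) measures their
  commutator, hence the normal curvature.

  The equation \<tau>(\<mu> - \<kappa>) = 0 is only an alternative at each point, so the case
  \<kappa> + \<mu> = 0 has to be decided on the open set where \<tau> is nonzero. Being an open part
  concerns images, not parametrizations; it is proved with a function on the ambient space that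
  recovers \<open>w\<close> from a point.\<close>

lemma Cn_on_cong:
  assumes "open U" "\<And>p. p \<in> U \<Longrightarrow> f p = g p"
  shows "Cn_on n U f \<longleftrightarrow> Cn_on n U g"
  using assms(2)
proof (induction n arbitrary: f g)
  case 0
  then show ?case by (simp cong: continuous_on_cong)
next
  case (Suc n)
  have hd: "(f has_derivative F) (at p) \<longleftrightarrow> (g has_derivative F) (at p)" if "p \<in> U" for p F
    using Suc.prems that assms(1) by (metis has_derivative_transform_within_open)
  have "frechet_derivative f (at p) = frechet_derivative g (at p)" if "p \<in> U" for p
    unfolding frechet_derivative_def using hd[OF that] by simp
  moreover have "f differentiable (at p) \<longleftrightarrow> g differentiable (at p)" if "p \<in> U" for p
    unfolding differentiable_def using hd[OF that] by simp
  ultimately show ?case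
    using Suc.IH[of "\<lambda>p. frechet_derivative f (at p) v" "\<lambda>p. frechet_derivative g (at p) v" for v]
    by simp
qed

lemma smooth_on_cong:
  "open U \<Longrightarrow> (\<And>p. p \<in> U \<Longrightarrow> f p = g p) \<Longrightarrow> smooth_on U f \<longleftrightarrow> smooth_on U g"
  unfolding smooth_on_def using Cn_on_cong by blast

text \<open>\<open>Cn_on\<close> speaks of \<open>frechet_derivative\<close>, a choice operator. An
  explicit derivative formula valid on the open set \<open>U\<close> may replace it, because
  \<open>Cn_on_cong\<close> ignores what happens outside \<open>U\<close>.\<close>

lemma Cn_on_SucI:
  assumes "open U" "\<And>p. p \<in> U \<Longrightarrow> (f has_derivative f' p) (at p)"
    and "\<And>v. Cn_on n U (\<lambda>p. f' p v)"
  shows "Cn_on (Suc n) U f"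
proof -
  have "frechet_derivative f (at p) = f' p" if "p \<in> U" for p
    using assms(2)[OF that] by (metis frechet_derivative_at)
  then have "Cn_on n U (\<lambda>p. frechet_derivative f (at p) v)" for v
    using Cn_on_cong[OF assms(1), of "\<lambda>p. frechet_derivative f (at p) v" "\<lambda>p. f' p v"] assms(3)
    by simp
  with assms(2) show ?thesis by (auto simp: differentiable_def)
qed

lemma Cn_on_Suc_has_derivative:
  "Cn_on (Suc n) U f \<Longrightarrow> p \<in> U \<Longrightarrow> (f has_derivative frechet_derivative f (at p)) (at p)"
  by (simp add: frechet_derivative_works)

lemma Cn_on_SucD: "Cn_on (Suc n) U f \<Longrightarrow> Cn_on n U f"
proof (induction n arbitrary: f)
  case 0
  then show ?case
    by (auto intro!: continuous_at_imp_continuous_on differentiable_imp_continuous_within)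
qed auto

lemma Cn_on_const: "open U \<Longrightarrow> Cn_on n U (\<lambda>p. c)"
  by (induction n arbitrary: c) auto

lemma Cn_on_linear:
  assumes "open U" "bounded_linear L"
  shows "Cn_on n U L"
proof (cases n)
  case 0
  then show ?thesis using assms linear_continuous_on by auto
next
  case (Suc m)
  show ?thesis unfolding Suc
    by (rule Cn_on_SucI[where f' = "\<lambda>p. L"])
      (auto intro: assms bounded_linear_imp_has_derivative Cn_on_const)
qed

lemma Cn_on_add:
  assumes "open U" "Cn_on n U f" "Cn_on n U g"
  shows "Cn_on n U (\<lambda>p. f p + g p)"
  using assms(2,3)
proof (induction n arbitrary: f g)
  case 0
  then show ?case by (auto intro!: continuous_intros)
next
  case (Suc n)
  show ?case
    by (rule Cn_on_SucI[OF assms(1)],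
        rule has_derivative_add[OF Cn_on_Suc_has_derivative[OF Suc.prems(1)]
          Cn_on_Suc_has_derivative[OF Suc.prems(2)]])
      (use Suc in auto)
qed

text \<open>The product rule yields a sum of products of the same kind in which one factor is
  differentiated and the other loses one order by \<open>Cn_on_SucD\<close>; hence the induction
  leaves both factors arbitrary.\<close>

lemma Cn_on_bilinear:
  assumes "open U" "bounded_bilinear B" "Cn_on n U f" "Cn_on n U g"
  shows "Cn_on n U (\<lambda>p. B (f p) (g p))"
  using assms(3,4)
proof (induction n arbitrary: f g)
  case 0
  then show ?case by (auto intro: bounded_bilinear.continuous_on[OF assms(2)])
next
  case (Suc n)
  show ?case
  proof (rule Cn_on_SucI[OF assms(1)])
    show "((\<lambda>p. B (f p) (g p)) has_derivative
        (\<lambda>v. B (f p) (frechet_derivative g (at p) v) + B (frechet_derivative f (at p) v) (g p))) (at p)"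
      if "p \<in> U" for p
      using bounded_bilinear.FDERIV[OF assms(2) Cn_on_Suc_has_derivative[OF Suc.prems(1) that]
          Cn_on_Suc_has_derivative[OF Suc.prems(2) that]] .
    show "Cn_on n U (\<lambda>p. B (f p) (frechet_derivative g (at p) v) + B (frechet_derivative f (at p) v) (g p))" for v
      using Suc.prems by (intro Cn_on_add assms(1) Suc.IH Cn_on_SucD[of n U f] Cn_on_SucD[of n U g]) auto
  qed
qed

text \<open>For an outer function of a real variable the derivative is scaling by the single vector
  \<open>?g'\<close>. The chain rule therefore gives a \<open>scaleR\<close> product whose second
  factor is again a composition, and the induction closes without multilinear derivatives.\<close>

lemma Cn_on_compose:
  fixes g :: "real \<Rightarrow> 'b::real_normed_vector"
  assumes "open U" "open T" "Cn_on n T g" "Cn_on n U f" "f ` U \<subseteq> T"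
  shows "Cn_on n U (\<lambda>p. g (f p))"
  using assms(3,4)
proof (induction n arbitrary: g)
  case 0
  then show ?case using assms(5) by (auto intro: continuous_on_compose2)
next
  case (Suc n)
  let ?g' = "\<lambda>y. frechet_derivative g (at y) 1"
  show ?case
  proof (rule Cn_on_SucI[OF assms(1)])
    show "((\<lambda>p. g (f p)) has_derivative (\<lambda>v. frechet_derivative f (at p) v *\<^sub>R ?g' (f p))) (at p)"
      if p: "p \<in> U" for p
    proof -
      have g: "(g has_derivative frechet_derivative g (at (f p))) (at (f p))"
        using Cn_on_Suc_has_derivative[OF Suc.prems(1)] p assms(5) by blast
      then have lin: "linear (frechet_derivative g (at (f p)))"
        by (rule has_derivative_linear)
      have "frechet_derivative g (at (f p)) u = u *\<^sub>R ?g' (f p)" for u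
        using linear_scale[OF lin, of u 1] by simp
      then have eq: "frechet_derivative g (at (f p)) = (\<lambda>u. u *\<^sub>R ?g' (f p))"
        by blast
      have "(g has_derivative (\<lambda>u. u *\<^sub>R ?g' (f p))) (at (f p))"
        by (rule subst[OF eq, of "\<lambda>F. (g has_derivative F) (at (f p))", OF g])
      then show ?thesis
        by (rule has_derivative_compose[OF Cn_on_Suc_has_derivative[OF Suc.prems(2) p]])
    qed
    show "Cn_on n U (\<lambda>p. frechet_derivative f (at p) v *\<^sub>R ?g' (f p))" for v
      using Suc.prems
      by (intro Cn_on_bilinear[OF assms(1) bounded_bilinear_scaleR] Suc.IH Cn_on_SucD[of n U f]) auto
  qed
qed

lemma Cn_on_sum:
  assumes "open U" "\<And>i. i \<in> A \<Longrightarrow> Cn_on n U (f i)"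
  shows "Cn_on n U (\<lambda>p. \<Sum>i\<in>A. f i p)"
  using assms(2) by (induction A rule: infinite_finite_induct)
    (simp_all add: Cn_on_add[OF assms(1)] Cn_on_const[OF assms(1)])

lemma smooth_on_const: "open U \<Longrightarrow> smooth_on U (\<lambda>p. c)"
  by (simp add: smooth_on_def Cn_on_const)

lemma smooth_on_linear: "open U \<Longrightarrow> bounded_linear L \<Longrightarrow> smooth_on U L"
  by (simp add: smooth_on_def Cn_on_linear)

lemma smooth_on_add:
  "open U \<Longrightarrow> smooth_on U f \<Longrightarrow> smooth_on U g \<Longrightarrow> smooth_on U (\<lambda>p. f p + g p)"
  by (simp add: smooth_on_def Cn_on_add)

lemma smooth_on_scaleR:
  "open U \<Longrightarrow> smooth_on U f \<Longrightarrow> smooth_on U g \<Longrightarrow> smooth_on U (\<lambda>p. f p *\<^sub>R g p)"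
  by (simp add: smooth_on_def Cn_on_bilinear[OF _ bounded_bilinear_scaleR])

lemma smooth_on_mult:
  fixes f g :: "'a::real_normed_vector \<Rightarrow> real"
  shows "open U \<Longrightarrow> smooth_on U f \<Longrightarrow> smooth_on U g \<Longrightarrow> smooth_on U (\<lambda>p. f p * g p)"
  using smooth_on_scaleR[of U f g] by simp

lemma smooth_on_minus: "open U \<Longrightarrow> smooth_on U f \<Longrightarrow> smooth_on U (\<lambda>p. - f p)"
  using smooth_on_scaleR[of U "\<lambda>p. -1" f] smooth_on_const[of U "-1::real"] by simp

lemma smooth_on_diff:
  "open U \<Longrightarrow> smooth_on U f \<Longrightarrow> smooth_on U g \<Longrightarrow> smooth_on U (\<lambda>p. f p - g p)"
  using smooth_on_add[of U f "\<lambda>p. - g p"] smooth_on_minus[of U g] by simp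

lemma smooth_on_power:
  fixes f :: "'a::real_normed_vector \<Rightarrow> real"
  shows "open U \<Longrightarrow> smooth_on U f \<Longrightarrow> smooth_on U (\<lambda>p. f p ^ k)"
  by (induction k) (simp_all add: smooth_on_const smooth_on_mult)

lemma smooth_on_compose:
  fixes g :: "real \<Rightarrow> 'b::real_normed_vector"
  assumes "smooth_on T g" "open T" "open U" "smooth_on U f" "f ` U \<subseteq> T"
  shows "smooth_on U (\<lambda>p. g (f p))"
  using assms by (simp add: smooth_on_def Cn_on_compose)

lemma smooth_on_compose_UNIV:
  fixes g :: "real \<Rightarrow> 'b::real_normed_vector"
  assumes "open U" "smooth_on UNIV g" "smooth_on U f"
  shows "smooth_on U (\<lambda>p. g (f p))"
  using assms smooth_on_compose[of UNIV g U f] by simp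

lemma smooth_on_vec:
  fixes f :: "'a::real_normed_vector \<Rightarrow> real^'n"
  assumes "open U" "\<And>i. smooth_on U (\<lambda>p. f p $ i)"
  shows "smooth_on U f"
proof -
  have expand: "f p = (\<Sum>i\<in>UNIV. (f p $ i) *\<^sub>R (axis i 1 :: real^'n))" for p
    by (auto simp: vec_eq_iff axis_def if_distrib cong: if_cong)
  have "Cn_on n U f \<longleftrightarrow> Cn_on n U (\<lambda>p. \<Sum>i\<in>UNIV. (f p $ i) *\<^sub>R (axis i 1 :: real^'n))" for n
    by (rule Cn_on_cong[OF assms(1)]) (rule expand)
  moreover have "Cn_on n U (\<lambda>p. \<Sum>i\<in>UNIV. (f p $ i) *\<^sub>R (axis i 1 :: real^'n))" for n
    using assms unfolding smooth_on_def
    by (intro Cn_on_sum Cn_on_bilinear[OF _ bounded_bilinear_scaleR] Cn_on_const) auto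
  ultimately show ?thesis by (simp add: smooth_on_def)
qed

section \<open>Smoothness of elementary functions\<close>

lemma smooth_on_exp: "smooth_on UNIV (exp :: real \<Rightarrow> real)"
proof -
  have "Cn_on n UNIV (exp :: real \<Rightarrow> real)" for n
  proof (induction n)
    case 0
    then show ?case by (auto intro!: continuous_intros)
  next
    case (Suc n)
    show ?case
    proof (rule Cn_on_SucI)
      show "(exp has_derivative (\<lambda>v. exp p * v)) (at p)" for p :: real
        by (metis DERIV_exp has_field_derivative_def)
      show "Cn_on n UNIV (\<lambda>p. exp p * v)" for v :: real
        by (rule Cn_on_bilinear[OF open_UNIV bounded_bilinear_mult Suc Cn_on_const]) simp
    qed simp
  qed
  then show ?thesis by (simp add: smooth_on_def)
qed

lemma smooth_on_sin_cos:
  "smooth_on UNIV (sin :: real \<Rightarrow> real)" "smooth_on UNIV (cos :: real \<Rightarrow> real)"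
proof -
  \<comment> \<open>Each derivative is a multiple of the other function, so one induction carries
    both.\<close>
  have "Cn_on n UNIV (sin :: real \<Rightarrow> real) \<and> Cn_on n UNIV (cos :: real \<Rightarrow> real)" for n
  proof (induction n)
    case 0
    then show ?case by (auto intro!: continuous_intros)
  next
    case (Suc n)
    have "Cn_on (Suc n) UNIV (sin :: real \<Rightarrow> real)"
    proof (rule Cn_on_SucI)
      show "(sin has_derivative (\<lambda>v. cos p * v)) (at p)" for p :: real
        by (metis DERIV_sin has_field_derivative_def)
      show "Cn_on n UNIV (\<lambda>p. cos p * v)" for v :: real
        using Suc by (intro Cn_on_bilinear[OF open_UNIV bounded_bilinear_mult] Cn_on_const) auto
    qed simp
    moreover have "Cn_on (Suc n) UNIV (cos :: real \<Rightarrow> real)"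
    proof (rule Cn_on_SucI)
      show "(cos has_derivative (\<lambda>v. sin p * - v)) (at p)" for p :: real
        by (rule has_derivative_eq_rhs[OF DERIV_cos[of p, unfolded has_field_derivative_def]]) auto
      show "Cn_on n UNIV (\<lambda>p. sin p * - v)" for v :: real
        using Suc by (intro Cn_on_bilinear[OF open_UNIV bounded_bilinear_mult] Cn_on_const) auto
    qed simp
    ultimately show ?case by blast
  qed
  then show "smooth_on UNIV (sin :: real \<Rightarrow> real)" "smooth_on UNIV (cos :: real \<Rightarrow> real)"
    by (auto simp: smooth_on_def)
qed

lemma smooth_on_sinh_cosh:
  "smooth_on UNIV (sinh :: real \<Rightarrow> real)" "smooth_on UNIV (cosh :: real \<Rightarrow> real)"
proof -
  have m: "smooth_on UNIV (\<lambda>x::real. exp (- x))"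
    by (rule smooth_on_compose_UNIV[OF open_UNIV smooth_on_exp])
      (intro smooth_on_linear open_UNIV bounded_linear_minus bounded_linear_ident)
  have "smooth_on UNIV (\<lambda>x::real. (1/2) *\<^sub>R (exp x - exp (- x)))"
    "smooth_on UNIV (\<lambda>x::real. (1/2) *\<^sub>R (exp x + exp (- x)))"
    by (intro smooth_on_scaleR smooth_on_const smooth_on_diff smooth_on_add smooth_on_exp m open_UNIV)+
  then show "smooth_on UNIV (sinh :: real \<Rightarrow> real)" "smooth_on UNIV (cosh :: real \<Rightarrow> real)"
    by (simp_all add: sinh_def [abs_def] cosh_def [abs_def])
qed

text \<open>The derivative is written as a product of two copies of \<open>inverse\<close>, so that
  the induction hypothesis and the product rule suffice.\<close>

lemma smooth_on_inverse: "smooth_on (- {0}) (inverse :: real \<Rightarrow> real)"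
proof -
  have op: "open (- {0::real})" by auto
  have "Cn_on n (- {0}) (inverse :: real \<Rightarrow> real)" for n
  proof (induction n)
    case 0
    then show ?case by (auto intro!: continuous_intros)
  next
    case (Suc n)
    show ?case
    proof (rule Cn_on_SucI)
      show "(inverse has_derivative (\<lambda>v. (inverse p * inverse p) * - v)) (at p)"
        if "p \<in> - {0}" for p :: real
        by (rule has_derivative_eq_rhs[OF DERIV_inverse[of p UNIV, unfolded has_field_derivative_def]])
          (use that in \<open>auto simp: power2_eq_square\<close>)
      show "Cn_on n (- {0}) (\<lambda>p. (inverse p * inverse p) * - v)" for v :: real
        using Suc op by (intro Cn_on_bilinear[OF op bounded_bilinear_mult] Cn_on_const) auto
    qed (rule op)
  qed
  then show ?thesis by (simp add: smooth_on_def)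
qed

text \<open>The derivative is half of \<open>inverse\<close> composed with \<open>sqrt\<close>
  itself, so the induction hypothesis for \<open>sqrt\<close> gives the next order.\<close>

lemma smooth_on_sqrt: "smooth_on {0<..} sqrt"
proof -
  have op: "open ({0<..}::real set)" by auto
  have "Cn_on n {0<..} sqrt" for n
  proof (induction n)
    case 0
    then show ?case by (auto intro!: continuous_intros)
  next
    case (Suc n)
    show ?case
    proof (rule Cn_on_SucI)
      show "(sqrt has_derivative (\<lambda>v. inverse (sqrt p) * (v / 2))) (at p)"
        if "p \<in> {0<..}" for p :: real
        by (rule has_derivative_eq_rhs[OF DERIV_real_sqrt[of p, unfolded has_field_derivative_def]])
          (use that in auto)
      show "Cn_on n {0<..} (\<lambda>p. inverse (sqrt p) * (v / 2))" for v :: real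
      proof (intro Cn_on_bilinear[OF op bounded_bilinear_mult] Cn_on_const op)
        show "Cn_on n {0<..} (\<lambda>p. inverse (sqrt p))"
          by (rule Cn_on_compose[OF op _ smooth_on_inverse[unfolded smooth_on_def, rule_format] Suc]) auto
      qed
    qed (rule op)
  qed
  then show ?thesis by (simp add: smooth_on_def)
qed

lemma smooth_on_inverse_compose:
  fixes f :: "'a::real_normed_vector \<Rightarrow> real"
  assumes "open U" "smooth_on U f" "\<And>p. p \<in> U \<Longrightarrow> f p \<noteq> 0"
  shows "smooth_on U (\<lambda>p. inverse (f p))"
  by (rule smooth_on_compose[OF smooth_on_inverse]) (use assms in auto)

lemma smooth_on_divide:
  fixes f g :: "'a::real_normed_vector \<Rightarrow> real"
  assumes "open U" "smooth_on U f" "smooth_on U g" "\<And>p. p \<in> U \<Longrightarrow> g p \<noteq> 0"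
  shows "smooth_on U (\<lambda>p. f p / g p)"
  unfolding divide_inverse using assms by (intro smooth_on_mult smooth_on_inverse_compose)

lemma smooth_on_sqrt_compose:
  fixes f :: "'a::real_normed_vector \<Rightarrow> real"
  assumes "open U" "smooth_on U f" "\<And>p. p \<in> U \<Longrightarrow> f p > 0"
  shows "smooth_on U (\<lambda>p. sqrt (f p))"
  by (rule smooth_on_compose[OF smooth_on_sqrt]) (use assms in auto)

lemmas smooth_on_intros =
  smooth_on_const smooth_on_add smooth_on_diff smooth_on_minus smooth_on_mult smooth_on_scaleR
  smooth_on_power smooth_on_divide smooth_on_sqrt_compose

lemma smooth_on_differentiable: "smooth_on U f \<Longrightarrow> p \<in> U \<Longrightarrow> f differentiable (at p)"
  using Cn_on.simps(2)[of 0 U f] unfolding smooth_on_def by blast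

lemma smooth_on_real_DERIV:
  fixes f :: "real \<Rightarrow> real"
  assumes "smooth_on U f" "s \<in> U"
  shows "(f has_real_derivative deriv f s) (at s)"
  using smooth_on_differentiable[OF assms] real_differentiable_def
  by (metis DERIV_imp_deriv)

lemma smooth_on_deriv:
  fixes f :: "real \<Rightarrow> real"
  assumes "smooth_on U f" "open U"
  shows "smooth_on U (deriv f)"
proof -
  have eq: "frechet_derivative f (at s) 1 = deriv f s" if "s \<in> U" for s
    using frechet_derivative_at[OF smooth_on_real_DERIV[OF assms(1) that, unfolded has_field_derivative_def]]
    by (metis mult.right_neutral)
  have "Cn_on n U (\<lambda>s. frechet_derivative f (at s) 1)" for n
    using assms(1) Cn_on.simps(2)[of n U f] unfolding smooth_on_def by blast
  then show ?thesis
    unfolding smooth_on_def using Cn_on_cong[OF assms(2), of "\<lambda>s. frechet_derivative f (at s) 1" "deriv f"] eq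
    by blast
qed

text \<open>Used to differentiate identities that hold throughout an open set, such as unit speed or
  the orthogonality of position and velocity.\<close>

lemma DERIV_eq_on_open:
  fixes f g :: "real \<Rightarrow> real"
  assumes "open S" "s \<in> S" "\<And>t. t \<in> S \<Longrightarrow> f t = g t"
    "(f has_real_derivative A) (at s)" "(g has_real_derivative B) (at s)"
  shows "A = B"
proof -
  have "(g has_real_derivative A) (at s)"
    using has_field_derivative_transform_within_open[OF assms(4,1,2)] assms(3) by blast
  then show ?thesis using assms(5) by (rule DERIV_unique)
qed

subsection \<open>Partial derivatives and linear algebra of Minkowski space\<close>

text \<open>A total derivative recorded by its two columns. This is stronger than the existence of
  partial derivatives and determines \<open>D X\<close> for every vector field
  \<open>X\<close>.\<close>

definition has_partials ::
  "(real^2 \<Rightarrow> 'b::real_normed_vector) \<Rightarrow> 'b \<Rightarrow> 'b \<Rightarrow> real^2 \<Rightarrow> bool" where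
  "has_partials \<phi> A B p \<longleftrightarrow> (\<phi> has_derivative (\<lambda>v. v$1 *\<^sub>R A + v$2 *\<^sub>R B)) (at p)"

lemma D_eq: "has_partials \<phi> A B p \<Longrightarrow> D X \<phi> p = X p $ 1 *\<^sub>R A + X p $ 2 *\<^sub>R B"
  unfolding has_partials_def D_def by (simp add: frechet_derivative_at[symmetric])

lemma partial_eq:
  assumes "has_partials \<phi> A B p"
  shows "partial 1 \<phi> p = A" "partial 2 \<phi> p = B"
  unfolding partial_def D_eq[OF assms] by (simp_all add: axis_def)

lemma differentiable_has_partials:
  assumes "\<phi> differentiable (at p)"
  shows "has_partials \<phi> (partial 1 \<phi> p) (partial 2 \<phi> p) p"
proof -
  let ?F = "frechet_derivative \<phi> (at p)"
  have F: "(\<phi> has_derivative ?F) (at p)"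
    using assms frechet_derivative_works by blast
  then have lin: "linear ?F" by (rule has_derivative_linear)
  have "?F v = v$1 *\<^sub>R partial 1 \<phi> p + v$2 *\<^sub>R partial 2 \<phi> p" for v
  proof -
    have "v = v$1 *\<^sub>R axis 1 1 + v$2 *\<^sub>R axis 2 1"
      by (simp add: vec_eq_iff forall_2 axis_def)
    then have "?F v = ?F (v$1 *\<^sub>R axis 1 1 + v$2 *\<^sub>R axis 2 1)" by simp
    then show ?thesis
      by (simp only: partial_def D_def linear_add[OF lin] linear_scale[OF lin])
  qed
  then show ?thesis
    unfolding has_partials_def by (intro has_derivative_eq_rhs[OF F] ext)
qed

lemma has_partials_cong:
  assumes "open U" "p \<in> U" "\<And>q. q \<in> U \<Longrightarrow> f q = g q" "has_partials f A B p"
  shows "has_partials g A B p"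
  unfolding has_partials_def
  by (rule has_derivative_transform_within_open[OF assms(4)[unfolded has_partials_def] assms(1-3)])

lemma has_partials_eq_rhs:
  "has_partials f A B p \<Longrightarrow> A = A' \<Longrightarrow> B = B' \<Longrightarrow> has_partials f A' B' p"
  by simp

lemma has_partials_const: "has_partials (\<lambda>p. c) 0 0 p"
  by (simp add: has_partials_def)

lemma has_partials_add:
  assumes "has_partials f A B p" "has_partials g A' B' p"
  shows "has_partials (\<lambda>p. f p + g p) (A + A') (B + B') p"
  unfolding has_partials_def
  by (rule has_derivative_eq_rhs[OF has_derivative_add[OF assms[unfolded has_partials_def]]])
    (simp add: algebra_simps)

lemma has_partials_bilinear:
  assumes "bounded_bilinear P" "has_partials f A B p" "has_partials g A' B' p"
  shows "has_partials (\<lambda>p. P (f p) (g p)) (P A (g p) + P (f p) A') (P B (g p) + P (f p) B') p"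
proof -
  interpret bounded_bilinear P by fact
  show ?thesis
    unfolding has_partials_def
    by (rule has_derivative_eq_rhs[OF FDERIV[OF assms(2,3)[unfolded has_partials_def]]])
      (simp add: fun_eq_iff add_left add_right scaleR_left scaleR_right algebra_simps)
qed

lemmas has_partials_scaleR = has_partials_bilinear[OF bounded_bilinear_scaleR]

lemma has_partials_nth:
  "has_partials f A B p \<Longrightarrow> has_partials (\<lambda>p. f p $ i) (A $ i) (B $ i) p"
  unfolding has_partials_def
  by (drule bounded_linear.has_derivative[OF bounded_linear_vec_nth]) simp

lemma has_partials_fst:
  assumes "(g has_vector_derivative g') (at (p$1))"
  shows "has_partials (\<lambda>p. g (p$1)) g' 0 p"
proof -
  have "((\<lambda>p::real^2. p$1) has_derivative (\<lambda>v. v$1)) (at p)"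
    by (intro bounded_linear_imp_has_derivative bounded_linear_vec_nth)
  from has_derivative_compose[OF this assms[unfolded has_vector_derivative_def]]
  show ?thesis by (simp add: has_partials_def)
qed

lemma has_partials_snd:
  assumes "(g has_vector_derivative g') (at (p$2))"
  shows "has_partials (\<lambda>p. g (p$2)) 0 g' p"
proof -
  have "((\<lambda>p::real^2. p$2) has_derivative (\<lambda>v. v$2)) (at p)"
    by (intro bounded_linear_imp_has_derivative bounded_linear_vec_nth)
  from has_derivative_compose[OF this assms[unfolded has_vector_derivative_def]]
  show ?thesis by (simp add: has_partials_def)
qed

lemma has_partials_vec:
  fixes f :: "real^2 \<Rightarrow> real^'n"
  assumes "\<And>i. has_partials (\<lambda>p. f p $ i) (A $ i) (B $ i) p"
  shows "has_partials f A B p"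
proof -
  have expand: "v = (\<Sum>i\<in>UNIV. (v $ i) *\<^sub>R (axis i 1 :: real^'n))" for v
    by (auto simp: vec_eq_iff axis_def if_distrib cong: if_cong)
  have "((\<lambda>p. \<Sum>i\<in>UNIV. (f p $ i) *\<^sub>R (axis i 1 :: real^'n)) has_derivative
      (\<lambda>v. \<Sum>i\<in>UNIV. (v$1 *\<^sub>R A $ i + v$2 *\<^sub>R B $ i) *\<^sub>R axis i 1)) (at p)"
    using assms unfolding has_partials_def
    by (intro has_derivative_sum has_derivative_scaleR_left) auto
  moreover have "(\<lambda>p. \<Sum>i\<in>UNIV. (f p $ i) *\<^sub>R (axis i 1 :: real^'n)) = f"
    using expand[symmetric] by blast
  moreover have "(\<Sum>i\<in>UNIV. (v$1 *\<^sub>R A $ i + v$2 *\<^sub>R B $ i) *\<^sub>R (axis i 1 :: real^'n))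
      = v$1 *\<^sub>R A + v$2 *\<^sub>R B" for v :: "real^2"
    using expand[of "v$1 *\<^sub>R A + v$2 *\<^sub>R B"] by simp
  ultimately show ?thesis
    by (simp add: has_partials_def)
qed

section \<open>Determinants, bivectors and orthonormal bases\<close>

lemma vector_4:
  "(vector [x,y,z,u] :: 'a::zero^4) $ 1 = x"
  "(vector [x,y,z,u] :: 'a::zero^4) $ 2 = y"
  "(vector [x,y,z,u] :: 'a::zero^4) $ 3 = z"
  "(vector [x,y,z,u] :: 'a::zero^4) $ 4 = u"
  unfolding vector_def by simp_all

lemma det_4:
  "det (A::'a::comm_ring_1^4^4) =
    A$1$1 * (A$2$2 * (A$3$3 * A$4$4 - A$3$4 * A$4$3)
           - A$2$3 * (A$3$2 * A$4$4 - A$3$4 * A$4$2)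
           + A$2$4 * (A$3$2 * A$4$3 - A$3$3 * A$4$2))
  - A$1$2 * (A$2$1 * (A$3$3 * A$4$4 - A$3$4 * A$4$3)
           - A$2$3 * (A$3$1 * A$4$4 - A$3$4 * A$4$1)
           + A$2$4 * (A$3$1 * A$4$3 - A$3$3 * A$4$1))
  + A$1$3 * (A$2$1 * (A$3$2 * A$4$4 - A$3$4 * A$4$2)
           - A$2$2 * (A$3$1 * A$4$4 - A$3$4 * A$4$1)
           + A$2$4 * (A$3$1 * A$4$2 - A$3$2 * A$4$1))
  - A$1$4 * (A$2$1 * (A$3$2 * A$4$3 - A$3$3 * A$4$2)
           - A$2$2 * (A$3$1 * A$4$3 - A$3$3 * A$4$1)
           + A$2$3 * (A$3$1 * A$4$2 - A$3$2 * A$4$1))"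
proof -
  have f1: "finite {2::4, 3, 4}" "1 \<notin> {2::4, 3, 4}" by auto
  have f2: "finite {3::4, 4}" "2 \<notin> {3::4, 4}" by auto
  have f3: "finite {4::4}" "3 \<notin> {4::4}" by auto
  show ?thesis
    unfolding det_def UNIV_4
    unfolding sum_over_permutations_insert[OF f1]
    unfolding sum_over_permutations_insert[OF f2]
    unfolding sum_over_permutations_insert[OF f3]
    unfolding permutes_sing
    by (simp add: sign_swap_id permutation_swap_id permutation_compose sign_compose sign_id swap_id_eq)
       (simp add: algebra_simps)
qed

lemma bounded_bilinear_wedge: "bounded_bilinear wedge"
  unfolding bilinear_conv_bounded_bilinear[symmetric] bilinear_def
  by (auto intro!: linearI simp: wedge_def vec_eq_iff algebra_simps)

lemma bilinear_mink: "bilinear mink"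
  unfolding bilinear_def by (auto intro!: linearI simp: mink_def algebra_simps)

interpretation wedge: bounded_bilinear wedge by (rule bounded_bilinear_wedge)

interpretation mink: bounded_bilinear mink
  using bilinear_mink by (simp add: bilinear_conv_bounded_bilinear)

lemma mink_commute: "mink u v = mink v u"
  by (simp add: mink_def algebra_simps)

lemma wedge_self: "wedge u u = 0"
  by (simp add: wedge_def vec_eq_iff)

lemma wedge_commute: "wedge u v = - wedge v u"
  by (simp add: wedge_def vec_eq_iff)

text \<open>\<open>real^4^4\<close> is also a ring under componentwise multiplication, so
  simplification collects equal terms into a product with a numeral; this equation restores a scalar
  multiple.\<close>

lemma mult_two_bivector: "2 * (m :: real^4^4) = 2 *\<^sub>R m"
  by (simp only: mult_2 scaleR_2)

text \<open>On decomposable bivectors this is the determinant inner product with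
  \<open>wedge u v\<close>; it serves to read off coefficients.\<close>

definition bivector_eval :: "real^4 \<Rightarrow> real^4 \<Rightarrow> real^4^4 \<Rightarrow> real" where
  "bivector_eval u v m = mink u (\<chi> i. mink (m $ i) v)"

lemma bivector_eval_add: "bivector_eval u v (m + n) = bivector_eval u v m + bivector_eval u v n"
  by (simp add: bivector_eval_def mink_def algebra_simps)

lemma bivector_eval_scaleR: "bivector_eval u v (c *\<^sub>R m) = c * bivector_eval u v m"
  by (simp add: bivector_eval_def mink_def algebra_simps)

lemma bivector_eval_wedge: "bivector_eval u v (wedge y z) = mink u y * mink z v - mink u z * mink y v"
  by (simp add: bivector_eval_def wedge_def mink_def algebra_simps)

text \<open>The columns of \<open>B\<close> are the basis vectors and the rows of \<open>A\<close>
  the dual covectors. Orthonormality says \<open>A ** B = mat 1\<close>; for square matrices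
  \<open>B ** A = mat 1\<close> follows, which is the expansion.\<close>

lemma mink_orthonormal_expansion:
  fixes b :: "4 \<Rightarrow> real^4" and \<epsilon> :: "4 \<Rightarrow> real"
  assumes "\<And>i j. mink (b i) (b j) = (if i = j then \<epsilon> i else 0)" "\<And>i. \<epsilon> i * \<epsilon> i = 1"
  shows "y = (\<Sum>i\<in>UNIV. (\<epsilon> i * mink (b i) y) *\<^sub>R b i)"
proof -
  define \<eta> :: "4 \<Rightarrow> real" where "\<eta> k = (if k = 4 then -1 else 1)" for k
  have mink_sum: "mink u v = (\<Sum>k\<in>UNIV. u$k * \<eta> k * v$k)" for u v
    by (simp add: mink_def sum_4 \<eta>_def)
  define A :: "real^4^4" where "A = (\<chi> i k. \<epsilon> i * (b i $ k * \<eta> k))"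
  define B :: "real^4^4" where "B = (\<chi> k j. b j $ k)"
  have "A ** B = mat 1"
  proof -
    have "(A ** B) $ i $ j = \<epsilon> i * mink (b i) (b j)" for i j
      by (simp add: matrix_matrix_mult_def A_def B_def mink_sum sum_distrib_left mult.assoc)
    then show ?thesis by (simp add: vec_eq_iff mat_def assms)
  qed
  then have "B ** A = mat 1" using matrix_left_right_inverse by blast
  then have "y = B *v (A *v y)" by (simp add: matrix_vector_mul_assoc)
  also have "A *v y = (\<chi> i. \<epsilon> i * mink (b i) y)"
    by (simp add: matrix_vector_mult_def A_def mink_sum vec_eq_iff sum_distrib_left mult.assoc)
  also have "B *v \<dots> = (\<Sum>i\<in>UNIV. (\<epsilon> i * mink (b i) y) *\<^sub>R b i)"
    by (simp add: matrix_vector_mult_def B_def vec_eq_iff mult.commute)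
  finally show ?thesis .
qed

text \<open>Here \<open>(u1, v1)\<close> and \<open>(u2, v2)\<close> are the coordinates of an
  orthonormal pair for the metric diag(-1, G). The conclusion says that the signed sum of their
  tensor squares is the inverse metric diag(-1, 1/G). As in the previous expansion, a left inverse
  is turned into a right inverse.\<close>

lemma Lorentz_plane_dual_basis:
  fixes G :: real
  assumes "e1 * (G * v1 * v1 - u1 * u1) = 1" "e2 * (G * v2 * v2 - u2 * u2) = 1"
    and "G * v1 * v2 - u1 * u2 = 0" "G \<noteq> 0"
  shows "e1 * u1 * u1 + e2 * u2 * u2 = -1" "e1 * u1 * v1 + e2 * u2 * v2 = 0"
    "e1 * v1 * v1 + e2 * v2 * v2 = 1 / G"
proof -
  define A :: "real^2^2" where "A = vector [vector [- e1 * u1, e1 * G * v1], vector [- e2 * u2, e2 * G * v2]]"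
  define B :: "real^2^2" where "B = vector [vector [u1, u2], vector [v1, v2]]"
  have "e2 * (G * v2 * v1 - u2 * u1) = 0" "e1 * (G * v1 * v2 - u1 * u2) = 0"
    using assms(3) by (simp_all add: algebra_simps)
  then have "A ** B = mat 1"
    using assms(1,2)
    by (simp add: vec_eq_iff forall_2 matrix_matrix_mult_def mat_def A_def B_def sum_2 algebra_simps)
  then have "B ** A = mat 1" using matrix_left_right_inverse by blast
  then have "u1 * (- e1 * u1) + u2 * (- e2 * u2) = 1" "u1 * (e1 * G * v1) + u2 * (e2 * G * v2) = 0"
    "v1 * (e1 * G * v1) + v2 * (e2 * G * v2) = 1"
    by (simp_all add: vec_eq_iff forall_2 matrix_matrix_mult_def mat_def A_def B_def sum_2)
  then have *: "e1 * u1 * u1 + e2 * u2 * u2 = -1" "G * (e1 * u1 * v1 + e2 * u2 * v2) = 0"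
    "G * (e1 * v1 * v1 + e2 * v2 * v2) = 1"
    by (simp_all add: algebra_simps)
  from * show "e1 * u1 * u1 + e2 * u2 * u2 = -1" "e1 * u1 * v1 + e2 * u2 * v2 = 0"
    using assms(4) by simp_all
  from *(3) show "e1 * v1 * v1 + e2 * v2 * v2 = 1 / G"
    using assms(4) by (simp add: eq_divide_eq mult.commute)
qed

lemma matrix_inv_eqI:
  fixes A B :: "real^'n^'n"
  assumes "A ** B = mat 1"
  shows "matrix_inv A = B"
proof -
  have "B ** A = mat 1" using assms matrix_left_right_inverse by blast
  with assms have "\<exists>C. A ** C = mat 1 \<and> C ** A = mat 1" by blast
  then have "matrix_inv A ** A = mat 1"
    unfolding matrix_inv_def by (rule someI2_ex) blast
  then show ?thesis
    by (metis assms matrix_mul_assoc matrix_mul_lid matrix_mul_rid)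
qed

subsection \<open>Surfaces with metric \<open>-ds\<^sup>2 + G(s) dt\<^sup>2\<close>\<close>

text \<open>The derivatives enter as named functions, so that they can be given in closed form. The
  shared \<open>rst\<close> in the partials of \<open>rs\<close> and \<open>rt\<close> expresses the
  symmetry of second derivatives.\<close>

locale orthogonal_surface =
  fixes r rs rt rss rst rtt :: "real^2 \<Rightarrow> real^4" and U :: "(real^2) set" and G G' :: "real \<Rightarrow> real"
  assumes open_U: "open U"
    and r_partials: "p \<in> U \<Longrightarrow> has_partials r (rs p) (rt p) p"
    and rs_partials: "p \<in> U \<Longrightarrow> has_partials rs (rss p) (rst p) p"
    and rt_partials: "p \<in> U \<Longrightarrow> has_partials rt (rst p) (rtt p) p"
    and mink_rs_rs: "p \<in> U \<Longrightarrow> mink (rs p) (rs p) = -1"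
    and mink_rs_rt: "p \<in> U \<Longrightarrow> mink (rs p) (rt p) = 0"
    and mink_rt_rt: "p \<in> U \<Longrightarrow> mink (rt p) (rt p) = G (p$1)"
    and G_pos: "p \<in> U \<Longrightarrow> G (p$1) > 0"
    and G_deriv: "p \<in> U \<Longrightarrow> (G has_real_derivative G' (p$1)) (at (p$1))"
begin

lemma first_ff_eq:
  assumes "p \<in> U"
  shows "first_ff r p = vector [vector [-1, 0], vector [0, G (p$1)]]"
  using assms
  by (simp add: first_ff_def vec_eq_iff forall_2 partial_eq[OF r_partials] mink_rs_rs mink_rs_rt
      mink_rt_rt mink_commute[of "rt p" "rs p"])

lemma first_ff_inv:
  assumes "p \<in> U"
  shows "matrix_inv (first_ff r p) = vector [vector [-1, 0], vector [0, 1 / G (p$1)]]"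
  using G_pos[OF assms]
  by (intro matrix_inv_eqI)
    (simp add: first_ff_eq[OF assms] vec_eq_iff forall_2 matrix_matrix_mult_def mat_def sum_2)

lemma partial_first_ff:
  assumes "p \<in> U"
  shows "partial k (\<lambda>q. first_ff r q $ i $ j) p = (if k = 1 \<and> i = 2 \<and> j = 2 then G' (p$1) else 0)"
proof -
  let ?g = "\<lambda>q::real^2. (vector [vector [-1, 0], vector [0, G (q$1)]] :: real^2^2)"
  have eq: "?g q $ i $ j = first_ff r q $ i $ j" if "q \<in> U" for q
    using first_ff_eq[OF that] by simp
  have "has_partials (\<lambda>q. ?g q $ i $ j) (if i = 2 \<and> j = 2 then G' (p$1) else 0) 0 p"
    using exhaust_2[of i] exhaust_2[of j]
      has_partials_fst[OF G_deriv[OF assms, unfolded has_real_derivative_iff_has_vector_derivative]]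
    by (auto intro: has_partials_const)
  from has_partials_cong[OF open_U assms eq this]
  have "has_partials (\<lambda>q. first_ff r q $ i $ j) (if i = 2 \<and> j = 2 then G' (p$1) else 0) 0 p" .
  from partial_eq[OF this] show ?thesis
    using exhaust_2[of k] by auto
qed

lemma christoffel_eq:
  assumes "p \<in> U"
  shows "christoffel r p 1 1 1 = 0" "christoffel r p 1 1 2 = 0" "christoffel r p 1 2 1 = 0"
    "christoffel r p 1 2 2 = G' (p$1) / 2"
    "christoffel r p 2 1 1 = 0" "christoffel r p 2 2 2 = 0"
    "christoffel r p 2 1 2 = G' (p$1) / (2 * G (p$1))"
    "christoffel r p 2 2 1 = G' (p$1) / (2 * G (p$1))"
  by (simp_all add: christoffel_def sum_2 first_ff_inv[OF assms] partial_first_ff[OF assms])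

lemma nabla_eq:
  assumes "p \<in> U"
  shows "nabla r X Y p $ 1 = D X Y p $ 1 + G' (p$1) / 2 * (X p $ 2 * Y p $ 2)"
    "nabla r X Y p $ 2 = D X Y p $ 2 + G' (p$1) / (2 * G (p$1)) * (X p $ 1 * Y p $ 2 + X p $ 2 * Y p $ 1)"
  by (simp_all add: nabla_def sum_2 christoffel_eq[OF assms] algebra_simps)

text \<open>The left-hand side is the covariant Hessian of \<phi>, which is tensorial: the
  derivatives of \<open>Y\<close> produced by the two terms cancel. For \<phi> = \<open>r\<close> it
  is the second fundamental form, and its trace gives the Laplacian, so one formula serves
  both.\<close>

lemma Hessian_eq:
  fixes \<phi> :: "real^2 \<Rightarrow> 'b::real_normed_vector"
  assumes "p \<in> U" "\<And>q. q \<in> U \<Longrightarrow> has_partials \<phi> (\<phi>s q) (\<phi>t q) q"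
    and "has_partials \<phi>s \<phi>ss \<phi>st p" "has_partials \<phi>t \<phi>st \<phi>tt p"
    and "Y differentiable (at p)"
  shows "D X (D Y \<phi>) p - D (nabla r X Y) \<phi> p =
    (X p $ 1 * Y p $ 1) *\<^sub>R \<phi>ss
    + (X p $ 1 * Y p $ 2 + X p $ 2 * Y p $ 1) *\<^sub>R (\<phi>st - (G' (p$1) / (2 * G (p$1))) *\<^sub>R \<phi>t p)
    + (X p $ 2 * Y p $ 2) *\<^sub>R (\<phi>tt - (G' (p$1) / 2) *\<^sub>R \<phi>s p)"
proof -
  note Y = differentiable_has_partials[OF assms(5)]
  have eq: "Y q $ 1 *\<^sub>R \<phi>s q + Y q $ 2 *\<^sub>R \<phi>t q = D Y \<phi> q" if "q \<in> U" for q
    using D_eq[OF assms(2)[OF that]] by simp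
  have DY: "has_partials (D Y \<phi>)
      (partial 1 Y p $ 1 *\<^sub>R \<phi>s p + Y p $ 1 *\<^sub>R \<phi>ss + (partial 1 Y p $ 2 *\<^sub>R \<phi>t p + Y p $ 2 *\<^sub>R \<phi>st))
      (partial 2 Y p $ 1 *\<^sub>R \<phi>s p + Y p $ 1 *\<^sub>R \<phi>st + (partial 2 Y p $ 2 *\<^sub>R \<phi>t p + Y p $ 2 *\<^sub>R \<phi>tt)) p"
    by (rule has_partials_cong[OF open_U assms(1)], erule eq)
      (intro has_partials_add has_partials_scaleR has_partials_nth Y assms(3,4))
  show ?thesis
    unfolding D_eq[OF DY] D_eq[OF assms(2)[OF assms(1)]] nabla_eq[OF assms(1)] D_eq[OF Y]
    by (simp add: algebra_simps)
qed

section \<open>Arbitrary oriented frames and the notions defined through them\<close>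

lemma frame_components:
  assumes "oriented_frame r V E e" "p \<in> V" "p \<in> U"
  shows "e 1 p = E 1 p $ 1 *\<^sub>R rs p + E 1 p $ 2 *\<^sub>R rt p"
    and "e 2 p = E 2 p $ 1 *\<^sub>R rs p + E 2 p $ 2 *\<^sub>R rt p"
  using assms D_eq[OF r_partials[OF assms(3)]] by (auto simp: oriented_frame_def)

lemma frame_sign:
  assumes "oriented_frame r V E e" "p \<in> V" "A \<in> {1..4}"
  shows "mink (e A p) (e A p) = 1 \<or> mink (e A p) (e A p) = -1"
  using assms by (auto simp: oriented_frame_def)

lemma frame_orthogonal:
  assumes "oriented_frame r V E e" "p \<in> V" "A \<in> {1..4}" "B \<in> {1..4}" "A \<noteq> B"
  shows "mink (e A p) (e B p) = 0"
  using assms unfolding oriented_frame_def by blast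

lemma frame_dual_metric:
  assumes "oriented_frame r V E e" "p \<in> V" "p \<in> U"
  defines "\<epsilon> \<equiv> \<lambda>A. mink (e A p) (e A p)"
  shows "\<epsilon> 1 * E 1 p $ 1 * E 1 p $ 1 + \<epsilon> 2 * E 2 p $ 1 * E 2 p $ 1 = -1"
    "\<epsilon> 1 * E 1 p $ 1 * E 1 p $ 2 + \<epsilon> 2 * E 2 p $ 1 * E 2 p $ 2 = 0"
    "\<epsilon> 1 * E 1 p $ 2 * E 1 p $ 2 + \<epsilon> 2 * E 2 p $ 2 * E 2 p $ 2 = 1 / G (p$1)"
proof -
  note c = frame_components[OF assms(1-3)]
  have m: "mink (e i p) (e j p) = G (p$1) * E i p $ 2 * E j p $ 2 - E i p $ 1 * E j p $ 1"
    if "i \<in> {1,2}" "j \<in> {1,2}" for i j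
    using that c mink_rs_rs[OF assms(3)] mink_rs_rt[OF assms(3)] mink_rt_rt[OF assms(3)]
      mink_commute[of "rt p" "rs p"]
    by (auto simp: mink.add_left mink.add_right mink.scaleR_left mink.scaleR_right algebra_simps)
  have sq: "\<epsilon> i * mink (e i p) (e i p) = 1" if "i \<in> {1,2}" for i
    using frame_sign[OF assms(1,2), of i] that by (auto simp: \<epsilon>_def)
  have "mink (e 1 p) (e 2 p) = 0"
    using frame_orthogonal[OF assms(1,2), of 1 2] by simp
  note * = Lorentz_plane_dual_basis[of "\<epsilon> 1" "G (p$1)" "E 1 p $ 2" "E 1 p $ 1" "\<epsilon> 2" "E 2 p $ 2" "E 2 p $ 1"]
  show "\<epsilon> 1 * E 1 p $ 1 * E 1 p $ 1 + \<epsilon> 2 * E 2 p $ 1 * E 2 p $ 1 = -1"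
    "\<epsilon> 1 * E 1 p $ 1 * E 1 p $ 2 + \<epsilon> 2 * E 2 p $ 1 * E 2 p $ 2 = 0"
    "\<epsilon> 1 * E 1 p $ 2 * E 1 p $ 2 + \<epsilon> 2 * E 2 p $ 2 * E 2 p $ 2 = 1 / G (p$1)"
    using * sq[of 1] sq[of 2] m[of 1 1] m[of 2 2] m[of 1 2] \<open>mink (e 1 p) (e 2 p) = 0\<close> G_pos[OF assms(3)]
    by simp_all
qed

lemma frame_expansion:
  assumes "oriented_frame r V E e" "p \<in> V"
  defines "\<epsilon> \<equiv> \<lambda>A. mink (e A p) (e A p)"
  shows "y = (\<epsilon> 1 * mink (e 1 p) y) *\<^sub>R e 1 p + (\<epsilon> 2 * mink (e 2 p) y) *\<^sub>R e 2 p
    + (\<epsilon> 3 * mink (e 3 p) y) *\<^sub>R e 3 p + (\<epsilon> 4 * mink (e 4 p) y) *\<^sub>R e 4 p"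
proof -
  \<comment> \<open>Translates the index type \<open>4\<close> of the expansion lemma into the
    natural numbers that index a frame.\<close>
  define idx :: "4 \<Rightarrow> nat" where "idx i = (if i = 1 then 1 else if i = 2 then 2 else if i = 3 then 3 else 4)" for i
  have idx: "idx i \<in> {1..4}" for i by (simp add: idx_def)
  have inj: "idx i = idx j \<longleftrightarrow> i = j" for i j
    using exhaust_4[of i] exhaust_4[of j] by (auto simp: idx_def)
  have "y = (\<Sum>i\<in>UNIV. (\<epsilon> (idx i) * mink (e (idx i) p) y) *\<^sub>R e (idx i) p)"
  proof (rule mink_orthonormal_expansion)
    show "mink (e (idx i) p) (e (idx j) p) = (if i = j then \<epsilon> (idx i) else 0)" for i j
      using frame_orthogonal[OF assms(1,2) idx idx, of i j] inj by (auto simp: \<epsilon>_def)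
    show "\<epsilon> (idx i) * \<epsilon> (idx i) = 1" for i
      using frame_sign[OF assms(1,2) idx, of i] by (auto simp: \<epsilon>_def)
  qed
  then show ?thesis by (simp add: sum_4 idx_def)
qed

lemma smooth_frame_differentiable:
  "oriented_frame r V E e \<Longrightarrow> p \<in> V \<Longrightarrow> i \<in> {1,2} \<Longrightarrow> E i differentiable (at p)"
  by (auto simp: oriented_frame_def intro: smooth_on_differentiable)

text \<open>Each summand is minus a value of the Hessian, so every frame yields minus its trace with
  respect to diag(-1, 1/G). The assumed frame at \<open>p\<close> makes the definite description
  denote.\<close>

lemma laplacian_eq:
  fixes \<phi> :: "real^2 \<Rightarrow> 'b::real_normed_vector"
  assumes "p \<in> U" "\<exists>V E e. oriented_frame r V E e \<and> p \<in> V"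
    and "\<And>q. q \<in> U \<Longrightarrow> has_partials \<phi> (\<phi>s q) (\<phi>t q) q"
    and "has_partials \<phi>s \<phi>ss \<phi>st p" "has_partials \<phi>t \<phi>st \<phi>tt p"
  shows "laplacian r \<phi> p = \<phi>ss - (1 / G (p$1)) *\<^sub>R \<phi>tt + (G' (p$1) / (2 * G (p$1))) *\<^sub>R \<phi>s p"
    (is "_ = ?L")
proof -
  have *: "(\<Sum>i\<in>{1,2}. mink (e i p) (e i p) *\<^sub>R
      (D (nabla r (E i) (E i)) \<phi> p - D (E i) (D (E i) \<phi>) p)) = ?L"
    if f: "oriented_frame r V E e" "p \<in> V" for V E e
  proof -
    define S where "S i = D (E i) (D (E i) \<phi>) p - D (nabla r (E i) (E i)) \<phi> p" for i
    have S: "S i = (E i p $ 1 * E i p $ 1) *\<^sub>R \<phi>ss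
        + (2 * (E i p $ 1 * E i p $ 2)) *\<^sub>R (\<phi>st - (G' (p$1) / (2 * G (p$1))) *\<^sub>R \<phi>t p)
        + (E i p $ 2 * E i p $ 2) *\<^sub>R (\<phi>tt - (G' (p$1) / 2) *\<^sub>R \<phi>s p)"
      if "i \<in> {1,2}" for i
      using Hessian_eq[OF assms(1,3,4,5) smooth_frame_differentiable[OF f that]]
      by (simp add: S_def mult.commute)
    let ?\<epsilon> = "\<lambda>A. mink (e A p) (e A p)"
    note d = frame_dual_metric[OF f assms(1)]
    have "(\<Sum>i\<in>{1,2}. ?\<epsilon> i *\<^sub>R (D (nabla r (E i) (E i)) \<phi> p - D (E i) (D (E i) \<phi>) p))
        = - (?\<epsilon> 1 *\<^sub>R S 1 + ?\<epsilon> 2 *\<^sub>R S 2)"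
      by (simp add: S_def algebra_simps)
    also have "\<dots> = - ((?\<epsilon> 1 * E 1 p $ 1 * E 1 p $ 1 + ?\<epsilon> 2 * E 2 p $ 1 * E 2 p $ 1) *\<^sub>R \<phi>ss
        + (2 * (?\<epsilon> 1 * E 1 p $ 1 * E 1 p $ 2 + ?\<epsilon> 2 * E 2 p $ 1 * E 2 p $ 2)) *\<^sub>R
            (\<phi>st - (G' (p$1) / (2 * G (p$1))) *\<^sub>R \<phi>t p)
        + (?\<epsilon> 1 * E 1 p $ 2 * E 1 p $ 2 + ?\<epsilon> 2 * E 2 p $ 2 * E 2 p $ 2) *\<^sub>R
            (\<phi>tt - (G' (p$1) / 2) *\<^sub>R \<phi>s p))"
    proof -
      have "?\<epsilon> 1 *\<^sub>R ((a1) *\<^sub>R A + (2 * b1) *\<^sub>R B + c1 *\<^sub>R C) + ?\<epsilon> 2 *\<^sub>R (a2 *\<^sub>R A + (2 * b2) *\<^sub>R B + c2 *\<^sub>R C)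
        = (?\<epsilon> 1 * a1 + ?\<epsilon> 2 * a2) *\<^sub>R A + (2 * (?\<epsilon> 1 * b1 + ?\<epsilon> 2 * b2)) *\<^sub>R B + (?\<epsilon> 1 * c1 + ?\<epsilon> 2 * c2) *\<^sub>R C"
        for a1 a2 b1 b2 c1 c2 and A B C :: 'b
        by (simp add: algebra_simps)
      from this[of "E 1 p $ 1 * E 1 p $ 1" \<phi>ss "E 1 p $ 1 * E 1 p $ 2" _ "E 1 p $ 2 * E 1 p $ 2" _
          "E 2 p $ 1 * E 2 p $ 1" "E 2 p $ 1 * E 2 p $ 2" "E 2 p $ 2 * E 2 p $ 2"]
      show ?thesis
        by (simp only: S[OF insertI1] S[OF insertI2[OF singletonI]] mult.assoc)
    qed
    also have "\<dots> = ?L"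
      unfolding d using G_pos[OF assms(1)] by (simp add: algebra_simps)
    finally show ?thesis .
  qed
  show ?thesis
    unfolding laplacian_def
  proof (rule the_equality)
    show "\<exists>V E e. oriented_frame r V E e \<and> p \<in> V \<and> ?L = (\<Sum>i\<in>{1,2}. mink (e i p) (e i p) *\<^sub>R
      (D (nabla r (E i) (E i)) \<phi> p - D (E i) (D (E i) \<phi>) p))"
    proof -
      obtain V E e where f: "oriented_frame r V E e" "p \<in> V" using assms(2) by blast
      show ?thesis
        by (rule exI[of _ V], rule exI[of _ E], rule exI[of _ e]) (intro conjI f *[OF f, symmetric])
    qed
  qed (elim exE conjE, simp only: *)
qed

text \<open>\<open>rs p\<close>, \<open>rt p\<close> divided by its length, \<open>n3\<close> and
  \<open>n4\<close> form an orthonormal basis of the whole space; the first two coefficients of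
  \<open>y\<close> vanish.\<close>

lemma normal_expansion:
  assumes "p \<in> U" "mink y (rs p) = 0" "mink y (rt p) = 0"
    and "mink n3 (rs p) = 0" "mink n3 (rt p) = 0" "mink n4 (rs p) = 0" "mink n4 (rt p) = 0"
    and "mink n3 n3 = 1" "mink n4 n4 = 1" "mink n3 n4 = 0"
  shows "y = mink n3 y *\<^sub>R n3 + mink n4 y *\<^sub>R n4"
proof -
  define g where "g = sqrt (G (p$1))"
  have g: "g \<noteq> 0" "G (p$1) \<noteq> 0" "g * g = G (p$1)" using G_pos[OF assms(1)] by (auto simp: g_def)
  define b :: "4 \<Rightarrow> real^4" where
    "b i = (if i = 1 then rs p else if i = 2 then (1 / g) *\<^sub>R rt p else if i = 3 then n3 else n4)" for i
  define \<epsilon> :: "4 \<Rightarrow> real" where "\<epsilon> i = (if i = 1 then -1 else 1)" for i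
  have c: "mink (rt p) (rs p) = 0" "mink (rs p) n3 = 0" "mink (rs p) n4 = 0" "mink (rt p) n3 = 0"
      "mink (rt p) n4 = 0" "mink n4 n3 = 0" "mink (rs p) y = 0" "mink (rt p) y = 0"
    using assms mink_rs_rt[OF assms(1)] by (simp_all only: mink_commute)
  have "y = (\<Sum>i\<in>UNIV. (\<epsilon> i * mink (b i) y) *\<^sub>R b i)"
  proof (rule mink_orthonormal_expansion)
    have "\<forall>i j. mink (b i) (b j) = (if i = j then \<epsilon> i else 0)"
      using assms c mink_rs_rs[OF assms(1)] mink_rs_rt[OF assms(1)] mink_rt_rt[OF assms(1)] g
      by (simp add: forall_4 b_def \<epsilon>_def mink.scaleR_left mink.scaleR_right)
    then show "mink (b i) (b j) = (if i = j then \<epsilon> i else 0)" for i j by blast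
  qed (simp add: \<epsilon>_def)
  then show ?thesis by (simp add: sum_4 b_def \<epsilon>_def c mink.scaleR_left)
qed

text \<open>Since \<open>n3\<close> and \<open>n4\<close> are both spacelike, the normal plane is
  positive definite. Any orthonormal normal pair is then spacelike and arises from
  \<open>n3\<close>, \<open>n4\<close> by an orthogonal matrix; the orientation conditions make its
  determinant 1.\<close>

lemma frame_normals:
  assumes "oriented_frame r V E e" "p \<in> V" "p \<in> U"
    and "mink n3 (rs p) = 0" "mink n3 (rt p) = 0" "mink n4 (rs p) = 0" "mink n4 (rt p) = 0"
    and "mink n3 n3 = 1" "mink n4 n4 = 1" "mink n3 n4 = 0"
    and "det (vector [rs p, rt p, n3, n4] :: real^4^4) > 0"
  shows "wedge (e 3 p) (e 4 p) = wedge n3 n4" "mink (e 3 p) (e 3 p) = 1" "mink (e 4 p) (e 4 p) = 1"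
proof -
  have orth: "mink (e k p) (rs p) = 0" "mink (e k p) (rt p) = 0" if "k \<in> {3,4}" for k
  proof -
    have "mink (e k p) (partial j r p) = 0" for j
      using assms(1,2) that unfolding oriented_frame_def by blast
    from this[of 1] this[of 2] show "mink (e k p) (rs p) = 0" "mink (e k p) (rt p) = 0"
      by (simp_all add: partial_eq[OF r_partials[OF assms(3)]])
  qed
  define a where "a = mink n3 (e 3 p)"
  define b where "b = mink n4 (e 3 p)"
  define c where "c = mink n3 (e 4 p)"
  define d where "d = mink n4 (e 4 p)"
  have e3: "e 3 p = a *\<^sub>R n3 + b *\<^sub>R n4" and e4: "e 4 p = c *\<^sub>R n3 + d *\<^sub>R n4"
    using normal_expansion[OF assms(3) orth assms(4-10)] by (simp_all add: a_def b_def c_def d_def)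
  have n43: "mink n4 n3 = 0" using assms(10) by (simp only: mink_commute)
  have m: "mink (e 3 p) (e 3 p) = a * a + b * b" "mink (e 4 p) (e 4 p) = c * c + d * d"
    "mink (e 3 p) (e 4 p) = a * c + b * d"
    unfolding e3 e4 using assms(8-10) n43
    by (simp_all add: mink.add_left mink.add_right mink.scaleR_left mink.scaleR_right)
  have "a * a + b * b \<ge> 0" "c * c + d * d \<ge> 0" by simp_all
  with frame_sign[OF assms(1,2), of 3] frame_sign[OF assms(1,2), of 4] m
  show u: "mink (e 3 p) (e 3 p) = 1" "mink (e 4 p) (e 4 p) = 1" by auto
  have z: "a * c + b * d = 0" using frame_orthogonal[OF assms(1,2), of 3 4] m by simp
  have w: "wedge (e 3 p) (e 4 p) = (a * d - b * c) *\<^sub>R wedge n3 n4"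
    unfolding e3 e4 using wedge_commute[of n4 n3]
    by (simp add: wedge.add_left wedge.add_right wedge.scaleR_left wedge.scaleR_right wedge_self
        algebra_simps)
  \<comment> \<open>Lagrange's identity: orthonormality fixes the determinant up to sign.\<close>
  have "(a * d - b * c)\<^sup>2 + (a * c + b * d)\<^sup>2 = (a * a + b * b) * (c * c + d * d)"
    by (simp add: power2_eq_square algebra_simps)
  with z u m have sq: "(a * d - b * c)\<^sup>2 = 1" by simp
  \<comment> \<open>The change of basis from \<open>(rs, rt, n3, n4)\<close> to the frame is block
    diagonal, so its determinant is the tangential determinant times \<open>a * d - b * c\<close>.
    This settles the sign.\<close>
  define B :: "real^4^4" where
    "B = vector [vector [E 1 p $ 1, E 1 p $ 2, 0, 0], vector [E 2 p $ 1, E 2 p $ 2, 0, 0],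
       vector [0, 0, a, b], vector [0, 0, c, d]]"
  have "(vector [e 1 p, e 2 p, e 3 p, e 4 p] :: real^4^4) = B ** vector [rs p, rt p, n3, n4]"
    unfolding frame_components[OF assms(1-3)] e3 e4
    by (simp add: vec_eq_iff forall_4 matrix_matrix_mult_def sum_4 B_def vector_4)
  moreover have "det B = det (vector [E 1 p, E 2 p] :: real^2^2) * (a * d - b * c)"
    by (simp add: det_4 det_2 B_def vector_4) (simp add: algebra_simps)
  moreover have "det (vector [E 1 p, E 2 p] :: real^2^2) > 0"
    "det (vector [e 1 p, e 2 p, e 3 p, e 4 p] :: real^4^4) > 0"
    using assms(1,2) by (auto simp: oriented_frame_def)
  ultimately have "a * d - b * c > 0"
    using assms(11) by (auto simp: det_mul zero_less_mult_iff)
  with sq have "a * d - b * c = 1" by (auto simp: power2_eq_1_iff)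
  with w show "wedge (e 3 p) (e 4 p) = wedge n3 n4" by simp
qed

lemma gauss_map_eq:
  assumes "p \<in> U" "\<exists>V E e. oriented_frame r V E e \<and> p \<in> V"
    and "mink n3 (rs p) = 0" "mink n3 (rt p) = 0" "mink n4 (rs p) = 0" "mink n4 (rt p) = 0"
    and "mink n3 n3 = 1" "mink n4 n4 = 1" "mink n3 n4 = 0"
    and "det (vector [rs p, rt p, n3, n4] :: real^4^4) > 0"
  shows "gauss_map r p = wedge n3 n4"
proof -
  have *: "wedge (e 3 p) (e 4 p) = wedge n3 n4" if "oriented_frame r V E e" "p \<in> V" for V E e
    using frame_normals(1)[OF that assms(1,3-10)] .
  show ?thesis
    unfolding gauss_map_def
  proof (rule the_equality)
    obtain V E e where f: "oriented_frame r V E e" "p \<in> V" using assms(2) by blast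
    show "\<exists>V E e. oriented_frame r V E e \<and> p \<in> V \<and> wedge n3 n4 = wedge (e 3 p) (e 4 p)"
      by (rule exI[of _ V], rule exI[of _ E], rule exI[of _ e]) (intro conjI f *[OF f, symmetric])
  qed (elim exE conjE, simp only: *)
qed

text \<open>\<open>rss\<close>, \<open>H12\<close> and \<open>H22\<close> are the coordinate
  components of \<open>h\<close>, normal by the last six assumptions. The norm contracts both slots
  of \<open>h\<close> with the inverse metric diag(-1, 1/G), which gives the weights 1, -2/G and 1/G
  squared.\<close>

lemma second_ff_norm_sq_eq:
  assumes "p \<in> U" "\<exists>V E e. oriented_frame r V E e \<and> p \<in> V"
    and "mink n3 (rs p) = 0" "mink n3 (rt p) = 0" "mink n4 (rs p) = 0" "mink n4 (rt p) = 0"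
    and "mink n3 n3 = 1" "mink n4 n4 = 1" "mink n3 n4 = 0"
    and "det (vector [rs p, rt p, n3, n4] :: real^4^4) > 0"
  defines "H12 \<equiv> rst p - (G' (p$1) / (2 * G (p$1))) *\<^sub>R rt p"
    and "H22 \<equiv> rtt p - (G' (p$1) / 2) *\<^sub>R rs p"
  assumes "mink (rss p) (rs p) = 0" "mink (rss p) (rt p) = 0" "mink H12 (rs p) = 0"
    "mink H12 (rt p) = 0" "mink H22 (rs p) = 0" "mink H22 (rt p) = 0"
  shows "second_ff_norm_sq r p = mink (rss p) (rss p) - 2 * mink H12 H12 / G (p$1)
    + mink H22 H22 / (G (p$1))\<^sup>2" (is "_ = ?L")
proof -
  have *: "(\<Sum>i\<in>{1,2}. \<Sum>j\<in>{1,2}. \<Sum>k\<in>{3,4}.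
               mink (e i p) (e i p) * mink (e j p) (e j p) * mink (e k p) (e k p) *
               mink (second_ff r (E i) (E j) p) (e k p) *
               mink (second_ff r (E j) (E i) p) (e k p)) = ?L"
    if f: "oriented_frame r V E e" "p \<in> V" for V E e
  proof -
    let ?\<epsilon> = "\<lambda>A. mink (e A p) (e A p)"
    let ?u = "\<lambda>i. E i p $ 1" and ?v = "\<lambda>i. E i p $ 2"
    define h where "h i j = (?u i * ?u j) *\<^sub>R rss p + (?u i * ?v j + ?v i * ?u j) *\<^sub>R H12
      + (?v i * ?v j) *\<^sub>R H22" for i j
    have h: "second_ff r (E i) (E j) p = h i j" if "i \<in> {1,2}" "j \<in> {1,2}" for i j
      unfolding second_ff_def h_def H12_def H22_def
      by (rule Hessian_eq[OF assms(1) r_partials rs_partials[OF assms(1)] rt_partials[OF assms(1)]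
            smooth_frame_differentiable[OF f that(2)]])
    have h_commute: "h j i = h i j" for i j
      by (simp add: h_def algebra_simps)
    have orth: "mink (h i j) (e k p) = 0" if "k \<in> {1,2}" for i j k
    proof -
      have "mink (h i j) (rs p) = 0" "mink (h i j) (rt p) = 0"
        using assms(13-18) by (simp_all add: h_def mink.add_left mink.scaleR_left)
      then show ?thesis
        using frame_components[OF f assms(1)] that by (auto simp: mink.add_right mink.scaleR_right)
    qed
    note n = frame_normals(2,3)[OF f assms(1,3-10)]
    have norm: "(mink (h i j) (e 3 p))\<^sup>2 + (mink (h i j) (e 4 p))\<^sup>2 = mink (h i j) (h i j)" for i j
    proof -
      have "mink (h i j) (h i j) = mink (h i j) (mink (e 3 p) (h i j) *\<^sub>R e 3 p + mink (e 4 p) (h i j) *\<^sub>R e 4 p)"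
        using frame_expansion[OF f, of "h i j"] orth[of 1 i j] orth[of 2 i j] n
          mink_commute[of "e 1 p" "h i j"] mink_commute[of "e 2 p" "h i j"] by simp
      then show ?thesis
        using mink_commute[of "e 3 p" "h i j"] mink_commute[of "e 4 p" "h i j"]
        by (simp add: mink.add_right mink.scaleR_right power2_eq_square)
    qed
    have inner: "(\<Sum>k\<in>{3,4}. ?\<epsilon> i * ?\<epsilon> j * ?\<epsilon> k * mink (second_ff r (E i) (E j) p) (e k p)
        * mink (second_ff r (E j) (E i) p) (e k p)) = ?\<epsilon> i * ?\<epsilon> j * mink (h i j) (h i j)"
      if "i \<in> {1,2}" "j \<in> {1,2}" for i j
    proof -
      have "?\<epsilon> i * ?\<epsilon> j * mink (h i j) (h i j) =
        ?\<epsilon> i * ?\<epsilon> j * ((mink (h i j) (e 3 p))\<^sup>2 + (mink (h i j) (e 4 p))\<^sup>2)"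
        by (simp only: norm)
      then show ?thesis
        by (simp add: h[OF that] h[OF that(2,1)] h_commute[of j i] n power2_eq_square algebra_simps)
    qed
    have norm_h: "mink (h i j) (h i j) =
        (?u i * ?u j)\<^sup>2 * mink (rss p) (rss p) + (?u i * ?v j + ?v i * ?u j)\<^sup>2 * mink H12 H12
        + (?v i * ?v j)\<^sup>2 * mink H22 H22
        + 2 * (?u i * ?u j) * (?u i * ?v j + ?v i * ?u j) * mink (rss p) H12
        + 2 * (?u i * ?u j) * (?v i * ?v j) * mink (rss p) H22
        + 2 * (?u i * ?v j + ?v i * ?u j) * (?v i * ?v j) * mink H12 H22" for i j
      using mink_commute[of H12 "rss p"] mink_commute[of H22 "rss p"] mink_commute[of H22 H12]
      by (simp add: h_def mink.add_left mink.add_right mink.scaleR_left mink.scaleR_right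
          power2_eq_square) (simp add: algebra_simps)
    \<comment> \<open>The components of the inverse metric built from the frame. The double sum
      depends on the frame only through these three numbers.\<close>
    define uu where "uu = ?\<epsilon> 1 * ?u 1 * ?u 1 + ?\<epsilon> 2 * ?u 2 * ?u 2"
    define uv where "uv = ?\<epsilon> 1 * ?u 1 * ?v 1 + ?\<epsilon> 2 * ?u 2 * ?v 2"
    define vv where "vv = ?\<epsilon> 1 * ?v 1 * ?v 1 + ?\<epsilon> 2 * ?v 2 * ?v 2"
    have d: "uu = -1" "uv = 0" "vv = 1 / G (p$1)"
      using frame_dual_metric[OF f assms(1)] by (simp_all add: uu_def uv_def vv_def)
    have "(\<Sum>i\<in>{1,2}. \<Sum>j\<in>{1,2}. \<Sum>k\<in>{3,4}.
               ?\<epsilon> i * ?\<epsilon> j * ?\<epsilon> k * mink (second_ff r (E i) (E j) p) (e k p) *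
               mink (second_ff r (E j) (E i) p) (e k p))
       = (\<Sum>i\<in>{1,2}. \<Sum>j\<in>{1,2}. ?\<epsilon> i * ?\<epsilon> j * mink (h i j) (h i j))"
      by (intro sum.cong refl inner)
    also have "\<dots> = uu\<^sup>2 * mink (rss p) (rss p) + (2 * uu * vv + 2 * uv\<^sup>2) * mink H12 H12
        + vv\<^sup>2 * mink H22 H22 + 4 * uu * uv * mink (rss p) H12 + 2 * uv\<^sup>2 * mink (rss p) H22
        + 4 * uv * vv * mink H12 H22"
      unfolding norm_h by (simp add: uu_def uv_def vv_def power2_eq_square) (simp add: algebra_simps)
    also have "\<dots> = ?L"
      unfolding d by (simp add: power2_eq_square)
    finally show ?thesis .
  qed
  show ?thesis
    unfolding second_ff_norm_sq_def
  proof (rule the_equality)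
    obtain V E e where f: "oriented_frame r V E e" "p \<in> V" using assms(2) by blast
    show "\<exists>V E e. oriented_frame r V E e \<and> p \<in> V \<and> ?L = (\<Sum>i\<in>{1,2}. \<Sum>j\<in>{1,2}. \<Sum>k\<in>{3,4}.
               mink (e i p) (e i p) * mink (e j p) (e j p) * mink (e k p) (e k p) *
               mink (second_ff r (E i) (E j) p) (e k p) *
               mink (second_ff r (E j) (E i) p) (e k p))"
      by (rule exI[of _ V], rule exI[of _ E], rule exI[of _ e]) (intro conjI f *[OF f, symmetric])
  qed (elim exE conjE, simp only: *)
qed

end

subsection \<open>The rotating basis\<close>

text \<open>The vector with coefficients \<alpha>, \<beta>, \<gamma>, \<delta> in the rotating basis
  at angle parameter \<open>t\<close>. Rotation by \<open>t\<close> is an isometry of determinant 1,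
  so inner products and determinants can be computed on coefficients alone.\<close>

definition rotv :: "real \<Rightarrow> real \<Rightarrow> real \<Rightarrow> real \<Rightarrow> real \<Rightarrow> real \<Rightarrow> real \<Rightarrow> real^4" where
  "rotv a b t \<alpha> \<beta> \<gamma> \<delta> =
     vector [\<alpha> * cos (a*t) - \<beta> * sin (a*t), \<alpha> * sin (a*t) + \<beta> * cos (a*t),
             \<gamma> * cosh (b*t) + \<delta> * sinh (b*t), \<gamma> * sinh (b*t) + \<delta> * cosh (b*t)]"

lemma double_rot_eq_rotv: "double_rot a b x w p = rotv a b (p$2) (x (p$1)) 0 0 (w (p$1))"
  by (simp add: double_rot_def rotv_def Let_def)

lemma rotv_add: "rotv a b t \<alpha> \<beta> \<gamma> \<delta> + rotv a b t \<alpha>' \<beta>' \<gamma>' \<delta>' = rotv a b t (\<alpha>+\<alpha>') (\<beta>+\<beta>') (\<gamma>+\<gamma>') (\<delta>+\<delta>')"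
  by (simp add: rotv_def vec_eq_iff forall_4 vector_4 algebra_simps)

lemma rotv_scaleR: "c *\<^sub>R rotv a b t \<alpha> \<beta> \<gamma> \<delta> = rotv a b t (c*\<alpha>) (c*\<beta>) (c*\<gamma>) (c*\<delta>)"
  by (simp add: rotv_def vec_eq_iff forall_4 vector_4 algebra_simps)

lemma rotv_diff: "rotv a b t \<alpha> \<beta> \<gamma> \<delta> - rotv a b t \<alpha>' \<beta>' \<gamma>' \<delta>' = rotv a b t (\<alpha>-\<alpha>') (\<beta>-\<beta>') (\<gamma>-\<gamma>') (\<delta>-\<delta>')"
  by (simp add: rotv_def vec_eq_iff forall_4 vector_4 algebra_simps)

lemma cos_sin_cosh_sinh:
  fixes s t :: real
  shows "cos s * cos s + sin s * sin s = 1" "cosh t * cosh t - sinh t * sinh t = 1"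
  using hyperbolic_pythagoras[of t] by (simp_all add: power2_eq_square)

lemma mink_rotv:
  "mink (rotv a b t \<alpha> \<beta> \<gamma> \<delta>) (rotv a b t \<alpha>' \<beta>' \<gamma>' \<delta>') = \<alpha>*\<alpha>' + \<beta>*\<beta>' + \<gamma>*\<gamma>' - \<delta>*\<delta>'"
  unfolding mink_def rotv_def vector_4
  using cos_sin_cosh_sinh(1)[of "a*t"] cos_sin_cosh_sinh(2)[of "b*t"] by algebra

lemma det_rotv:
  "det (vector [rotv a b t m11 m12 m13 m14, rotv a b t m21 m22 m23 m24,
      rotv a b t m31 m32 m33 m34, rotv a b t m41 m42 m43 m44] :: real^4^4)
   = det (vector [vector [m11, m12, m13, m14], vector [m21, m22, m23, m24],
      vector [m31, m32, m33, m34], vector [m41, m42, m43, m44]] :: real^4^4)" (is "det ?L = det ?M")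
proof -
  define R :: "real^4^4" where
    "R = vector [rotv a b t 1 0 0 0, rotv a b t 0 1 0 0, rotv a b t 0 0 1 0, rotv a b t 0 0 0 1]"
  have "det R = 1"
    unfolding R_def rotv_def det_4 vector_4
    using cos_sin_cosh_sinh(1)[of "a*t"] cos_sin_cosh_sinh(2)[of "b*t"] by algebra
  moreover have "?L = ?M ** R"
    by (simp add: vec_eq_iff forall_4 matrix_matrix_mult_def sum_4 R_def rotv_def vector_4 algebra_simps)
  ultimately show ?thesis by (simp add: det_mul)
qed

text \<open>Differentiation in \<open>t\<close> acts on the coefficients by a constant matrix: a
  rotation generator with factor \<open>a\<close> on the first two and a boost generator with factor
  \<open>b\<close> on the last two.\<close>

lemma has_partials_rotv:
  assumes "(f1 has_real_derivative d1) (at (p$1))" "(f2 has_real_derivative d2) (at (p$1))"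
    "(f3 has_real_derivative d3) (at (p$1))" "(f4 has_real_derivative d4) (at (p$1))"
  shows "has_partials (\<lambda>p. rotv a b (p$2) (f1 (p$1)) (f2 (p$1)) (f3 (p$1)) (f4 (p$1)))
    (rotv a b (p$2) d1 d2 d3 d4)
    (rotv a b (p$2) (- a * f2 (p$1)) (a * f1 (p$1)) (b * f4 (p$1)) (b * f3 (p$1))) p"
proof -
  have prod: "has_partials (\<lambda>p. f (p$1) * g (p$2)) (d * g (p$2)) (f (p$1) * d') p"
    if "(f has_real_derivative d) (at (p$1))" "(g has_real_derivative d') (at (p$2))" for f g d d'
    using has_partials_bilinear[OF bounded_bilinear_mult
        has_partials_fst[OF that(1)[unfolded has_real_derivative_iff_has_vector_derivative]]
        has_partials_snd[OF that(2)[unfolded has_real_derivative_iff_has_vector_derivative]]]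
    by simp
  have trig: "((\<lambda>t. cos (a*t)) has_real_derivative - a * sin (a*t)) (at t)"
    "((\<lambda>t. sin (a*t)) has_real_derivative a * cos (a*t)) (at t)"
    "((\<lambda>t. - sin (a*t)) has_real_derivative - a * cos (a*t)) (at t)"
    "((\<lambda>t. cosh (b*t)) has_real_derivative b * sinh (b*t)) (at t)"
    "((\<lambda>t. sinh (b*t)) has_real_derivative b * cosh (b*t)) (at t)" for t
    by (auto intro!: derivative_eq_intros)
  have sum: "has_partials F A B p"
    if "has_partials f A1 B1 p" "has_partials g A2 B2 p" "A = A1 + A2" "B = B1 + B2"
      "\<And>p. F p = f p + g p" for f g F :: "real^2 \<Rightarrow> real" and A1 B1 A2 B2 A B
    using has_partials_add[OF that(1,2)] that(3,4) by (simp add: that(5) [abs_def])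
  show ?thesis
  proof (rule has_partials_vec)
    fix i :: 4
    consider "i = 1" | "i = 2" | "i = 3" | "i = 4" using exhaust_4 by blast
    then show "has_partials (\<lambda>p. rotv a b (p$2) (f1 (p$1)) (f2 (p$1)) (f3 (p$1)) (f4 (p$1)) $ i)
      (rotv a b (p$2) d1 d2 d3 d4 $ i)
      (rotv a b (p$2) (- a * f2 (p$1)) (a * f1 (p$1)) (b * f4 (p$1)) (b * f3 (p$1)) $ i) p"
    proof cases
      case 1
      show ?thesis
        by (rule sum[OF prod[OF assms(1) trig(1)] prod[OF assms(2) trig(3)]]) (simp_all add: 1 rotv_def vector_4 algebra_simps)
    next
      case 2
      show ?thesis
        by (rule sum[OF prod[OF assms(1) trig(2)] prod[OF assms(2) trig(1)]]) (simp_all add: 2 rotv_def vector_4 algebra_simps)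
    next
      case 3
      show ?thesis
        by (rule sum[OF prod[OF assms(3) trig(4)] prod[OF assms(4) trig(5)]]) (simp_all add: 3 rotv_def vector_4 algebra_simps)
    next
      case 4
      show ?thesis
        by (rule sum[OF prod[OF assms(3) trig(5)] prod[OF assms(4) trig(4)]]) (simp_all add: 4 rotv_def vector_4 algebra_simps)
    qed
  qed
qed

lemma open_rot_domain:
  assumes "open I"
  shows "open (rot_domain I)"
proof -
  have "rot_domain I = (\<lambda>p. p$1) -` I \<inter> (\<lambda>p. p$2) -` {0<..<2*pi}"
    by (auto simp: rot_domain_def)
  then show ?thesis
    using assms by (auto intro!: open_Int open_vimage_vec_nth)
qed

lemma smooth_on_fst:
  fixes f :: "real \<Rightarrow> real"
  assumes "open I" "smooth_on I f"
  shows "smooth_on (rot_domain I) (\<lambda>p. f (p$1))"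
  by (rule smooth_on_compose[OF assms(2,1) open_rot_domain[OF assms(1)]
      smooth_on_linear[OF open_rot_domain[OF assms(1)] bounded_linear_vec_nth]])
    (auto simp: rot_domain_def)

lemma smooth_on_rotv:
  assumes "open I" "smooth_on I f1" "smooth_on I f2" "smooth_on I f3" "smooth_on I f4"
  shows "smooth_on (rot_domain I) (\<lambda>p. rotv a b (p$2) (f1 (p$1)) (f2 (p$1)) (f3 (p$1)) (f4 (p$1)))"
proof -
  let ?U = "rot_domain I"
  note U = open_rot_domain[OF assms(1)]
  have lin: "smooth_on ?U (\<lambda>p. c * p$2)" for c
    by (rule smooth_on_linear[OF U]) (intro bounded_linear_mult_const bounded_linear_const_mult bounded_linear_vec_nth)
  note f = smooth_on_fst[OF assms(1,2)] smooth_on_fst[OF assms(1,3)]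
    smooth_on_fst[OF assms(1,4)] smooth_on_fst[OF assms(1,5)]
  note g = smooth_on_compose_UNIV[OF U smooth_on_sin_cos(1) lin]
    smooth_on_compose_UNIV[OF U smooth_on_sin_cos(2) lin]
    smooth_on_compose_UNIV[OF U smooth_on_sinh_cosh(1) lin]
    smooth_on_compose_UNIV[OF U smooth_on_sinh_cosh(2) lin]
  show ?thesis
  proof (rule smooth_on_vec[OF U])
    fix i :: 4
    consider "i = 1" | "i = 2" | "i = 3" | "i = 4" using exhaust_4 by blast
    then show "smooth_on ?U (\<lambda>p. rotv a b (p$2) (f1 (p$1)) (f2 (p$1)) (f3 (p$1)) (f4 (p$1)) $ i)"
      by cases (simp_all add: rotv_def vector_4 smooth_on_add smooth_on_diff smooth_on_mult U f g)
  qed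
qed

text \<open>The combinations \<open>G A B C E\<close> are closed under differentiation, and the
  first derivative removes the constant \<open>d\<close>. Four derivatives at the interior point
  \<open>pi\<close> give four linear equations.\<close>

lemma trig_hyperbolic_independent:
  fixes a b d A B C E :: real
  assumes "a \<noteq> 0" "b \<noteq> 0"
    and "\<And>t. t \<in> {0<..<2*pi} \<Longrightarrow> A * cos (a*t) + B * sin (a*t) + C * sinh (b*t) + E * cosh (b*t) = d"
  shows "A = 0" "B = 0" "C = 0" "E = 0"
proof -
  define G where "G A B C E t = A * cos (a*t) + B * sin (a*t) + C * sinh (b*t) + E * cosh (b*t)"
    for A B C E t :: real
  have deriv: "(G A B C E has_real_derivative G (a * B) (- (a * A)) (b * E) (b * C) t) (at t)" for A B C E t
    unfolding G_def [abs_def] by (auto intro!: derivative_eq_intros simp: algebra_simps)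
  have step: "G (a * B) (- (a * A)) (b * E) (b * C) t = 0"
    if "\<And>t. t \<in> {0<..<2*pi} \<Longrightarrow> G A B C E t = d" "t \<in> {0<..<2*pi}" for A B C E d t
    by (rule DERIV_eq_on_open[OF open_greaterThanLessThan that(2) that(1) deriv DERIV_const])
  have "pi \<in> {0<..<2*pi}" by simp
  have g0: "G A B C E t = d" if "t \<in> {0<..<2*pi}" for t
    using assms(3)[OF that] by (simp add: G_def)
  note g1 = step[OF g0]
  note g2 = step[OF g1]
  note g3 = step[OF g2]
  note g4 = step[OF g3]
  define p p' q q' where "p = A * cos (a*pi) + B * sin (a*pi)" and "p' = B * cos (a*pi) - A * sin (a*pi)"
    and "q = C * sinh (b*pi) + E * cosh (b*pi)" and "q' = C * cosh (b*pi) + E * sinh (b*pi)"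
  have e: "a * p' + b * q' = 0" "b\<^sup>2 * q - a\<^sup>2 * p = 0" "b^3 * q' - a^3 * p' = 0" "a^4 * p + b^4 * q = 0"
    using g1[of pi] g2[of pi] g3[of pi] g4[of pi] \<open>pi \<in> {0<..<2*pi}\<close>
    by (simp_all add: G_def p_def p'_def q_def q'_def algebra_simps power2_eq_square power3_eq_cube power4_eq_xxxx)
  \<comment> \<open>Odd orders involve only \<open>p'\<close> and \<open>q'\<close>, even orders
    only \<open>p\<close> and \<open>q\<close>. The two systems have determinants
    \<open>a * b * (a\<^sup>2 + b\<^sup>2)\<close> and
    \<open>- a\<^sup>2 * b\<^sup>2 * (a\<^sup>2 + b\<^sup>2)\<close>.\<close>
  have ab: "a\<^sup>2 + b\<^sup>2 \<noteq> 0" using assms(1) by simp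
  have "a * (a\<^sup>2 + b\<^sup>2) * p' = 0" "b * (a\<^sup>2 + b\<^sup>2) * q' = 0" "a\<^sup>2 * (a\<^sup>2 + b\<^sup>2) * p = 0" "b\<^sup>2 * (a\<^sup>2 + b\<^sup>2) * q = 0"
    using e by algebra+
  then have z: "p = 0" "p' = 0" "q = 0" "q' = 0" using assms(1,2) ab by simp_all
  have "A = p * cos (a*pi) - p' * sin (a*pi)" "B = p * sin (a*pi) + p' * cos (a*pi)"
    "C = q' * cosh (b*pi) - q * sinh (b*pi)" "E = q * cosh (b*pi) - q' * sinh (b*pi)"
    unfolding p_def p'_def q_def q'_def
    using cos_sin_cosh_sinh(1)[of "a*pi"] cos_sin_cosh_sinh(2)[of "b*pi"] by algebra+
  then show "A = 0" "B = 0" "C = 0" "E = 0" by (simp_all add: z)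
qed

text \<open>A signed Lorentzian radius in the plane of the last two coordinates. On a double
  rotational surface it returns \<open>w\<close>, so conditions on the profile parameter become
  conditions on the point.\<close>

definition height :: "real^4 \<Rightarrow> real" where
  "height y = (if y$4 \<ge> 0 then sqrt ((y$4)\<^sup>2 - (y$3)\<^sup>2) else - sqrt ((y$4)\<^sup>2 - (y$3)\<^sup>2))"

lemma height_rotv: "height (rotv a b t \<alpha> \<beta> 0 \<delta>) = \<delta>"
proof -
  have "(\<delta> * cosh (b*t))\<^sup>2 - (\<delta> * sinh (b*t))\<^sup>2 = \<delta>\<^sup>2"
    using hyperbolic_pythagoras[of "b*t"] by algebra
  moreover have "0 \<le> \<delta> * cosh (b*t) \<longleftrightarrow> 0 \<le> \<delta>"
    using cosh_real_pos[of "b*t"] mult_neg_pos[of \<delta> "cosh (b*t)"] mult_nonneg_nonneg[of \<delta> "cosh (b*t)"]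
    by linarith
  ultimately show ?thesis
    by (simp add: height_def rotv_def vector_4)
qed

text \<open>The two branches meet at \<open>y$4 = 0\<close>, where the hypothesis makes both of them
  0.\<close>

lemma continuous_on_height:
  assumes "\<And>y. y \<in> S \<Longrightarrow> y$4 = 0 \<Longrightarrow> y$3 = 0"
  shows "continuous_on S height"
proof -
  let ?A = "S \<inter> {y. y$4 \<ge> 0}" and ?B = "S \<inter> {y. y$4 \<le> 0}"
  have S: "?A \<union> ?B = S" by auto
  have "closed {y::real^4. 0 \<le> y$4}" "closed {y::real^4. y$4 \<le> 0}"
    by (intro closed_Collect_le continuous_intros)+
  then have "closedin (top_of_set S) ?A" "closedin (top_of_set S) ?B"
    by (simp_all add: closedin_closed_Int)
  then have "continuous_on (?A \<union> ?B) (\<lambda>y. if y$4 \<ge> 0 then sqrt ((y$4)\<^sup>2 - (y$3)\<^sup>2) else - sqrt ((y$4)\<^sup>2 - (y$3)\<^sup>2))"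
    by (intro continuous_on_cases_local) (auto simp: S intro!: continuous_intros dest: assms)
  then show ?thesis by (simp add: S height_def [abs_def])
qed

subsection \<open>The Gauss map of a double rotational surface\<close>

locale double_rotational =
  fixes a b :: real and I :: "real set" and x w :: "real \<Rightarrow> real"
  assumes a_nz: "a \<noteq> 0" and b_nz: "b \<noteq> 0" and open_I: "open I"
    and smooth_x: "smooth_on I x" and smooth_w: "smooth_on I w"
    and unit_speed: "s \<in> I \<Longrightarrow> (deriv x s)\<^sup>2 - (deriv w s)\<^sup>2 = -1"
    and metric_pos: "s \<in> I \<Longrightarrow> a\<^sup>2 * (x s)\<^sup>2 + b\<^sup>2 * (w s)\<^sup>2 > 0"
begin

definition "x1 = deriv x"
definition "w1 = deriv w"
definition "x2 = deriv x1"
definition "w2 = deriv w1"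
definition "Q s = a\<^sup>2 * (x s)\<^sup>2 + b\<^sup>2 * (w s)\<^sup>2"
definition "Q1 s = 2 * (a\<^sup>2 * x s * x1 s + b\<^sup>2 * w s * w1 s)"
definition "q s = sqrt (Q s)"

text \<open>In the moving frame \<open>e\<^sub>1, e\<^sub>2, e\<^sub>3, e\<^sub>4\<close> below, \<open>h(e\<^sub>1,e\<^sub>1) = \<kappa> e\<^sub>3\<close>, \<open>h(e\<^sub>2,e\<^sub>2) = -\<mu> e\<^sub>3\<close>,
  \<open>h(e\<^sub>1,e\<^sub>2) = \<tau> e\<^sub>4\<close>, and \<open>\<sigma>\<close> is the normal connection form \<open>\<langle>D\<^sub>2 e\<^sub>3, e\<^sub>4\<rangle>\<close>, where \<open>D\<^sub>2\<close> is
  the ambient derivative along \<open>e\<^sub>2\<close>.\<close>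

definition "\<kappa> s = x2 s * w1 s - w2 s * x1 s"
definition "\<mu> s = (a\<^sup>2 * x s * w1 s + b\<^sup>2 * w s * x1 s) / Q s"
definition "\<tau> s = a * b * (x s * w1 s - x1 s * w s) / Q s"
definition "\<sigma> s = a * b * (x s * x1 s - w s * w1 s) / Q s"

lemma smooth_x1: "smooth_on I x1" and smooth_w1: "smooth_on I w1"
  by (simp_all add: x1_def w1_def smooth_on_deriv smooth_x smooth_w open_I)

lemma smooth_x2: "smooth_on I x2" and smooth_w2: "smooth_on I w2"
  by (simp_all add: x2_def w2_def smooth_on_deriv smooth_x1 smooth_w1 open_I)

lemma Q_pos: "s \<in> I \<Longrightarrow> Q s > 0"
  using metric_pos by (simp add: Q_def)

lemma q_pos: "s \<in> I \<Longrightarrow> q s > 0" and q_sq: "s \<in> I \<Longrightarrow> q s * q s = Q s"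
  using Q_pos[of s] by (simp_all add: q_def)

lemma smooth_Q: "smooth_on I Q"
  unfolding Q_def by (intro smooth_on_intros smooth_x smooth_w open_I)

lemma smooth_q: "smooth_on I q"
  unfolding q_def by (intro smooth_on_sqrt_compose smooth_Q Q_pos open_I)

lemma smooth_\<kappa>: "smooth_on I \<kappa>"
  unfolding \<kappa>_def by (intro smooth_on_intros smooth_x1 smooth_w1 smooth_x2 smooth_w2 open_I)

lemma x_DERIV: "s \<in> I \<Longrightarrow> (x has_real_derivative x1 s) (at s)"
  and w_DERIV: "s \<in> I \<Longrightarrow> (w has_real_derivative w1 s) (at s)"
  and x1_DERIV0: "s \<in> I \<Longrightarrow> (x1 has_real_derivative x2 s) (at s)"
  and w1_DERIV0: "s \<in> I \<Longrightarrow> (w1 has_real_derivative w2 s) (at s)"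
  using smooth_x smooth_w smooth_x1 smooth_w1
  by (simp_all add: x1_def w1_def x2_def w2_def smooth_on_real_DERIV)

lemma \<kappa>_DERIV: "s \<in> I \<Longrightarrow> (\<kappa> has_real_derivative deriv \<kappa> s) (at s)"
  by (rule smooth_on_real_DERIV[OF smooth_\<kappa>])

lemma speed: "s \<in> I \<Longrightarrow> x1 s * x1 s = w1 s * w1 s - 1"
  using unit_speed[of s] by (simp add: x1_def w1_def power2_eq_square)

lemma speed_deriv:
  assumes "s \<in> I"
  shows "x1 s * x2 s = w1 s * w2 s"
  using DERIV_eq_on_open[OF open_I assms speed DERIV_mult[OF x1_DERIV0 x1_DERIV0]
      DERIV_diff[OF DERIV_mult[OF w1_DERIV0 w1_DERIV0] DERIV_const]] assms
  by (simp add: algebra_simps)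

text \<open>Frenet equations in the Lorentz plane: the acceleration is orthogonal to the unit
  velocity \<open>(x1, w1)\<close>, hence \<kappa> times the unit normal
  \<open>(w1, x1)\<close>.\<close>

lemma x2_eq: "s \<in> I \<Longrightarrow> x2 s = \<kappa> s * w1 s" and w2_eq: "s \<in> I \<Longrightarrow> w2 s = \<kappa> s * x1 s"
  using speed[of s] speed_deriv[of s] unfolding \<kappa>_def by algebra+

lemma x1_DERIV: "s \<in> I \<Longrightarrow> (x1 has_real_derivative \<kappa> s * w1 s) (at s)"
  and w1_DERIV: "s \<in> I \<Longrightarrow> (w1 has_real_derivative \<kappa> s * x1 s) (at s)"
  using x1_DERIV0[of s] w1_DERIV0[of s] x2_eq w2_eq by simp_all

lemma Q_DERIV:
  assumes "s \<in> I"
  shows "(Q has_real_derivative Q1 s) (at s)"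
  unfolding Q_def [abs_def] Q1_def
  by (auto intro!: derivative_eq_intros x_DERIV w_DERIV assms simp: algebra_simps)

lemma q_DERIV:
  assumes "s \<in> I"
  shows "(q has_real_derivative Q1 s / (2 * q s)) (at s)"
  unfolding q_def [abs_def]
  by (rule DERIV_cong[OF DERIV_chain2[OF DERIV_real_sqrt[OF Q_pos[OF assms]] Q_DERIV[OF assms]]])
    (simp add: field_simps)

lemma mu_Q: "s \<in> I \<Longrightarrow> \<mu> s * Q s = a\<^sup>2 * x s * w1 s + b\<^sup>2 * w s * x1 s"
  and tau_Q: "s \<in> I \<Longrightarrow> \<tau> s * Q s = a * b * (x s * w1 s - x1 s * w s)"
  and sigma_Q: "s \<in> I \<Longrightarrow> \<sigma> s * Q s = a * b * (x s * x1 s - w s * w1 s)"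
  using Q_pos[of s] by (simp_all add: \<mu>_def \<tau>_def \<sigma>_def)

text \<open>One of the two Codazzi equations, verified directly from the closed formula for
  \<tau>.\<close>

lemma \<tau>_DERIV:
  assumes "s \<in> I"
  shows "(\<tau> has_real_derivative \<kappa> s * \<sigma> s - Q1 s / Q s * \<tau> s) (at s)"
proof -
  have "((\<lambda>s. a * b * (x s * w1 s - x1 s * w s)) has_real_derivative
      a * b * (x1 s * w1 s + \<kappa> s * x1 s * x s - (\<kappa> s * w1 s * w s + w1 s * x1 s))) (at s)"
    by (intro DERIV_cmult DERIV_diff DERIV_mult x_DERIV w_DERIV x1_DERIV w1_DERIV assms)
  from DERIV_divide[OF this Q_DERIV[OF assms]] Q_pos[OF assms]
  have "(\<tau> has_real_derivative (a * b * (x1 s * w1 s + \<kappa> s * x1 s * x s - (\<kappa> s * w1 s * w s + w1 s * x1 s)) * Q s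
      - a * b * (x s * w1 s - x1 s * w s) * Q1 s) / (Q s * Q s)) (at s)"
    by (simp add: \<tau>_def [abs_def])
  also have "a * b * (x1 s * w1 s + \<kappa> s * x1 s * x s - (\<kappa> s * w1 s * w s + w1 s * x1 s)) = \<kappa> s * (\<sigma> s * Q s)"
    unfolding sigma_Q[OF assms] by (simp add: algebra_simps)
  also have "(\<kappa> s * (\<sigma> s * Q s) * Q s - a * b * (x s * w1 s - x1 s * w s) * Q1 s) / (Q s * Q s)
      = \<kappa> s * \<sigma> s - Q1 s / Q s * \<tau> s"
    unfolding tau_Q[OF assms, symmetric] using Q_pos[OF assms] by (simp add: field_simps)
  finally show ?thesis .
qed

text \<open>The other Codazzi equation. It expresses the derivative of \<mu> by \<kappa> without the
  derivative of \<kappa>.\<close>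

lemma \<mu>_DERIV:
  assumes "s \<in> I"
  shows "(\<mu> has_real_derivative Q1 s / (2 * Q s) * (\<kappa> s - \<mu> s) + \<tau> s * \<sigma> s) (at s)"
proof -
  let ?N = "a\<^sup>2 * x s * w1 s + b\<^sup>2 * w s * x1 s"
  let ?N' = "(a\<^sup>2 + b\<^sup>2) * x1 s * w1 s + \<kappa> s * Q1 s / 2"
  have "((\<lambda>s. a\<^sup>2 * x s * w1 s + b\<^sup>2 * w s * x1 s) has_real_derivative ?N') (at s)"
    by (auto intro!: derivative_eq_intros x_DERIV w_DERIV x1_DERIV w1_DERIV assms
        simp: Q1_def algebra_simps)
  from DERIV_divide[OF this Q_DERIV[OF assms]] Q_pos[OF assms]
  have "(\<mu> has_real_derivative (?N' * Q s - ?N * Q1 s) / (Q s * Q s)) (at s)"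
    by (simp add: \<mu>_def [abs_def])
  \<comment> \<open>The terms free of \<kappa>, namely
    \<open>(a\<^sup>2 + b\<^sup>2) * x1 s * w1 s * Q s - ?N * Q1 s / 2\<close>, factor into the
    numerators of \<tau> and \<sigma>.\<close>
  also have "?N' * Q s - ?N * Q1 s = \<kappa> s * Q1 s / 2 * Q s - ?N * Q1 s / 2
      + (a * b * (x s * w1 s - x1 s * w s)) * (a * b * (x s * x1 s - w s * w1 s))"
    unfolding Q1_def Q_def by (simp add: field_simps power2_eq_square)
  also have "\<dots> = \<kappa> s * Q1 s / 2 * Q s - \<mu> s * Q s * Q1 s / 2 + \<tau> s * Q s * (\<sigma> s * Q s)"
    unfolding mu_Q[OF assms] tau_Q[OF assms] sigma_Q[OF assms] ..
  also have "\<dots> / (Q s * Q s) = Q1 s / (2 * Q s) * (\<kappa> s - \<mu> s) + \<tau> s * \<sigma> s"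
    using Q_pos[OF assms] by (simp add: field_simps)
  finally show ?thesis .
qed

section \<open>The adapted orthonormal frame and its derivatives\<close>

definition e1 :: "real^2 \<Rightarrow> real^4" where
  "e1 p = rotv a b (p$2) (x1 (p$1)) 0 0 (w1 (p$1))"
definition e2 :: "real^2 \<Rightarrow> real^4" where
  "e2 p = rotv a b (p$2) 0 (a * x (p$1) / q (p$1)) (b * w (p$1) / q (p$1)) 0"
definition e3 :: "real^2 \<Rightarrow> real^4" where
  "e3 p = rotv a b (p$2) (w1 (p$1)) 0 0 (x1 (p$1))"
definition e4 :: "real^2 \<Rightarrow> real^4" where
  "e4 p = rotv a b (p$2) 0 (- (b * w (p$1) / q (p$1))) (a * x (p$1) / q (p$1)) 0"

text \<open>The two quotients are cosine and sine of an angle, because their squares add up to 1.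
  The lemma says that \<tau> is the derivative of this angle.\<close>

lemma X_DERIV:
  assumes "s \<in> I"
  shows "((\<lambda>s. a * x s / q s) has_real_derivative - (\<tau> s * (b * w s / q s))) (at s)"
    and "((\<lambda>s. b * w s / q s) has_real_derivative \<tau> s * (a * x s / q s)) (at s)"
proof -
  note qp = q_pos[OF assms] and qq = q_sq[OF assms]
  have "Q s \<noteq> 0" "q s \<noteq> 0" using Q_pos[OF assms] qp by auto
  have "((\<lambda>s. a * x s / q s) has_real_derivative
      ((a * x1 s) * q s - a * x s * (Q1 s / (2 * q s))) / (q s * q s)) (at s)"
    by (intro DERIV_divide DERIV_cmult x_DERIV q_DERIV assms) (use qp in auto)
  moreover have "((a * x1 s) * q s - a * x s * (Q1 s / (2 * q s))) / (q s * q s)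
      = a * (x1 s * Q s - x s * Q1 s / 2) / (q s * Q s)"
    using \<open>q s \<noteq> 0\<close> \<open>Q s \<noteq> 0\<close> qq by (simp add: field_simps)
  moreover have "a * (x1 s * Q s - x s * Q1 s / 2) = - (\<tau> s * Q s * (b * w s))"
    unfolding tau_Q[OF assms] by (simp add: Q_def Q1_def power2_eq_square algebra_simps)
  moreover have "- (\<tau> s * Q s * (b * w s)) / (q s * Q s) = - (\<tau> s * (b * w s / q s))"
    using \<open>Q s \<noteq> 0\<close> by simp
  ultimately show "((\<lambda>s. a * x s / q s) has_real_derivative - (\<tau> s * (b * w s / q s))) (at s)"
    by simp
  have "((\<lambda>s. b * w s / q s) has_real_derivative
      ((b * w1 s) * q s - b * w s * (Q1 s / (2 * q s))) / (q s * q s)) (at s)"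
    by (intro DERIV_divide DERIV_cmult w_DERIV q_DERIV assms) (use qp in auto)
  moreover have "((b * w1 s) * q s - b * w s * (Q1 s / (2 * q s))) / (q s * q s)
      = b * (w1 s * Q s - w s * Q1 s / 2) / (q s * Q s)"
    using \<open>q s \<noteq> 0\<close> \<open>Q s \<noteq> 0\<close> qq by (simp add: field_simps)
  moreover have "b * (w1 s * Q s - w s * Q1 s / 2) = \<tau> s * Q s * (a * x s)"
    unfolding tau_Q[OF assms] by (simp add: Q_def Q1_def power2_eq_square algebra_simps)
  moreover have "\<tau> s * Q s * (a * x s) / (q s * Q s) = \<tau> s * (a * x s / q s)"
    using \<open>Q s \<noteq> 0\<close> by simp
  ultimately show "((\<lambda>s. b * w s / q s) has_real_derivative \<tau> s * (a * x s / q s)) (at s)"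
    by simp
qed

abbreviation "q1 s \<equiv> Q1 s / (2 * q s)"

text \<open>These are the components of the \<open>t\<close>-derivatives of \<open>e1\<close>,
  \<open>e2\<close>, \<open>e3\<close>, \<open>e4\<close>, two equations each, expressed in the
  frame again. They rest on two normalizations: \<open>(x1, w1)\<close> on the unit hyperbola and
  the two quotients on the unit circle.\<close>

lemma frame_coefficients:
  assumes s: "s \<in> I"
  shows "a * x1 s = q1 s * (a * x s / q s) - q s * \<tau> s * (b * w s / q s)"
    "b * w1 s = q1 s * (b * w s / q s) + q s * \<tau> s * (a * x s / q s)"
    "- a * (a * x s / q s) = q1 s * x1 s - q s * \<mu> s * w1 s"
    "b * (b * w s / q s) = q1 s * w1 s - q s * \<mu> s * x1 s"
    "a * w1 s = q s * \<mu> s * (a * x s / q s) - q s * \<sigma> s * (b * w s / q s)"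
    "b * x1 s = q s * \<mu> s * (b * w s / q s) + q s * \<sigma> s * (a * x s / q s)"
    "a * (b * w s / q s) = q s * \<tau> s * x1 s - q s * \<sigma> s * w1 s"
    "b * (a * x s / q s) = q s * \<tau> s * w1 s - q s * \<sigma> s * x1 s"
proof -
  \<comment> \<open>Naming the reciprocal of \<open>q\<close> turns every equation into a polynomial
    identity modulo \<open>qy\<close> and one of \<open>Qy\<close> and the speed equation, which
    \<open>algebra\<close> can decide.\<close>
  define y where "y = 1 / q s"
  have qy: "q s * y = 1" using q_pos[OF s] by (simp add: y_def)
  have div: "z / q s = z * y" "z / Q s = z * (y * y)" for z
    using q_sq[OF s, symmetric] by (simp_all add: y_def)
  have Qy: "y * y * (a * a * x s * x s + b * b * w s * w s) = 1"
  proof -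
    have "a * a * x s * x s + b * b * w s * w s = q s * q s"
      using q_sq[OF s] by (simp add: Q_def power2_eq_square algebra_simps)
    then show ?thesis using qy by algebra
  qed
  have q1: "q1 s = (a * a * x s * x1 s + b * b * w s * w1 s) * y"
    unfolding Q1_def y_def power2_eq_square mult_divide_mult_cancel_left_if by simp
  note defs = q1 \<tau>_def \<mu>_def \<sigma>_def div power2_eq_square
  show "a * x1 s = q1 s * (a * x s / q s) - q s * \<tau> s * (b * w s / q s)"
    using qy Qy unfolding defs by algebra
  show "b * w1 s = q1 s * (b * w s / q s) + q s * \<tau> s * (a * x s / q s)"
    using qy Qy unfolding defs by algebra
  show "- a * (a * x s / q s) = q1 s * x1 s - q s * \<mu> s * w1 s"
    using qy speed[OF s] unfolding defs by algebra
  show "b * (b * w s / q s) = q1 s * w1 s - q s * \<mu> s * x1 s"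
    using qy speed[OF s] unfolding defs by algebra
  show "a * w1 s = q s * \<mu> s * (a * x s / q s) - q s * \<sigma> s * (b * w s / q s)"
    using qy Qy unfolding defs by algebra
  show "b * x1 s = q s * \<mu> s * (b * w s / q s) + q s * \<sigma> s * (a * x s / q s)"
    using qy Qy unfolding defs by algebra
  show "a * (b * w s / q s) = q s * \<tau> s * x1 s - q s * \<sigma> s * w1 s"
    using qy speed[OF s] unfolding defs by algebra
  show "b * (a * x s / q s) = q s * \<tau> s * w1 s - q s * \<sigma> s * x1 s"
    using qy speed[OF s] unfolding defs by algebra
qed

text \<open>The Gauss and Weingarten formulas. The factor \<open>q\<close> in the
  \<open>t\<close>-derivatives arises because the coordinate vector of \<open>t\<close> is
  \<open>q\<close> times \<open>e2\<close>.\<close>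

lemma frame_partials:
  assumes "p \<in> rot_domain I"
  defines "s \<equiv> p$1"
  shows e1_partials: "has_partials e1 (\<kappa> s *\<^sub>R e3 p) (q1 s *\<^sub>R e2 p + (q s * \<tau> s) *\<^sub>R e4 p) p"
    and e2_partials: "has_partials e2 (\<tau> s *\<^sub>R e4 p) (q1 s *\<^sub>R e1 p - (q s * \<mu> s) *\<^sub>R e3 p) p"
    and e3_partials: "has_partials e3 (\<kappa> s *\<^sub>R e1 p)
      ((q s * \<mu> s) *\<^sub>R e2 p + (q s * \<sigma> s) *\<^sub>R e4 p) p"
    and e4_partials: "has_partials e4 (- \<tau> s *\<^sub>R e2 p)
      ((q s * \<tau> s) *\<^sub>R e1 p - (q s * \<sigma> s) *\<^sub>R e3 p) p"
proof -
  have s: "s \<in> I" using assms by (simp add: rot_domain_def)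
  note c = frame_coefficients[OF s]
  note R = has_partials_rotv[where a = a and b = b and p = p, folded s_def]
  note K = DERIV_const[where k = 0]
  have e1: "q1 s *\<^sub>R e2 p + (q s * \<tau> s) *\<^sub>R e4 p = rotv a b (p$2) (- a * 0) (a * x1 s) (b * w1 s) (b * 0)"
    unfolding e2_def e4_def rotv_scaleR rotv_add s_def[symmetric] c(1,2) by simp
  show "has_partials e1 (\<kappa> s *\<^sub>R e3 p) (q1 s *\<^sub>R e2 p + (q s * \<tau> s) *\<^sub>R e4 p) p"
    using R[OF x1_DERIV[OF s] K K w1_DERIV[OF s]]
    unfolding e1 by (simp add: e1_def [abs_def] e3_def rotv_scaleR s_def)
  have e2: "q1 s *\<^sub>R e1 p - (q s * \<mu> s) *\<^sub>R e3 p =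
      rotv a b (p$2) (- a * (a * x s / q s)) (a * 0) (b * 0) (b * (b * w s / q s))"
    unfolding e1_def e3_def rotv_scaleR rotv_diff s_def[symmetric] c(3,4) by simp
  show "has_partials e2 (\<tau> s *\<^sub>R e4 p) (q1 s *\<^sub>R e1 p - (q s * \<mu> s) *\<^sub>R e3 p) p"
    using R[OF K X_DERIV[OF s] K]
    unfolding e2 by (simp add: e2_def [abs_def] e4_def rotv_scaleR s_def)
  have e3: "(q s * \<mu> s) *\<^sub>R e2 p + (q s * \<sigma> s) *\<^sub>R e4 p =
      rotv a b (p$2) (- a * 0) (a * w1 s) (b * x1 s) (b * 0)"
    unfolding e2_def e4_def rotv_scaleR rotv_add s_def[symmetric] c(5,6) by simp
  show "has_partials e3 (\<kappa> s *\<^sub>R e1 p) ((q s * \<mu> s) *\<^sub>R e2 p + (q s * \<sigma> s) *\<^sub>R e4 p) p"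
    using R[OF w1_DERIV[OF s] K K x1_DERIV[OF s]]
    unfolding e3 by (simp add: e3_def [abs_def] e1_def rotv_scaleR s_def)
  have e4: "(q s * \<tau> s) *\<^sub>R e1 p - (q s * \<sigma> s) *\<^sub>R e3 p =
      rotv a b (p$2) (- a * - (b * w s / q s)) (a * 0) (b * 0) (b * (a * x s / q s))"
    unfolding e1_def e3_def rotv_scaleR rotv_diff s_def[symmetric] by (simp add: c(7,8)[symmetric])
  show "has_partials e4 (- \<tau> s *\<^sub>R e2 p) ((q s * \<tau> s) *\<^sub>R e1 p - (q s * \<sigma> s) *\<^sub>R e3 p) p"
    using R[OF K DERIV_minus[OF X_DERIV(2)[OF s]] X_DERIV(1)[OF s] K]
    unfolding e4 by (simp add: e4_def [abs_def] e2_def rotv_scaleR s_def)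
qed

text \<open>The logarithmic derivative of \<open>q\<close>, that is, the Levi-Civita connection
  coefficient of the tangent frame.\<close>

definition "\<rho> s = Q1 s / (2 * Q s)"

lemma q1_eq: "s \<in> I \<Longrightarrow> q1 s = q s * \<rho> s"
  using q_pos[of s] by (simp add: \<rho>_def q_sq[symmetric])

lemma Q1_eq: "s \<in> I \<Longrightarrow> Q1 s / Q s = 2 * \<rho> s"
  by (simp add: \<rho>_def)

lemma mink_frame:
  assumes "p \<in> rot_domain I"
  shows "mink (e1 p) (e1 p) = -1" "mink (e2 p) (e2 p) = 1" "mink (e3 p) (e3 p) = 1"
    "mink (e4 p) (e4 p) = 1"
    "mink (e1 p) (e2 p) = 0" "mink (e1 p) (e3 p) = 0" "mink (e1 p) (e4 p) = 0"
    "mink (e2 p) (e3 p) = 0" "mink (e2 p) (e4 p) = 0" "mink (e3 p) (e4 p) = 0"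
    "mink (e2 p) (e1 p) = 0" "mink (e3 p) (e1 p) = 0" "mink (e4 p) (e1 p) = 0"
    "mink (e3 p) (e2 p) = 0" "mink (e4 p) (e2 p) = 0" "mink (e4 p) (e3 p) = 0"
proof -
  have s: "p$1 \<in> I" using assms by (simp add: rot_domain_def)
  have "a * x (p$1) * (a * x (p$1)) + b * w (p$1) * (b * w (p$1)) = q (p$1) * q (p$1)"
    unfolding q_sq[OF s] by (simp add: Q_def power2_eq_square algebra_simps)
  then have "a * x (p$1) / q (p$1) * (a * x (p$1) / q (p$1))
      + b * w (p$1) / q (p$1) * (b * w (p$1) / q (p$1)) = 1"
    using q_pos[OF s] by (simp add: add_divide_distrib[symmetric])
  then show "mink (e2 p) (e2 p) = 1" "mink (e4 p) (e4 p) = 1"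
    by (simp_all add: e2_def e4_def mink_rotv add.commute)
qed (use assms speed in \<open>simp_all add: rot_domain_def e1_def e2_def e3_def e4_def mink_rotv\<close>)

lemma smooth_frame:
  "smooth_on (rot_domain I) e1" "smooth_on (rot_domain I) e2"
  "smooth_on (rot_domain I) e3" "smooth_on (rot_domain I) e4"
proof -
  have X: "smooth_on I (\<lambda>s. a * x s / q s)" and W: "smooth_on I (\<lambda>s. b * w s / q s)"
    using q_pos
    by (fastforce intro!: smooth_on_divide smooth_on_mult smooth_on_const smooth_q smooth_x smooth_w open_I)+
  have Z: "smooth_on I (\<lambda>s. 0::real)"
    by (rule smooth_on_const[OF open_I])
  note r = smooth_on_rotv[OF open_I, where a = a and b = b]
  show "smooth_on (rot_domain I) e1" "smooth_on (rot_domain I) e2"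
    "smooth_on (rot_domain I) e3" "smooth_on (rot_domain I) e4"
    using r[OF smooth_x1 Z Z smooth_w1] r[OF Z X W Z] r[OF smooth_w1 Z Z smooth_x1]
      r[OF Z smooth_on_minus[OF open_I W] X Z]
    by (simp_all add: e1_def [abs_def] e2_def [abs_def] e3_def [abs_def] e4_def [abs_def])
qed

definition r_t :: "real^2 \<Rightarrow> real^4" where
  "r_t p = rotv a b (p$2) 0 (a * x (p$1)) (b * w (p$1)) 0"
definition r_ss :: "real^2 \<Rightarrow> real^4" where
  "r_ss p = rotv a b (p$2) (\<kappa> (p$1) * w1 (p$1)) 0 0 (\<kappa> (p$1) * x1 (p$1))"
definition r_st :: "real^2 \<Rightarrow> real^4" where
  "r_st p = rotv a b (p$2) 0 (a * x1 (p$1)) (b * w1 (p$1)) 0"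
definition r_tt :: "real^2 \<Rightarrow> real^4" where
  "r_tt p = rotv a b (p$2) (- (a * (a * x (p$1)))) 0 0 (b * (b * w (p$1)))"

lemma r_t_eq: "p \<in> rot_domain I \<Longrightarrow> r_t p = q (p$1) *\<^sub>R e2 p"
  using q_pos[of "p$1"] by (simp add: r_t_def e2_def rotv_scaleR rot_domain_def)

lemma r_partials:
  assumes "p \<in> rot_domain I"
  shows "has_partials (double_rot a b x w) (e1 p) (r_t p) p"
    "has_partials e1 (r_ss p) (r_st p) p" "has_partials r_t (r_st p) (r_tt p) p"
proof -
  have s: "p$1 \<in> I" using assms by (simp add: rot_domain_def)
  note R = has_partials_rotv[where a = a and b = b and p = p]
  note K = DERIV_const[where k = 0]
  show "has_partials (double_rot a b x w) (e1 p) (r_t p) p"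
    using R[OF x_DERIV[OF s] K K w_DERIV[OF s]]
    by (simp add: double_rot_eq_rotv [abs_def] e1_def r_t_def)
  show "has_partials e1 (r_ss p) (r_st p) p"
    using R[OF x1_DERIV[OF s] K K w1_DERIV[OF s]]
    by (simp add: e1_def [abs_def] r_ss_def r_st_def)
  show "has_partials r_t (r_st p) (r_tt p) p"
    using R[OF K DERIV_cmult[OF x_DERIV[OF s], of a] DERIV_cmult[OF w_DERIV[OF s], of b] K]
    by (simp add: r_t_def [abs_def] r_st_def r_tt_def)
qed

sublocale orthogonal_surface "double_rot a b x w" e1 r_t r_ss r_st r_tt "rot_domain I" Q Q1
proof
  fix p :: "real^2" assume p: "p \<in> rot_domain I"
  then have s: "p$1 \<in> I" by (simp add: rot_domain_def)
  show "mink (e1 p) (e1 p) = -1" "mink (e1 p) (r_t p) = 0" "mink (r_t p) (r_t p) = Q (p$1)"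
    using p s by (simp_all add: r_t_eq mink.scaleR_right mink.scaleR_left mink_frame q_sq)
  show "0 < Q (p$1)" "(Q has_real_derivative Q1 (p$1)) (at (p$1))"
    using Q_pos[OF s] Q_DERIV[OF s] .
qed (simp_all add: open_rot_domain open_I r_partials)

text \<open>The factor \<open>c\<close> covers both the orthonormal frame, with \<open>c\<close> =
  1, and the coordinate vector \<open>r_t\<close>, with \<open>c\<close> = \<open>q\<close>.\<close>

lemma det_frame:
  assumes "p \<in> rot_domain I"
  shows "det (vector [e1 p, c *\<^sub>R e2 p, e3 p, e4 p] :: real^4^4) = c"
proof -
  have s: "p$1 \<in> I" using assms by (simp add: rot_domain_def)
  define X W where "X = a * x (p$1) / q (p$1)" and "W = b * w (p$1) / q (p$1)"
  have "X * X + W * W = 1"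
    using mink_frame(2)[OF assms] by (simp add: e2_def mink_rotv X_def W_def)
  then show ?thesis
    using speed[OF s]
    unfolding e1_def e2_def e3_def e4_def rotv_scaleR det_rotv X_def[symmetric] W_def[symmetric]
    unfolding det_4 vector_4 by algebra
qed

lemma frame_exists:
  assumes "p \<in> rot_domain I"
  shows "\<exists>V E e. oriented_frame (double_rot a b x w) V E e \<and> p \<in> V"
proof -
  define E :: "nat \<Rightarrow> real^2 \<Rightarrow> real^2" where
    "E i = (if i = 1 then (\<lambda>p. vector [1, 0]) else (\<lambda>p. vector [0, 1 / q (p$1)]))" for i
  define e :: "nat \<Rightarrow> real^2 \<Rightarrow> real^4" where
    "e A = (if A = 1 then e1 else if A = 2 then e2 else if A = 3 then e3 else e4)" for A
  have four: "{1..4} = {1, 2, 3, 4::nat}" by auto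
  have sE: "smooth_on (rot_domain I) (E i)" for i
  proof -
    have "smooth_on (rot_domain I) (\<lambda>p. 1 / q (p$1))"
    proof (rule smooth_on_divide)
      show "smooth_on (rot_domain I) (\<lambda>p. q (p$1))"
        by (rule smooth_on_fst[OF open_I smooth_q])
      show "p \<in> rot_domain I \<Longrightarrow> q (p$1) \<noteq> 0" for p
        using q_pos[of "p$1"] by (simp add: rot_domain_def)
    qed (simp_all add: open_rot_domain open_I smooth_on_const)
    then have "smooth_on (rot_domain I) (\<lambda>p. vector [0, 1 / q (p$1)] :: real^2)"
    proof (intro smooth_on_vec open_rot_domain open_I)
      fix i :: 2
      show "smooth_on (rot_domain I) (\<lambda>p. (vector [0, 1 / q (p$1)] :: real^2) $ i)"
        if "smooth_on (rot_domain I) (\<lambda>p. 1 / q (p$1))"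
        using that exhaust_2[of i] by (auto simp: smooth_on_const open_rot_domain open_I)
    qed
    then show ?thesis
      by (simp add: E_def smooth_on_const open_rot_domain open_I)
  qed
  have se: "smooth_on (rot_domain I) (e A)" for A
    using smooth_frame by (simp add: e_def)
  have "oriented_frame (double_rot a b x w) (rot_domain I) E e"
    unfolding oriented_frame_def
  proof (intro conjI ballI)
    fix p :: "real^2" assume p: "p \<in> rot_domain I"
    then have s: "p$1 \<in> I" by (simp add: rot_domain_def)
    note qp = q_pos[OF s]
    show "e i p = D (E i) (double_rot a b x w) p" if "i \<in> {1,2}" for i
      using that qp by (auto simp: D_eq[OF r_partials(1)[OF p]] e_def E_def r_t_eq[OF p])
    show "\<forall>j. mink (e k p) (partial j (double_rot a b x w) p) = 0" if "k \<in> {3,4}" for k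
      using that
      by (auto simp: forall_2 partial_eq[OF r_partials(1)[OF p]] r_t_eq[OF p] e_def mink_frame[OF p]
          mink.scaleR_right)
    show "A \<noteq> B \<longrightarrow> mink (e A p) (e B p) = 0" if "A \<in> {1..4}" "B \<in> {1..4}" for A B
      using that unfolding four by (auto simp: e_def mink_frame[OF p])
    show "mink (e A p) (e A p) \<in> {1, -1}" if "A \<in> {1..4}" for A
      using that unfolding four by (auto simp: e_def mink_frame[OF p])
    show "det (vector [E 1 p, E 2 p] :: real^2^2) > 0"
      using qp by (simp add: det_2 E_def)
    show "det (vector [e 1 p, e 2 p, e 3 p, e 4 p] :: real^4^4) > 0"
      using det_frame[OF p, of 1] by (simp add: e_def)
  qed (simp_all add: open_rot_domain open_I sE se)
  with assms show ?thesis by blast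
qed

lemma normal_frame:
  assumes "p \<in> rot_domain I"
  shows "mink (e3 p) (e1 p) = 0" "mink (e3 p) (r_t p) = 0" "mink (e4 p) (e1 p) = 0"
    "mink (e4 p) (r_t p) = 0" "mink (e3 p) (e3 p) = 1" "mink (e4 p) (e4 p) = 1" "mink (e3 p) (e4 p) = 0"
    "det (vector [e1 p, r_t p, e3 p, e4 p] :: real^4^4) > 0"
  using assms q_pos[of "p$1"]
  by (simp_all add: r_t_eq mink_frame mink.scaleR_right det_frame rot_domain_def)

lemma gauss_map_double_rot:
  "p \<in> rot_domain I \<Longrightarrow> gauss_map (double_rot a b x w) p = wedge (e3 p) (e4 p)"
  by (rule gauss_map_eq[OF _ frame_exists normal_frame])

lemma second_ff_norm_sq_double_rot:
  assumes "p \<in> rot_domain I"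
  shows "second_ff_norm_sq (double_rot a b x w) p
    = (\<kappa> (p$1))\<^sup>2 + (\<mu> (p$1))\<^sup>2 - 2 * (\<tau> (p$1))\<^sup>2"
proof -
  define s where "s = p$1"
  have s: "s \<in> I" using assms by (simp add: rot_domain_def s_def)
  have e1t: "r_st p = q1 s *\<^sub>R e2 p + (q s * \<tau> s) *\<^sub>R e4 p"
    using frame_coefficients(1,2)[OF s]
    by (simp add: r_st_def e2_def e4_def rotv_scaleR rotv_add s_def)
  have e2t: "r_tt p = q s *\<^sub>R (q1 s *\<^sub>R e1 p - (q s * \<mu> s) *\<^sub>R e3 p)"
  proof -
    have "q1 s *\<^sub>R e1 p - (q s * \<mu> s) *\<^sub>R e3 p =
        rotv a b (p$2) (- a * (a * x s / q s)) 0 0 (b * (b * w s / q s))"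
      unfolding e1_def e3_def rotv_scaleR rotv_diff s_def[symmetric] frame_coefficients(3,4)[OF s]
      by simp
    then show ?thesis
      using q_pos[OF s] by (simp add: r_tt_def rotv_scaleR s_def[symmetric])
  qed
  \<comment> \<open>The coordinate components of \<open>h\<close>; each index \<open>t\<close>
    contributes one factor \<open>q\<close>.\<close>
  have H11: "r_ss p = \<kappa> s *\<^sub>R e3 p"
    by (simp add: r_ss_def e3_def rotv_scaleR s_def)
  have H12: "r_st p - (Q1 (p$1) / (2 * Q (p$1))) *\<^sub>R r_t p = (q s * \<tau> s) *\<^sub>R e4 p"
    using q_pos[OF s] unfolding e1t r_t_eq[OF assms] s_def[symmetric] q_sq[OF s, symmetric] by simp
  have H22: "r_tt p - (Q1 (p$1) / 2) *\<^sub>R e1 p = - (q s * q s * \<mu> s) *\<^sub>R e3 p"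
    using q_pos[OF s] unfolding e2t s_def[symmetric] by (simp add: algebra_simps)
  note H = H11 H12 H22
  show ?thesis
  proof (subst second_ff_norm_sq_eq[OF assms frame_exists[OF assms] normal_frame[OF assms]])
    show "mink (r_ss p) (r_ss p)
      - 2 * mink (r_st p - (Q1 (p$1) / (2 * Q (p$1))) *\<^sub>R r_t p) (r_st p - (Q1 (p$1) / (2 * Q (p$1))) *\<^sub>R r_t p) / Q (p$1)
      + mink (r_tt p - (Q1 (p$1) / 2) *\<^sub>R e1 p) (r_tt p - (Q1 (p$1) / 2) *\<^sub>R e1 p) / (Q (p$1))\<^sup>2
      = (\<kappa> (p$1))\<^sup>2 + (\<mu> (p$1))\<^sup>2 - 2 * (\<tau> (p$1))\<^sup>2"
      unfolding H
      unfolding mink.scaleR_left mink.scaleR_right mink_frame[OF assms] s_def[symmetric] q_sq[OF s, symmetric]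
      using q_pos[OF s] by (simp add: power2_eq_square)
  qed (simp_all only: H mink.scaleR_left mink.scaleR_right normal_frame[OF assms] mult_zero_right scaleR_zero_right)
qed

section \<open>Derivatives and Laplacian of the Gauss map\<close>

lemma frame_partials':
  assumes "p \<in> rot_domain I"
  defines "s \<equiv> p$1"
  shows "has_partials e1 (\<kappa> s *\<^sub>R e3 p) ((q s * \<rho> s) *\<^sub>R e2 p + (q s * \<tau> s) *\<^sub>R e4 p) p"
    and "has_partials e2 (\<tau> s *\<^sub>R e4 p) ((q s * \<rho> s) *\<^sub>R e1 p - (q s * \<mu> s) *\<^sub>R e3 p) p"
  using frame_partials(1,2)[OF assms(1)] q1_eq[of s] assms by (simp_all add: rot_domain_def)

text \<open>The products with \<open>q\<close> are the coefficients of \<open>\<nu>_t\<close>. In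
  their derivatives the Codazzi equations combine with q' = q \<rho>: the term with \<mu> cancels,
  and the one with \<tau> changes sign.\<close>

lemma coefficient_partials:
  assumes "p \<in> rot_domain I"
  defines "s \<equiv> p$1"
  shows "has_partials (\<lambda>p. \<kappa> (p$1)) (deriv \<kappa> s) 0 p"
    and "has_partials (\<lambda>p. \<tau> (p$1)) (\<kappa> s * \<sigma> s - 2 * \<rho> s * \<tau> s) 0 p"
    and "has_partials (\<lambda>p. q (p$1) * \<mu> (p$1)) (q s * (\<rho> s * \<kappa> s + \<tau> s * \<sigma> s)) 0 p"
    and "has_partials (\<lambda>p. - (q (p$1) * \<tau> (p$1))) (q s * (\<rho> s * \<tau> s - \<kappa> s * \<sigma> s)) 0 p"
proof -
  have s: "s \<in> I" using assms by (simp add: rot_domain_def)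
  have tau: "(\<tau> has_real_derivative \<kappa> s * \<sigma> s - 2 * \<rho> s * \<tau> s) (at s)"
    using \<tau>_DERIV[OF s] Q1_eq[OF s] by simp
  have mu: "(\<mu> has_real_derivative \<rho> s * (\<kappa> s - \<mu> s) + \<tau> s * \<sigma> s) (at s)"
    using \<mu>_DERIV[OF s] by (simp add: \<rho>_def)
  have q: "(q has_real_derivative q s * \<rho> s) (at s)"
    using q_DERIV[OF s] q1_eq[OF s] by simp
  have qmu: "((\<lambda>s. q s * \<mu> s) has_real_derivative q s * (\<rho> s * \<kappa> s + \<tau> s * \<sigma> s)) (at s)"
    by (rule DERIV_cong[OF DERIV_mult[OF q mu]]) (simp add: algebra_simps)
  have qtau: "((\<lambda>s. - (q s * \<tau> s)) has_real_derivative q s * (\<rho> s * \<tau> s - \<kappa> s * \<sigma> s)) (at s)"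
    by (rule DERIV_cong[OF DERIV_minus[OF DERIV_mult[OF q tau]]]) (simp add: algebra_simps)
  note V = has_real_derivative_iff_has_vector_derivative s_def
  show "has_partials (\<lambda>p. \<kappa> (p$1)) (deriv \<kappa> s) 0 p"
    by (rule has_partials_fst[OF \<kappa>_DERIV[OF s, unfolded V], folded V])
  show "has_partials (\<lambda>p. \<tau> (p$1)) (\<kappa> s * \<sigma> s - 2 * \<rho> s * \<tau> s) 0 p"
    using has_partials_fst[OF tau[unfolded V]] by (simp add: s_def)
  show "has_partials (\<lambda>p. q (p$1) * \<mu> (p$1)) (q s * (\<rho> s * \<kappa> s + \<tau> s * \<sigma> s)) 0 p"
    using has_partials_fst[OF qmu[unfolded V]] by (simp add: s_def)
  show "has_partials (\<lambda>p. - (q (p$1) * \<tau> (p$1))) (q s * (\<rho> s * \<tau> s - \<kappa> s * \<sigma> s)) 0 p"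
    using has_partials_fst[OF qtau[unfolded V]] by (simp add: s_def)
qed

definition \<nu>_s :: "real^2 \<Rightarrow> real^4^4" where
  "\<nu>_s p = \<kappa> (p$1) *\<^sub>R wedge (e1 p) (e4 p) + \<tau> (p$1) *\<^sub>R wedge (e2 p) (e3 p)"
definition \<nu>_t :: "real^2 \<Rightarrow> real^4^4" where
  "\<nu>_t p = (q (p$1) * \<mu> (p$1)) *\<^sub>R wedge (e2 p) (e4 p) + (- (q (p$1) * \<tau> (p$1))) *\<^sub>R wedge (e1 p) (e3 p)"

text \<open>Instances of antisymmetry oriented towards increasing indices, so that they terminate as
  rewrite rules.\<close>

lemma wedge_frame_sort:
  "wedge (e2 p) (e1 p) = - wedge (e1 p) (e2 p)" "wedge (e3 p) (e1 p) = - wedge (e1 p) (e3 p)"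
  "wedge (e4 p) (e1 p) = - wedge (e1 p) (e4 p)" "wedge (e3 p) (e2 p) = - wedge (e2 p) (e3 p)"
  "wedge (e4 p) (e2 p) = - wedge (e2 p) (e4 p)" "wedge (e4 p) (e3 p) = - wedge (e3 p) (e4 p)"
  by (rule wedge_commute)+

lemmas wedge_frame_simps = wedge_frame_sort wedge_self wedge.add_left wedge.add_right
  wedge.diff_left wedge.diff_right wedge.minus_left wedge.minus_right wedge.scaleR_left wedge.scaleR_right

lemma \<nu>_partials:
  assumes p: "p \<in> rot_domain I"
  shows "has_partials (\<lambda>p. wedge (e3 p) (e4 p)) (\<nu>_s p) (\<nu>_t p) p"
proof -
  note w = has_partials_bilinear[OF bounded_bilinear_wedge e3_partials[OF p] e4_partials[OF p]]
  show ?thesis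
    by (rule has_partials_eq_rhs[OF w])
      (simp_all add: \<nu>_s_def \<nu>_t_def wedge_frame_simps algebra_simps)
qed

lemma \<nu>_s_partials:
  assumes p: "p \<in> rot_domain I"
  defines "s \<equiv> p$1"
  shows "has_partials \<nu>_s
    (deriv \<kappa> s *\<^sub>R wedge (e1 p) (e4 p) + (\<kappa> s * \<sigma> s - 2 * \<rho> s * \<tau> s) *\<^sub>R wedge (e2 p) (e3 p)
      + (\<kappa> s * \<kappa> s - \<tau> s * \<tau> s) *\<^sub>R wedge (e3 p) (e4 p) - (2 * \<kappa> s * \<tau> s) *\<^sub>R wedge (e1 p) (e2 p))
    ((q s * (\<rho> s * \<kappa> s + \<tau> s * \<sigma> s)) *\<^sub>R wedge (e2 p) (e4 p)
      + (q s * (\<rho> s * \<tau> s - \<kappa> s * \<sigma> s)) *\<^sub>R wedge (e1 p) (e3 p)) p"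
proof -
  note w = has_partials_bilinear[OF bounded_bilinear_wedge]
  note h = has_partials_add[OF
    has_partials_scaleR[OF coefficient_partials(1)[OF p] w[OF frame_partials'(1)[OF p] e4_partials[OF p]]]
    has_partials_scaleR[OF coefficient_partials(2)[OF p] w[OF frame_partials'(2)[OF p] e3_partials[OF p]]]]
  show ?thesis
    unfolding \<nu>_s_def [abs_def]
    by (rule has_partials_eq_rhs[OF h])
      (simp_all add: s_def wedge_frame_simps mult_two_bivector algebra_simps)
qed

text \<open>The \<open>s\<close>-derivative here has the same form as the
  \<open>t\<close>-derivative in \<open>\<nu>_s_partials\<close>, as \<open>laplacian_eq\<close>
  requires. The Codazzi equations produce this agreement.\<close>

lemma \<nu>_t_partials:
  assumes p: "p \<in> rot_domain I"
  defines "s \<equiv> p$1"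
  shows "has_partials \<nu>_t
    ((q s * (\<rho> s * \<kappa> s + \<tau> s * \<sigma> s)) *\<^sub>R wedge (e2 p) (e4 p)
      + (q s * (\<rho> s * \<tau> s - \<kappa> s * \<sigma> s)) *\<^sub>R wedge (e1 p) (e3 p))
    ((q s * q s) *\<^sub>R ((\<rho> s * \<mu> s - \<tau> s * \<sigma> s) *\<^sub>R wedge (e1 p) (e4 p)
      + (\<tau> s * \<tau> s - \<mu> s * \<mu> s) *\<^sub>R wedge (e3 p) (e4 p)
      - (2 * \<mu> s * \<tau> s) *\<^sub>R wedge (e1 p) (e2 p)
      - (\<mu> s * \<sigma> s + \<tau> s * \<rho> s) *\<^sub>R wedge (e2 p) (e3 p))) p"
proof -
  note w = has_partials_bilinear[OF bounded_bilinear_wedge]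
  note h = has_partials_add[OF
    has_partials_scaleR[OF coefficient_partials(3)[OF p] w[OF frame_partials'(2)[OF p] e4_partials[OF p]]]
    has_partials_scaleR[OF coefficient_partials(4)[OF p] w[OF frame_partials'(1)[OF p] e3_partials[OF p]]]]
  show ?thesis
    unfolding \<nu>_t_def [abs_def]
    by (rule has_partials_eq_rhs[OF h])
      (simp_all add: s_def wedge_frame_simps mult_two_bivector algebra_simps)
qed

text \<open>The bivectors \<open>e1 \<and> e3\<close> and \<open>e2 \<and> e4\<close> are absent
  because in the second derivatives they occur only in the mixed one, which a diagonal metric does
  not see. The coefficient of \<open>e1 \<and> e4\<close> is the derivative of \<kappa> + \<mu> by
  \<open>\<mu>_DERIV\<close>.\<close>

lemma laplacian_gauss_map:
  assumes p: "p \<in> rot_domain I"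
  defines "s \<equiv> p$1"
  shows "laplacian (double_rot a b x w) (gauss_map (double_rot a b x w)) p =
    (\<kappa> s * \<kappa> s + \<mu> s * \<mu> s - 2 * \<tau> s * \<tau> s) *\<^sub>R wedge (e3 p) (e4 p)
    + (2 * (\<tau> s * (\<mu> s - \<kappa> s))) *\<^sub>R wedge (e1 p) (e2 p)
    + (deriv \<kappa> s + \<rho> s * (\<kappa> s - \<mu> s) + \<tau> s * \<sigma> s) *\<^sub>R wedge (e1 p) (e4 p)
    + ((\<kappa> s + \<mu> s) * \<sigma> s) *\<^sub>R wedge (e2 p) (e3 p)"
proof -
  have s: "s \<in> I" using assms by (simp add: rot_domain_def)
  have "has_partials (gauss_map (double_rot a b x w)) (\<nu>_s p) (\<nu>_t p) p" if "p \<in> rot_domain I" for p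
    by (rule has_partials_cong[OF open_U that _ \<nu>_partials[OF that]]) (simp add: gauss_map_double_rot)
  note L = laplacian_eq[OF p frame_exists[OF p] this \<nu>_s_partials[OF p] \<nu>_t_partials[OF p]]
  have cancel: "(1 / Q (p$1)) *\<^sub>R (q (p$1) * q (p$1)) *\<^sub>R Z = Z" for Z :: "real^4^4"
    using Q_pos[OF s] q_sq[OF s] by (simp add: s_def)
  \<comment> \<open>Stated for arbitrary scalars and matrices, so that it reduces to a polynomial
    identity in each entry.\<close>
  have collect: "k' *\<^sub>R B14 + (k * g - 2 * r * t) *\<^sub>R B23 + (k * k - t * t) *\<^sub>R B34 - (2 * k * t) *\<^sub>R B12
      - ((r * m - t * g) *\<^sub>R B14 + (t * t - m * m) *\<^sub>R B34 - (2 * m * t) *\<^sub>R B12 - (m * g + t * r) *\<^sub>R B23)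
      + r *\<^sub>R (k *\<^sub>R B14 + t *\<^sub>R B23)
    = (k * k + m * m - 2 * t * t) *\<^sub>R B34 + (2 * (t * (m - k))) *\<^sub>R B12
      + (k' + r * (k - m) + t * g) *\<^sub>R B14 + ((k + m) * g) *\<^sub>R B23"
    for k' k g r t m and B12 B14 B23 B34 :: "real^4^4"
    by (simp add: vec_eq_iff) (simp add: algebra_simps)
  show ?thesis
    unfolding s_def by (rule trans[OF L], assumption, unfold cancel \<rho>_def[symmetric] \<nu>_s_def) (rule collect)
qed

text \<open>The bivectors of an orthonormal frame are mutually orthogonal, so pairing with one of
  them isolates its coefficient.\<close>

lemma wedge_frame_independent:
  assumes "p \<in> rot_domain I"
    and "A *\<^sub>R wedge (e3 p) (e4 p) + B *\<^sub>R wedge (e1 p) (e2 p) + C *\<^sub>R wedge (e1 p) (e4 p)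
      + E *\<^sub>R wedge (e2 p) (e3 p) = F *\<^sub>R wedge (e3 p) (e4 p)"
  shows "B = 0" "C = 0" "E = 0"
proof -
  note m = mink_frame[OF assms(1)]
  have "bivector_eval u v (A *\<^sub>R wedge (e3 p) (e4 p) + B *\<^sub>R wedge (e1 p) (e2 p) + C *\<^sub>R wedge (e1 p) (e4 p)
      + E *\<^sub>R wedge (e2 p) (e3 p)) = bivector_eval u v (F *\<^sub>R wedge (e3 p) (e4 p))" for u v
    by (simp only: assms(2))
  note ev = this[unfolded bivector_eval_add bivector_eval_scaleR bivector_eval_wedge]
  show "B = 0" "C = 0" "E = 0"
    using ev[of "e1 p" "e2 p"] ev[of "e1 p" "e4 p"] ev[of "e2 p" "e3 p"] by (simp_all add: m)
qed

lemma first_kind_conditions: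
  assumes "\<And>p. p \<in> rot_domain I \<Longrightarrow> laplacian (double_rot a b x w) (gauss_map (double_rot a b x w)) p
      = f p *\<^sub>R gauss_map (double_rot a b x w) p"
    and "s \<in> I"
  shows "\<tau> s * (\<mu> s - \<kappa> s) = 0" "deriv \<kappa> s + \<rho> s * (\<kappa> s - \<mu> s) + \<tau> s * \<sigma> s = 0"
    "(\<kappa> s + \<mu> s) * \<sigma> s = 0"
proof -
  \<comment> \<open>The coefficients depend on \<open>s\<close> only, so a single admissible
    \<open>t\<close> is enough.\<close>
  have p: "vector [s, pi] \<in> rot_domain I" using assms(2) by (simp add: rot_domain_def)
  show "\<tau> s * (\<mu> s - \<kappa> s) = 0" "deriv \<kappa> s + \<rho> s * (\<kappa> s - \<mu> s) + \<tau> s * \<sigma> s = 0"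
    "(\<kappa> s + \<mu> s) * \<sigma> s = 0"
    using wedge_frame_independent[OF p assms(1)[OF p, unfolded laplacian_gauss_map[OF p] gauss_map_double_rot[OF p]]]
    by simp_all
qed

subsection \<open>Classification of the profile curve\<close>

text \<open>The support function of the profile curve: the inner product of the position vector with
  \<open>e3\<close>.\<close>

definition "R s = x s * w1 s - x1 s * w s"

lemma w1_nz:
  assumes "s \<in> I"
  shows "w1 s \<noteq> 0"
proof
  assume "w1 s = 0"
  then have "x1 s * x1 s = -1" using speed[OF assms] by simp
  moreover have "x1 s * x1 s \<ge> 0" by simp
  ultimately show False by linarith
qed

lemma \<sigma>_eq_0_iff: "s \<in> I \<Longrightarrow> \<sigma> s = 0 \<longleftrightarrow> x s * x1 s = w s * w1 s"
  and \<tau>_eq_0_iff: "s \<in> I \<Longrightarrow> \<tau> s = 0 \<longleftrightarrow> R s = 0"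
  and \<mu>_eq_0_iff: "s \<in> I \<Longrightarrow> \<mu> s = 0 \<longleftrightarrow> a\<^sup>2 * x s * w1 s + b\<^sup>2 * w s * x1 s = 0"
  using Q_pos[of s] a_nz b_nz by (auto simp: \<sigma>_def \<tau>_def \<mu>_def R_def)

text \<open>The hypothesis says that position is orthogonal to velocity, hence position is
  \<open>R\<close> times the unit normal \<open>(w1, x1)\<close>.\<close>

lemma orthogonal_position:
  assumes "s \<in> I" "x s * x1 s = w s * w1 s"
  shows "x s = w1 s * R s" "w s = x1 s * R s"
  using assms(2) speed[OF assms(1)] unfolding R_def by algebra+

lemma position_nz: "s \<in> I \<Longrightarrow> x s \<noteq> 0 \<or> w s \<noteq> 0"
  using Q_pos[of s] by (auto simp: Q_def)

lemma R_nz: "s \<in> I \<Longrightarrow> x s * x1 s = w s * w1 s \<Longrightarrow> R s \<noteq> 0"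
  using orthogonal_position[of s] position_nz[of s] by auto

lemma profile_classification:
  assumes "is_interval I" and "I \<noteq> {}"
    and "\<And>s. s \<in> I \<Longrightarrow> \<tau> s * (\<mu> s - \<kappa> s) = 0"
    and "\<And>s. s \<in> I \<Longrightarrow> deriv \<kappa> s + \<rho> s * (\<kappa> s - \<mu> s) + \<tau> s * \<sigma> s = 0"
    and "\<And>s. s \<in> I \<Longrightarrow> (\<kappa> s + \<mu> s) * \<sigma> s = 0"
  shows "(\<forall>s\<in>I. x s = 0) \<or> (\<exists>c>0. \<forall>s\<in>I. (x s)\<^sup>2 - (w s)\<^sup>2 = c)"
proof -
  have cvx: "convex I" using assms(1) by (simp add: is_interval_convex)
  have "((\<lambda>s. \<kappa> s + \<mu> s) has_real_derivative 0) (at s within I)" if "s \<in> I" for s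
  proof -
    have "((\<lambda>s. \<kappa> s + \<mu> s) has_real_derivative deriv \<kappa> s + (Q1 s / (2 * Q s) * (\<kappa> s - \<mu> s) + \<tau> s * \<sigma> s)) (at s)"
      by (intro DERIV_add \<kappa>_DERIV \<mu>_DERIV that)
    then show ?thesis
      using assms(4)[OF that] by (simp add: \<rho>_def has_field_derivative_at_within add.assoc)
  qed
  from has_field_derivative_zero_constant[OF cvx this]
  obtain m where m: "\<And>s. s \<in> I \<Longrightarrow> \<kappa> s + \<mu> s = m" by blast
  show ?thesis
  proof (cases "m = 0")
    case False
    then have orth: "x s * x1 s = w s * w1 s" if "s \<in> I" for s
      using assms(5)[OF that] m[OF that] \<sigma>_eq_0_iff[OF that] by simp
    have "((\<lambda>s. (x s)\<^sup>2 - (w s)\<^sup>2) has_real_derivative 0) (at s within I)" if "s \<in> I" for s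
    proof -
      have "((\<lambda>s. (x s)\<^sup>2 - (w s)\<^sup>2) has_real_derivative 2 * (x s * x1 s) - 2 * (w s * w1 s)) (at s)"
        by (auto intro!: derivative_eq_intros x_DERIV w_DERIV that)
      then show ?thesis by (simp add: orth[OF that] has_field_derivative_at_within)
    qed
    from has_field_derivative_zero_constant[OF cvx this]
    obtain c where c: "\<And>s. s \<in> I \<Longrightarrow> (x s)\<^sup>2 - (w s)\<^sup>2 = c" by blast
    obtain s where s: "s \<in> I" using assms(2) by blast
    have "(x s)\<^sup>2 - (w s)\<^sup>2 = R s * R s"
      using orthogonal_position[OF s orth[OF s]] speed[OF s] by algebra
    then have "c > 0" using c[OF s] R_nz[OF s orth[OF s]]
      by (simp add: power2_eq_square[of "R s", symmetric])
    with c show ?thesis by blast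
  next
    case True
    \<comment> \<open>Where \<tau> is nonzero, \<mu> = \<kappa> and \<kappa> + \<mu> = 0 make both
      vanish on a whole neighbourhood. Differentiating \<mu> = 0 then gives \<sigma> = 0, position
      is normal to the curve, and \<mu> = 0 forces \<open>R\<close>, hence \<tau>, to vanish after
      all.\<close>
    have \<tau>0: "\<tau> s = 0" if s: "s \<in> I" for s
    proof (rule ccontr)
      assume nz: "\<tau> s \<noteq> 0"
      define S where "S = {t\<in>I. \<tau> t \<noteq> 0}"
      have "continuous_on I \<tau>"
        by (intro continuous_at_imp_continuous_on ballI DERIV_isCont[OF \<tau>_DERIV])
      from continuous_open_preimage[OF this open_I, of "- {0}"]
      have "open S" by (auto simp: S_def vimage_def Int_def)
      have \<kappa>\<mu>: "\<kappa> t = 0" "\<mu> t = 0" if "t \<in> S" for t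
        using that assms(3)[of t] m[of t] True by (auto simp: S_def)
      have "s \<in> S" using s nz by (simp add: S_def)
      have "Q1 s / (2 * Q s) * (\<kappa> s - \<mu> s) + \<tau> s * \<sigma> s = 0"
        by (rule DERIV_eq_on_open[OF \<open>open S\<close> \<open>s \<in> S\<close> \<kappa>\<mu>(2) \<mu>_DERIV[OF s] DERIV_const])
      with nz \<kappa>\<mu>[OF \<open>s \<in> S\<close>] have orth: "x s * x1 s = w s * w1 s"
        using \<sigma>_eq_0_iff[OF s] by simp
      have "a\<^sup>2 * x s * w1 s + b\<^sup>2 * w s * x1 s = R s * (a\<^sup>2 * (w1 s)\<^sup>2 + b\<^sup>2 * (x1 s)\<^sup>2)"
        using orthogonal_position[OF s orth] by algebra
      then have "R s * (a\<^sup>2 * (w1 s)\<^sup>2 + b\<^sup>2 * (x1 s)\<^sup>2) = 0"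
        using \<kappa>\<mu>(2)[OF \<open>s \<in> S\<close>] \<mu>_eq_0_iff[OF s] by simp
      moreover have "a\<^sup>2 * (w1 s)\<^sup>2 + b\<^sup>2 * (x1 s)\<^sup>2 > 0"
        using a_nz w1_nz[OF s] by (simp add: add_pos_nonneg)
      ultimately show False
        using nz \<tau>_eq_0_iff[OF s] by simp
    qed
    \<comment> \<open>Now \<tau> = 0 everywhere, so its Codazzi equation gives \<kappa>\<sigma> = 0.
      Since \<open>R\<close> = 0, a zero of \<sigma> would put the position vector at the origin;
      therefore \<kappa> = 0, so \<mu> = 0, and \<mu> = 0 together with \<open>R\<close> = 0 leaves
      only \<open>x\<close> = 0.\<close>
    have "x s = 0" if s: "s \<in> I" for s
    proof -
      have R0: "R s = 0" using \<tau>0[OF s] \<tau>_eq_0_iff[OF s] by simp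
      have "\<kappa> s * \<sigma> s - Q1 s / Q s * \<tau> s = 0"
        by (rule DERIV_eq_on_open[OF open_I s \<tau>0 \<tau>_DERIV[OF s] DERIV_const])
      with \<tau>0[OF s] have "\<kappa> s * \<sigma> s = 0" by simp
      moreover have "\<sigma> s \<noteq> 0"
        using R0 R_nz[OF s] \<sigma>_eq_0_iff[OF s] by blast
      ultimately have "\<mu> s = 0" using m[OF s] True by simp
      then have "a\<^sup>2 * x s * w1 s + b\<^sup>2 * w s * x1 s = 0" using \<mu>_eq_0_iff[OF s] by simp
      with R0 have "(a\<^sup>2 + b\<^sup>2) * (x s * w1 s) = 0" unfolding R_def by algebra
      then show "x s = 0" using a_nz w1_nz[OF s] by simp
    qed
    then show ?thesis by blast
  qed
qed

lemma planar_invariants: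
  assumes "\<And>s. s \<in> I \<Longrightarrow> x s = 0" "s \<in> I"
  shows "\<tau> s = 0" "\<mu> s = 0" "\<kappa> s = 0"
proof -
  have x1: "x1 s = 0" if "s \<in> I" for s
    by (rule DERIV_eq_on_open[OF open_I that assms(1) x_DERIV[OF that] DERIV_const])
  have "\<kappa> s * w1 s = 0"
    by (rule DERIV_eq_on_open[OF open_I assms(2) x1 x1_DERIV[OF assms(2)] DERIV_const])
  then show "\<kappa> s = 0" using w1_nz[OF assms(2)] by simp
  show "\<tau> s = 0" "\<mu> s = 0"
    using assms x1[OF assms(2)] by (simp_all add: \<tau>_def \<mu>_def)
qed

text \<open>On the hyperbola position equals \<open>R\<close> times \<open>e3\<close>.
  Differentiating the orthogonality of position and velocity once more gives \<kappa> = 1/R, and the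
  same position formula gives \<mu> = 1/R.\<close>

lemma hyperbolic_invariants:
  assumes "\<And>s. s \<in> I \<Longrightarrow> (x s)\<^sup>2 - (w s)\<^sup>2 = c" "s \<in> I"
  shows "\<sigma> s = 0" "R s * R s = c" "\<kappa> s * R s = 1" "\<mu> s * R s = 1"
proof -
  have orth: "x t * x1 t = w t * w1 t" if t: "t \<in> I" for t
  proof -
    have "((\<lambda>s. (x s)\<^sup>2 - (w s)\<^sup>2) has_real_derivative 2 * (x t * x1 t) - 2 * (w t * w1 t)) (at t)"
      by (auto intro!: derivative_eq_intros x_DERIV w_DERIV t)
    from DERIV_eq_on_open[OF open_I t assms(1) this DERIV_const] show ?thesis by simp
  qed
  note o = orthogonal_position[OF assms(2) orth[OF assms(2)]]
  show "\<sigma> s = 0" using orth assms(2) \<sigma>_eq_0_iff by blast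
  show "R s * R s = c"
    using o assms(1)[OF assms(2)] speed[OF assms(2)] by algebra
  have "((\<lambda>s. x s * x1 s) has_real_derivative x1 s * x1 s + \<kappa> s * w1 s * x s) (at s)"
    "((\<lambda>s. w s * w1 s) has_real_derivative w1 s * w1 s + \<kappa> s * x1 s * w s) (at s)"
    by (intro DERIV_mult x_DERIV w_DERIV x1_DERIV w1_DERIV assms(2))+
  from DERIV_eq_on_open[OF open_I assms(2) orth this]
  show "\<kappa> s * R s = 1" using speed[OF assms(2)] unfolding R_def by algebra
  have "R s * (a\<^sup>2 * x s * w1 s + b\<^sup>2 * w s * x1 s) = Q s"
    using o unfolding Q_def by algebra
  then show "\<mu> s * R s = 1"
    using Q_pos[OF assms(2)] unfolding \<mu>_def by (simp add: field_simps)
qed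

lemma hyperbolic_conditions:
  assumes "\<And>s. s \<in> I \<Longrightarrow> (x s)\<^sup>2 - (w s)\<^sup>2 = c" "s \<in> I"
  shows "\<mu> s = \<kappa> s" "deriv \<kappa> s + \<rho> s * (\<kappa> s - \<mu> s) + \<tau> s * \<sigma> s = 0"
    "(\<kappa> s)\<^sup>2 + (\<mu> s)\<^sup>2 - 2 * (\<tau> s)\<^sup>2 = 2 / c - 2 * a\<^sup>2 * b\<^sup>2 * c / (Q s)\<^sup>2"
proof -
  have h: "\<sigma> t = 0" "R t * R t = c" "\<kappa> t * R t = 1" "\<mu> t * R t = 1" if "t \<in> I" for t
    using hyperbolic_invariants[OF assms(1) that] by simp_all
  have eq: "\<kappa> t = \<mu> t" if "t \<in> I" for t
    using h(3,4)[OF that] by (metis mult_cancel_right mult_zero_right zero_neq_one)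
  then show \<mu>\<kappa>: "\<mu> s = \<kappa> s" using assms(2) by simp
  have "deriv \<kappa> s = Q1 s / (2 * Q s) * (\<kappa> s - \<mu> s) + \<tau> s * \<sigma> s"
    by (rule DERIV_eq_on_open[OF open_I assms(2) eq \<kappa>_DERIV[OF assms(2)] \<mu>_DERIV[OF assms(2)]])
  then show "deriv \<kappa> s + \<rho> s * (\<kappa> s - \<mu> s) + \<tau> s * \<sigma> s = 0"
    using h(1)[OF assms(2)] \<mu>\<kappa> by simp
  have "R s \<noteq> 0" using h(3)[OF assms(2)] by auto
  then have "\<kappa> s = 1 / R s" using h(3)[OF assms(2)] by (simp add: field_simps)
  then have "(\<kappa> s)\<^sup>2 = 1 / c"
    using h(2)[OF assms(2)] by (simp add: power2_eq_square)
  moreover have "(\<tau> s)\<^sup>2 = a\<^sup>2 * b\<^sup>2 * c / (Q s)\<^sup>2"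
    using h(2)[OF assms(2)] by (simp add: \<tau>_def R_def power2_eq_square)
  ultimately show "(\<kappa> s)\<^sup>2 + (\<mu> s)\<^sup>2 - 2 * (\<tau> s)\<^sup>2 = 2 / c - 2 * a\<^sup>2 * b\<^sup>2 * c / (Q s)\<^sup>2"
    unfolding \<mu>\<kappa> by simp
qed

section \<open>Pointwise 1-type Gauss map on the two families of surfaces\<close>

lemma laplacian_gauss_map_first_kind:
  assumes p: "p \<in> rot_domain I"
  defines "s \<equiv> p$1"
  assumes "\<tau> s * (\<mu> s - \<kappa> s) = 0" "deriv \<kappa> s + \<rho> s * (\<kappa> s - \<mu> s) + \<tau> s * \<sigma> s = 0"
    "(\<kappa> s + \<mu> s) * \<sigma> s = 0"
  shows "laplacian (double_rot a b x w) (gauss_map (double_rot a b x w)) p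
    = second_ff_norm_sq (double_rot a b x w) p *\<^sub>R gauss_map (double_rot a b x w) p"
  using assms(3-5)
  unfolding laplacian_gauss_map[OF p] gauss_map_double_rot[OF p] second_ff_norm_sq_double_rot[OF p] s_def
  by (simp only: power2_eq_square mult_zero_right scaleR_zero_left add_0_right mult.assoc)

lemma zero_in_Lambda2: "0 \<in> Lambda2"
  unfolding Lambda2_def by (rule span_zero)

lemma planar_first_kind:
  assumes "\<And>s. s \<in> I \<Longrightarrow> x s = 0"
  shows "pointwise_1_type (rot_domain I) (double_rot a b x w) (\<lambda>p. 0) 0"
  unfolding pointwise_1_type_def
proof (intro conjI ballI smooth_on_const open_rot_domain open_I zero_in_Lambda2)
  fix p :: "real^2" assume p: "p \<in> rot_domain I"
  then have s: "p$1 \<in> I" by (simp add: rot_domain_def)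
  note z = planar_invariants[OF assms s]
  have "deriv \<kappa> (p$1) = 0"
    by (rule DERIV_eq_on_open[OF open_I s planar_invariants(3)[OF assms] \<kappa>_DERIV[OF s] DERIV_const])
  then show "laplacian (double_rot a b x w) (gauss_map (double_rot a b x w)) p
      = 0 *\<^sub>R (gauss_map (double_rot a b x w) p + 0)"
    by (simp add: laplacian_gauss_map_first_kind[OF p] second_ff_norm_sq_double_rot[OF p] z)
qed

lemma hyperbolic_norm_sq:
  assumes "\<And>s. s \<in> I \<Longrightarrow> (x s)\<^sup>2 - (w s)\<^sup>2 = c" "p \<in> rot_domain I"
  shows "second_ff_norm_sq (double_rot a b x w) p = 2 / c - 2 * a\<^sup>2 * b\<^sup>2 * c / (Q (p$1))\<^sup>2"
  using hyperbolic_conditions(3)[OF assms(1)] assms(2)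
  by (simp add: second_ff_norm_sq_double_rot rot_domain_def)

lemma hyperbolic_first_kind:
  assumes "\<And>s. s \<in> I \<Longrightarrow> (x s)\<^sup>2 - (w s)\<^sup>2 = c"
  shows "pointwise_1_type (rot_domain I) (double_rot a b x w) (second_ff_norm_sq (double_rot a b x w)) 0"
  unfolding pointwise_1_type_def
proof (intro conjI ballI zero_in_Lambda2)
  note U = open_rot_domain[OF open_I]
  have "smooth_on (rot_domain I) (\<lambda>p. 2 / c - 2 * a\<^sup>2 * b\<^sup>2 * c / (Q (p$1))\<^sup>2)"
    by (intro smooth_on_diff smooth_on_divide smooth_on_const smooth_on_power smooth_on_fst[OF open_I smooth_Q] U)
      (use Q_pos in \<open>fastforce simp: rot_domain_def\<close>)
  then show "smooth_on (rot_domain I) (second_ff_norm_sq (double_rot a b x w))"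
    using smooth_on_cong[OF U hyperbolic_norm_sq[OF assms]] by simp
  fix p :: "real^2" assume p: "p \<in> rot_domain I"
  then have s: "p$1 \<in> I" by (simp add: rot_domain_def)
  show "laplacian (double_rot a b x w) (gauss_map (double_rot a b x w)) p
      = second_ff_norm_sq (double_rot a b x w) p *\<^sub>R (gauss_map (double_rot a b x w) p + 0)"
    using laplacian_gauss_map_first_kind[OF p] hyperbolic_conditions(1,2)[OF assms s]
      hyperbolic_invariants(1)[OF assms s] by simp
qed

lemma pointwise_1_type_first_kind_classification:
  assumes "is_interval I" and "I \<noteq> {}"
  shows "pointwise_1_type_first_kind (rot_domain I) (double_rot a b x w) \<longleftrightarrow>
    (\<forall>s\<in>I. x s = 0) \<or> (\<exists>c>0. \<forall>s\<in>I. (x s)\<^sup>2 - (w s)\<^sup>2 = c)"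
proof
  assume "pointwise_1_type_first_kind (rot_domain I) (double_rot a b x w)"
  then obtain f where f: "\<And>p. p \<in> rot_domain I \<Longrightarrow>
      laplacian (double_rot a b x w) (gauss_map (double_rot a b x w)) p
      = f p *\<^sub>R gauss_map (double_rot a b x w) p"
    by (auto simp: pointwise_1_type_first_kind_def pointwise_1_type_def)
  show "(\<forall>s\<in>I. x s = 0) \<or> (\<exists>c>0. \<forall>s\<in>I. (x s)\<^sup>2 - (w s)\<^sup>2 = c)"
    by (rule profile_classification[OF assms first_kind_conditions[OF f]])
next
  assume "(\<forall>s\<in>I. x s = 0) \<or> (\<exists>c>0. \<forall>s\<in>I. (x s)\<^sup>2 - (w s)\<^sup>2 = c)"
  then show "pointwise_1_type_first_kind (rot_domain I) (double_rot a b x w)"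
    unfolding pointwise_1_type_first_kind_def
    using planar_first_kind hyperbolic_first_kind by blast
qed

text \<open>Unit speed keeps w' away from 0, so \<open>w\<close> is a parameter for the profile
  curve by Rolle's theorem. This is why images can be described through
  \<open>height\<close>.\<close>

lemma inj_w:
  assumes "is_interval I"
  shows "inj_on w I"
proof (rule linorder_inj_onI)
  fix s t assume st: "s < t" "s \<in> I" "t \<in> I"
  then have I: "u \<in> I" if "s \<le> u" "u \<le> t" for u
    using assms that mem_is_interval_1_I by blast
  show "w s \<noteq> w t"
  proof
    assume "w s = w t"
    then obtain z where "s < z" "z < t" "(w has_real_derivative 0) (at z)"
      using Rolle[OF st(1)] w_DERIV I DERIV_continuous_on
      by (metis DERIV_isCont continuous_at_imp_continuous_on atLeastAtMost_iff less_eq_real_def real_differentiable_def)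
    then show False
      using DERIV_unique[OF w_DERIV, of z 0] w1_nz[of z] I by simp
  qed
qed auto

lemma open_w_image:
  assumes "is_interval I"
  shows "open (w ` I)"
  using invariance_of_domain[OF _ open_I inj_w[OF assms]] w_DERIV
  by (meson DERIV_isCont continuous_at_imp_continuous_on)

subsection \<open>Images of double rotational surfaces\<close>

text \<open>Some nonzero covector \<open>l\<close> is constant on the plane. By
  \<open>trig_hyperbolic_independent\<close>, on each rotation orbit its components are killed by
  \<open>x\<close> or by \<open>w\<close>, which contradicts \<open>l\<close> being nonzero once
  both are nonzero at one parameter.\<close>

lemma x_zero_of_subset_plane:
  assumes "is_interval I" "timelike_plane P" "double_rot a b x w ` rot_domain I \<subseteq> P" "s \<in> I"
  shows "x s = 0"
proof (rule ccontr)
  assume xs: "x s \<noteq> 0"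
  obtain c u v where P: "P = {c + \<alpha> *\<^sub>R u + \<beta> *\<^sub>R v |\<alpha> \<beta>. True}"
    using assms(2) by (auto simp: timelike_plane_def)
  have "dim {u, v} \<le> card {u, v}" by (rule dim_le_card') simp
  also have "\<dots> \<le> 2" by (simp add: card_insert_if)
  finally have "dim {u, v} < DIM(real^4)" by simp
  then obtain l where l: "l \<noteq> 0" "\<And>y. y \<in> span {u, v} \<Longrightarrow> orthogonal l y"
    using orthogonal_to_subspace_exists by blast
  have const: "l \<bullet> y = l \<bullet> c" if "y \<in> P" for y
    using that l(2)[of u] l(2)[of v]
    by (auto simp: P orthogonal_def inner_add_right span_base)
  have zero: "l$1 * x z = 0" "l$2 * x z = 0" "l$3 * w z = 0" "l$4 * w z = 0" if "z \<in> I" for z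
  proof -
    have "l$1 * x z * cos (a*t) + l$2 * x z * sin (a*t) + l$3 * w z * sinh (b*t) + l$4 * w z * cosh (b*t) = l \<bullet> c"
      if "t \<in> {0<..<2*pi}" for t
    proof -
      have "vector [z, t] \<in> rot_domain I" using that \<open>z \<in> I\<close> by (simp add: rot_domain_def)
      then have "double_rot a b x w (vector [z, t]) \<in> P" using assms(3) by blast
      from const[OF this] show ?thesis
        by (simp add: double_rot_def Let_def inner_vec_def sum_4 vector_4 mult.assoc)
    qed
    from trig_hyperbolic_independent[OF a_nz b_nz this]
    show "l$1 * x z = 0" "l$2 * x z = 0" "l$3 * w z = 0" "l$4 * w z = 0" by auto
  qed
  \<comment> \<open>\<open>w\<close> may vanish at \<open>s\<close> itself, but it is injective, so
    it is nonzero at one of two different parameters in the open set where \<open>x\<close> is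
    nonzero.\<close>
  define S where "S = {z\<in>I. x z \<noteq> 0}"
  have "continuous_on I x"
    by (intro continuous_at_imp_continuous_on ballI DERIV_isCont[OF x_DERIV])
  from continuous_open_preimage[OF this open_I, of "- {0}"]
  have "open S" by (auto simp: S_def vimage_def Int_def)
  moreover have "s \<in> S" using xs assms(4) by (simp add: S_def)
  ultimately have "S \<noteq> {s}" using not_open_singleton by metis
  then obtain z where "z \<in> S" "z \<noteq> s" using \<open>s \<in> S\<close> by blast
  then have "w z \<noteq> w s" using inj_w[OF assms(1)] assms(4) by (auto simp: S_def inj_on_def)
  then have "w z \<noteq> 0 \<or> w s \<noteq> 0" by auto
  then obtain u where "u \<in> I" "x u \<noteq> 0" "w u \<noteq> 0"
    using \<open>z \<in> S\<close> \<open>s \<in> S\<close> unfolding S_def by blast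
  with zero[of u] have "l$1 = 0" "l$2 = 0" "l$3 = 0" "l$4 = 0" by auto
  then have "l = 0" by (simp add: vec_eq_iff forall_4)
  with l(1) show False by simp
qed

text \<open>The square of the position vector depends only on the point: it is
  \<open>(x s)\<^sup>2 - (w s)\<^sup>2\<close> on one surface and \<open>r0\<^sup>2\<close>
  everywhere on the other.\<close>

lemma hyperbola_of_subset_F_surface:
  assumes "double_rot a b x w ` rot_domain I \<subseteq> F_surface a b r0 ` rot_domain UNIV" "s \<in> I"
  shows "(x s)\<^sup>2 - (w s)\<^sup>2 = r0\<^sup>2"
proof -
  have "vector [s, pi] \<in> rot_domain I" using assms(2) by (simp add: rot_domain_def)
  then have "double_rot a b x w (vector [s, pi]) \<in> F_surface a b r0 ` rot_domain UNIV"
    using assms(1) by blast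
  then obtain p where p: "double_rot a b x w (vector [s, pi]) = F_surface a b r0 p" by blast
  have "(x s)\<^sup>2 - (w s)\<^sup>2 = mink (double_rot a b x w (vector [s, pi])) (double_rot a b x w (vector [s, pi]))"
    by (simp add: double_rot_eq_rotv mink_rotv power2_eq_square)
  also have "\<dots> = r0\<^sup>2 * ((cosh (p$1 / r0))\<^sup>2 - (sinh (p$1 / r0))\<^sup>2)"
    unfolding p by (simp add: F_surface_def double_rot_eq_rotv mink_rotv power2_eq_square algebra_simps)
  finally show ?thesis by (simp add: hyperbolic_pythagoras)
qed

text \<open>The surface lies in the plane of the last two coordinates, where \<open>height\<close>
  and \<open>arsinh (y$3 / height y)\<close> are continuous hyperbolic polar coordinates with values
  \<open>w s\<close> and \<open>b * t\<close>. The image is thus a preimage of open sets.\<close>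

lemma open_part_plane:
  assumes "is_interval I" "\<And>s. s \<in> I \<Longrightarrow> x s = 0"
  shows "\<exists>P. timelike_plane P \<and> open_part (double_rot a b x w ` rot_domain I) P"
proof -
  define P :: "(real^4) set" where "P = {y. y$1 = 0 \<and> y$2 = 0}"
  have "timelike_plane P"
    unfolding timelike_plane_def
  proof (intro exI conjI)
    show "mink (axis 3 1) (axis 3 1) = 1" "mink (axis 4 1) (axis 4 1) = -1" "mink (axis 3 1) (axis 4 1) = 0"
      by (simp_all add: mink_def axis_def)
    show "P = {0 + \<alpha> *\<^sub>R axis 3 1 + \<beta> *\<^sub>R axis 4 1 |\<alpha> \<beta>. True}"
    proof (intro set_eqI iffI)
      fix y :: "real^4" assume "y \<in> P"
      then have "y = 0 + y$3 *\<^sub>R axis 3 1 + y$4 *\<^sub>R axis 4 1"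
        by (simp add: P_def vec_eq_iff forall_4 axis_def)
      then show "y \<in> {0 + \<alpha> *\<^sub>R axis 3 1 + \<beta> *\<^sub>R axis 4 1 |\<alpha> \<beta>. True}" by blast
    qed (auto simp: P_def axis_def)
  qed
  \<comment> \<open>The timelike vectors of the plane: the region where \<open>height\<close> is
    nonzero and the polar coordinates exist.\<close>
  define P0 where "P0 = P \<inter> {y. \<bar>y$3\<bar> < \<bar>y$4\<bar>}"
  have "open {y::real^4. \<bar>y$3\<bar> < \<bar>y$4\<bar>}"
    by (intro open_Collect_less continuous_intros)
  then have "openin (top_of_set P) P0"
    unfolding P0_def by (rule openin_open_Int)
  have h: "height y \<noteq> 0" "(height y)\<^sup>2 = (y$4)\<^sup>2 - (y$3)\<^sup>2" "y$4 / height y > 0" if "y \<in> P0" for y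
  proof -
    have "(y$3)\<^sup>2 < (y$4)\<^sup>2" using that abs_le_square_iff[of "y$4" "y$3"] by (auto simp: P0_def)
    moreover from this have "y$4 \<noteq> 0" by auto
    ultimately show "height y \<noteq> 0" "(height y)\<^sup>2 = (y$4)\<^sup>2 - (y$3)\<^sup>2" "y$4 / height y > 0"
      by (auto simp: height_def divide_less_0_iff)
  qed
  have ch: "continuous_on P0 height"
    by (intro continuous_on_height) (auto simp: P0_def)
  have ct: "continuous_on P0 (\<lambda>y. arsinh (y$3 / height y))"
    by (rule continuous_on_compose2[OF continuous_on_arsinh[of UNIV] continuous_on_divide[OF _ ch]])
      (use h(1) in \<open>auto intro!: continuous_intros\<close>)
  let ?T = "(\<lambda>t. b * t) ` {0<..<2*pi}"
  have "open ?T" using open_scaling[OF b_nz, of "{0<..<2*pi}"] by simp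
  define M where "M = (P0 \<inter> height -` (w ` I)) \<inter> (P0 \<inter> (\<lambda>y. arsinh (y$3 / height y)) -` ?T)"
  have "openin (top_of_set P0) M"
    unfolding M_def
    by (intro openin_Int continuous_openin_preimage_gen ch ct open_w_image assms(1) \<open>open ?T\<close>)
  then have "openin (top_of_set P) M"
    using \<open>openin (top_of_set P) P0\<close> openin_trans by blast
  moreover have "M = double_rot a b x w ` rot_domain I"
  proof (intro set_eqI iffI)
    fix y assume y: "y \<in> M"
    then obtain s t where s: "s \<in> I" "height y = w s" and t: "t \<in> {0<..<2*pi}" "arsinh (y$3 / height y) = b * t"
      by (auto simp: M_def)
    have P0: "y \<in> P0" using y by (simp add: M_def)
    have "y$3 / w s = sinh (b*t)" using t(2) s(2) by (metis sinh_arsinh_real)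
    then have y3: "y$3 = w s * sinh (b*t)" using h(1)[OF P0] s(2) by (simp add: field_simps)
    have "(y$4)\<^sup>2 = (w s * cosh (b*t))\<^sup>2"
      using h(2)[OF P0] y3 s(2) hyperbolic_pythagoras[of "b*t"] by algebra
    then have "(y$4 / w s)\<^sup>2 = (cosh (b*t))\<^sup>2"
      using h(1)[OF P0] s(2) by (simp add: power_divide power_mult_distrib)
    then have "y$4 / w s = cosh (b*t)"
      using h(3)[OF P0] s(2) by (simp add: power2_eq_iff_nonneg)
    then have y4: "y$4 = w s * cosh (b*t)" using h(1)[OF P0] s(2) by (simp add: field_simps)
    have "y = double_rot a b x w (vector [s, t])"
      using P0 y3 y4 assms(2)[OF s(1)]
      by (simp add: double_rot_def Let_def vec_eq_iff forall_4 vector_4 P0_def P_def)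
    moreover have "vector [s, t] \<in> rot_domain I" using s t by (simp add: rot_domain_def)
    ultimately show "y \<in> double_rot a b x w ` rot_domain I" by blast
  next
    fix y assume "y \<in> double_rot a b x w ` rot_domain I"
    then obtain p where p: "y = double_rot a b x w p" "p \<in> rot_domain I" by blast
    then have s: "p$1 \<in> I" and t: "p$2 \<in> {0<..<2*pi}" by (auto simp: rot_domain_def)
    have x0: "x (p$1) = 0" by (rule assms(2)[OF s])
    then have wnz: "w (p$1) \<noteq> 0" using position_nz[OF s] by simp
    have hy: "height y = w (p$1)" by (simp add: p(1) double_rot_eq_rotv height_rotv)
    have y: "y$1 = 0" "y$2 = 0" "y$3 = w (p$1) * sinh (b * p$2)" "y$4 = w (p$1) * cosh (b * p$2)"
      by (simp_all add: p(1) double_rot_def Let_def vector_4 x0)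
    have "\<bar>sinh (b * p$2)\<bar> < cosh (b * p$2)"
      using sinh_less_cosh_real[of "b * p$2"] sinh_less_cosh_real[of "- (b * p$2)"] by auto
    then have "y \<in> P0" using wnz y by (simp add: P0_def P_def abs_mult)
    moreover have "b * p$2 \<in> ?T" using t by (rule imageI)
    ultimately show "y \<in> M" using s wnz by (simp add: M_def hy y arsinh_sinh_real)
  qed
  ultimately show ?thesis
    using \<open>timelike_plane P\<close> unfolding open_part_def by blast
qed

lemma open_part_F_surface:
  assumes "is_interval I" "c > 0" "\<And>s. s \<in> I \<Longrightarrow> (x s)\<^sup>2 - (w s)\<^sup>2 = c"
  shows "\<exists>r0. r0 \<noteq> 0 \<and> open_part (double_rot a b x w ` rot_domain I) (F_surface a b r0 ` rot_domain UNIV)"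
proof -
  have xnz: "x s \<noteq> 0" if "s \<in> I" for s
  proof
    assume "x s = 0"
    then have "- (w s)\<^sup>2 = c" using assms(3)[OF that] by simp
    then show False using assms(2) by (smt (verit) zero_le_power2)
  qed
  have "continuous_on I x"
    by (intro continuous_at_imp_continuous_on ballI DERIV_isCont[OF x_DERIV])
  then have "connected (x ` I)"
    using assms(1) by (simp add: connected_continuous_image is_interval_connected_1)
  then have int: "is_interval (x ` I)" by (simp add: is_interval_connected_1)
  have "0 \<notin> x ` I" using xnz by auto
  then have sign: "(\<forall>s\<in>I. x s > 0) \<or> (\<forall>s\<in>I. x s < 0)"
    using mem_is_interval_1_I[OF int, of _ _ 0] by (metis imageI linorder_less_linear order_less_imp_le xnz)
  \<comment> \<open>\<open>cosh\<close> is positive, so \<open>r0\<close> must carry the sign of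
    \<open>x\<close>, which is constant because \<open>I\<close> is connected and \<open>x\<close>
    has no zero.\<close>
  obtain r0 where r0: "r0\<^sup>2 = c" "\<And>s. s \<in> I \<Longrightarrow> x s / r0 > 0"
  proof (cases "\<forall>s\<in>I. x s > 0")
    case True
    then show ?thesis using that[of "sqrt c"] assms(2) by simp
  next
    case False
    then show ?thesis using that[of "- sqrt c"] sign assms(2) by (auto simp: divide_less_0_iff)
  qed
  have r0nz: "r0 \<noteq> 0" using r0(1) assms(2) by auto
  have cosh_eq: "r0 * cosh (u / r0) = x s" if "s \<in> I" "r0 * sinh (u / r0) = w s" for s u
  proof -
    have "(x s)\<^sup>2 = (r0 * cosh (u / r0))\<^sup>2"
      using assms(3)[OF that(1)]
      by (simp add: that(2)[symmetric] r0(1)[symmetric] power_mult_distrib cosh_square_eq algebra_simps)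
    then have "(x s / r0)\<^sup>2 = (cosh (u / r0))\<^sup>2"
      using r0nz by (simp add: power_divide power_mult_distrib)
    then have "x s / r0 = cosh (u / r0)"
      using r0(2)[OF that(1)] by (simp add: power2_eq_iff_nonneg)
    then show ?thesis using r0nz by (simp add: field_simps)
  qed
  let ?F = "F_surface a b r0 ` rot_domain UNIV"
  have F: "F_surface a b r0 p = rotv a b (p$2) (r0 * cosh (p$1 / r0)) 0 0 (r0 * sinh (p$1 / r0))" for p
    by (simp add: F_surface_def double_rot_eq_rotv)
  have "continuous_on ?F height"
  proof (rule continuous_on_height)
    fix y assume "y \<in> ?F" "y$4 = 0"
    then show "y$3 = 0" by (auto simp: F rotv_def vector_4)
  qed
  then have "openin (top_of_set ?F) (?F \<inter> height -` (w ` I))"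
    by (intro continuous_openin_preimage_gen open_w_image assms(1))
  moreover have "?F \<inter> height -` (w ` I) = double_rot a b x w ` rot_domain I"
  proof (intro set_eqI iffI)
    fix y assume "y \<in> ?F \<inter> height -` (w ` I)"
    then obtain p s where p: "p \<in> rot_domain UNIV" "y = F_surface a b r0 p" and s: "s \<in> I" "height y = w s"
      by auto
    have ws: "r0 * sinh (p$1 / r0) = w s" using s(2) by (simp add: p(2) F height_rotv)
    have "y = double_rot a b x w (vector [s, p$2])"
      by (simp add: p(2) F double_rot_eq_rotv ws cosh_eq[OF s(1) ws])
    moreover have "vector [s, p$2] \<in> rot_domain I" using p(1) s(1) by (simp add: rot_domain_def)
    ultimately show "y \<in> double_rot a b x w ` rot_domain I" by blast
  next
    fix y assume "y \<in> double_rot a b x w ` rot_domain I"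
    then obtain p where p: "p \<in> rot_domain I" "y = double_rot a b x w p" by auto
    then have s: "p$1 \<in> I" by (simp add: rot_domain_def)
    define u where "u = r0 * arsinh (w (p$1) / r0)"
    have ws: "r0 * sinh (u / r0) = w (p$1)"
      using r0nz by (simp add: u_def sinh_arsinh_real)
    have "y = F_surface a b r0 (vector [u, p$2])"
      by (simp add: p(2) F double_rot_eq_rotv ws cosh_eq[OF s ws])
    moreover have "vector [u, p$2] \<in> rot_domain UNIV" using p(1) by (simp add: rot_domain_def)
    moreover have "height y \<in> w ` I" using s by (simp add: p(2) double_rot_eq_rotv height_rotv)
    ultimately show "y \<in> ?F \<inter> height -` (w ` I)" by blast
  qed
  ultimately show ?thesis
    using r0nz unfolding open_part_def by auto
qed

end

lemma F_surface_double_rotational: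
  assumes "a \<noteq> 0" "b \<noteq> 0" "r0 \<noteq> 0"
  shows "double_rotational a b UNIV (\<lambda>s. r0 * cosh (s/r0)) (\<lambda>s. r0 * sinh (s/r0))"
proof
  have lin: "smooth_on UNIV (\<lambda>s::real. s / r0)"
    by (intro smooth_on_linear bounded_linear_divide open_UNIV)
  show "smooth_on UNIV (\<lambda>s. r0 * cosh (s/r0))" "smooth_on UNIV (\<lambda>s. r0 * sinh (s/r0))"
    by (intro smooth_on_mult smooth_on_const open_UNIV
        smooth_on_compose_UNIV[OF open_UNIV smooth_on_sinh_cosh(1) lin]
        smooth_on_compose_UNIV[OF open_UNIV smooth_on_sinh_cosh(2) lin])+
  fix s :: real
  have "((\<lambda>s. r0 * cosh (s/r0)) has_real_derivative sinh (s/r0)) (at s)"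
    "((\<lambda>s. r0 * sinh (s/r0)) has_real_derivative cosh (s/r0)) (at s)"
    using assms(3) by (auto intro!: derivative_eq_intros)
  then show "(deriv (\<lambda>s. r0 * cosh (s/r0)) s)\<^sup>2 - (deriv (\<lambda>s. r0 * sinh (s/r0)) s)\<^sup>2 = -1"
    using hyperbolic_pythagoras[of "s/r0"] by (simp add: DERIV_imp_deriv)
  show "0 < a\<^sup>2 * (r0 * cosh (s/r0))\<^sup>2 + b\<^sup>2 * (r0 * sinh (s/r0))\<^sup>2"
    using assms cosh_real_nonzero[of "s/r0"] by (intro add_pos_nonneg) simp_all
qed (use assms in simp_all)

theorem theorem3p9:
  fixes a b :: real and I :: "real set" and x w :: "real \<Rightarrow> real"
  assumes "a \<noteq> 0" and "b \<noteq> 0"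
    and "open I" and "is_interval I" and "I \<noteq> {}"
    and "smooth_on I x" and "smooth_on I w"
    and "\<And>s. s \<in> I \<Longrightarrow> (deriv x s)\<^sup>2 - (deriv w s)\<^sup>2 = -1"
    and "\<And>s. s \<in> I \<Longrightarrow> a\<^sup>2 * (x s)\<^sup>2 + b\<^sup>2 * (w s)\<^sup>2 > 0"
  shows "(pointwise_1_type_first_kind (rot_domain I) (double_rot a b x w) \<longleftrightarrow>
            (\<exists>P. timelike_plane P \<and> open_part (double_rot a b x w ` rot_domain I) P) \<or>
            (\<exists>r0. r0 \<noteq> 0 \<and>
               open_part (double_rot a b x w ` rot_domain I)
                         (F_surface a b r0 ` rot_domain UNIV)))
       \<and> (\<forall>r0. r0 \<noteq> 0 \<longrightarrow>
            pointwise_1_type (rot_domain UNIV) (F_surface a b r0)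
              (second_ff_norm_sq (F_surface a b r0)) 0 \<and>
            (\<forall>p\<in>rot_domain UNIV. second_ff_norm_sq (F_surface a b r0) p =
               2 / r0\<^sup>2 * (1 - a\<^sup>2 * b\<^sup>2 /
                 (a\<^sup>2 * (cosh (p$1 / r0))\<^sup>2 + b\<^sup>2 * (sinh (p$1 / r0))\<^sup>2)\<^sup>2)))"
proof (intro conjI allI impI)
  interpret double_rotational a b I x w
    by unfold_locales (use assms in auto)
  let ?M = "double_rot a b x w ` rot_domain I"
  have "(\<forall>s\<in>I. x s = 0) \<longleftrightarrow> (\<exists>P. timelike_plane P \<and> open_part ?M P)"
    using open_part_plane[OF assms(4)] x_zero_of_subset_plane[OF assms(4)]
    unfolding open_part_def by (meson openin_imp_subset)
  moreover have "(\<exists>c>0. \<forall>s\<in>I. (x s)\<^sup>2 - (w s)\<^sup>2 = c) \<longleftrightarrow>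
      (\<exists>r0. r0 \<noteq> 0 \<and> open_part ?M (F_surface a b r0 ` rot_domain UNIV))" (is "?L \<longleftrightarrow> ?R")
  proof
    show "?L \<Longrightarrow> ?R" using open_part_F_surface[OF assms(4)] by blast
    assume ?R
    then obtain r0 where r0: "r0 \<noteq> 0" "?M \<subseteq> F_surface a b r0 ` rot_domain UNIV"
      unfolding open_part_def by (meson openin_imp_subset)
    have "r0\<^sup>2 > 0" using r0(1) by simp
    with hyperbola_of_subset_F_surface[OF r0(2)] show ?L by blast
  qed
  ultimately show "pointwise_1_type_first_kind (rot_domain I) (double_rot a b x w) \<longleftrightarrow>
      (\<exists>P. timelike_plane P \<and> open_part ?M P) \<or>
      (\<exists>r0. r0 \<noteq> 0 \<and> open_part ?M (F_surface a b r0 ` rot_domain UNIV))"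
    using pointwise_1_type_first_kind_classification[OF assms(4,5)] by simp
next
  fix r0 :: real assume r0: "r0 \<noteq> 0"
  interpret F: double_rotational a b UNIV "\<lambda>s. r0 * cosh (s/r0)" "\<lambda>s. r0 * sinh (s/r0)"
    by (rule F_surface_double_rotational[OF assms(1,2) r0])
  have c: "(r0 * cosh (s/r0))\<^sup>2 - (r0 * sinh (s/r0))\<^sup>2 = r0\<^sup>2" for s
    using hyperbolic_pythagoras[of "s/r0"] by algebra
  show "pointwise_1_type (rot_domain UNIV) (F_surface a b r0) (second_ff_norm_sq (F_surface a b r0)) 0"
    unfolding F_surface_def by (rule F.hyperbolic_first_kind[OF c])
  show "\<forall>p\<in>rot_domain UNIV. second_ff_norm_sq (F_surface a b r0) p = 2 / r0\<^sup>2 * (1 - a\<^sup>2 * b\<^sup>2 /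
      (a\<^sup>2 * (cosh (p$1 / r0))\<^sup>2 + b\<^sup>2 * (sinh (p$1 / r0))\<^sup>2)\<^sup>2)"
  proof
    fix p :: "real^2" assume p: "p \<in> rot_domain UNIV"
    define K where "K = a\<^sup>2 * (cosh (p$1 / r0))\<^sup>2 + b\<^sup>2 * (sinh (p$1 / r0))\<^sup>2"
    have Q: "F.Q (p$1) = r0\<^sup>2 * K"
      by (simp add: F.Q_def K_def power_mult_distrib algebra_simps)
    then have "K \<noteq> 0" using F.Q_pos[of "p$1"] by auto
    have "second_ff_norm_sq (F_surface a b r0) p = 2 / r0\<^sup>2 - 2 * a\<^sup>2 * b\<^sup>2 * r0\<^sup>2 / (r0\<^sup>2 * K)\<^sup>2"
      using F.hyperbolic_norm_sq[OF c p] unfolding Q F_surface_def .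
    also have "\<dots> = 2 / r0\<^sup>2 * (1 - a\<^sup>2 * b\<^sup>2 / K\<^sup>2)"
      using r0 \<open>K \<noteq> 0\<close> by (simp add: field_simps power2_eq_square)
    finally show "second_ff_norm_sq (F_surface a b r0) p = 2 / r0\<^sup>2 * (1 - a\<^sup>2 * b\<^sup>2 /
      (a\<^sup>2 * (cosh (p$1 / r0))\<^sup>2 + b\<^sup>2 * (sinh (p$1 / r0))\<^sup>2)\<^sup>2)"
      unfolding K_def .
  qed
qed

end
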